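(* Let $D$ be a compact metric space with metric $d$, $\lambda$ a Radon measure on $D$ and $\mu>0$. The stationary distribution of the FIFM matching process $\{\eta_t\}$ on $D$ (defined in the context) has density, with respect to the measure $\bigoplus_{n\ge0}\bar\lambda^{n}$ on $\bigsqcup_{n\ge0}(D\times\mathbf C)^n$, given by $$\pi(\gamma)=K\,\mathbf 1(\gamma\text{ is valid})\prod_{i=1}^{|\gamma|}\frac{1}{\bar\lambda(N(\gamma_1^{i}))+i\mu},\qquad \pi(\emptyset)=K,$$ where for $\gamma=(x_1,\dots,x_n)$ we write $|\gamma|=n$ and $\gamma_1^i=(x_1,\dots,x_i)$, $\gamma$ is called valid if $\{x_1,\dots,x_n\}\cap N(\{x_1,\dots,x_n\})=\emptyset$, and $K$ is the normalizing constant given by $$K^{-1}=\sum_{n=0}^\infty\int_{(D\times\mathbf C\times\{\mathtt u,\mathtt m\})^n}\mathbf 1(\gamma\text{ is detailed-valid})\prod_{i=1}^n\frac{1}{2\lambda(D)+Q^i_{\mathtt u}(\gamma)\mu}\,(\lambda\otimes m_c\otimes m_c)^{n}(d\gamma).$$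
   Context: $\mathbf C=\{\mathtt R,\mathtt B\}$ (colors), $\bar{\mathtt R}=\mathtt B$, $\bar{\mathtt B}=\mathtt R$; $m_c$ is counting measure on the relevant two-point set; $\bar\lambda=\lambda\otimes m_c$ on $D\times\mathbf C$. For $x\in D\times\mathbf C$ write $x=(p_x,c_x)$, $N(x)=\{y\in D\times\mathbf C:c_y=\bar c_x,\ d(p_x,p_y)<1\}$, $N(A)=\bigcup_{x\in A}N(x)$. FIFM matching process: the Markov jump process whose state is a finite ordered list $\eta=(x_1,\dots,x_n)$ of elements of $D\times\mathbf C$, with transitions: for each $i$, $x_i$ is removed (order of the others kept) at rate $\mu+\bar\lambda(W_{x_i})$, where $W_{x_i}=N(x_i)\setminus N(\{x_1,\dots,x_{i-1}\})$; and at rate $\bar\lambda(dx)\mathbf 1(x\notin N(\eta))$ the element $x$ is appended at the end of the list. (I.e. red and blue particles arrive as Poisson processes with intensity $\lambda$ per unit time; an arrival is matched with the earliest present particle of opposite color within distance less than $1$, and both disappear; otherwise it joins the end of the list; present particles also leave at rate $\mu$.) Detailed-valid: a finite list $(x_1,\dots,x_n)$ of elements $x_i$ with position $p_{x_i}\in D$, color $c_{x_i}\in\mathbf C$ and mark $s_{x_i}\in\{\mathtt u,\mathtt m\}$ is detailed-valid if (1) $s_{x_1}=\mathtt u$ when $n\ge1$; (2) $s_{x_i}=s_{x_j}=\mathtt u$ and $d(p_{x_i},p_{x_j})<1$ imply $c_{x_i}=c_{x_j}$; (3) $i<j$, $s_{x_i}=\mathtt u$, $s_{x_j}=\mathtt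 m$ and $d(p_{x_i},p_{x_j})<1$ imply $c_{x_i}=c_{x_j}$. $Q^i_{\mathtt u}(\gamma)$ is the number of elements with mark $\mathtt u$ among the first $i$ elements of $\gamma$. *)

theory Defs
  imports "HOL-Probability.Probability"
begin

section \<open>Radon measures\<close>

definition radon_measure_on :: "'a::metric_space set \<Rightarrow> 'a measure \<Rightarrow> bool" where
  "radon_measure_on D M \<longleftrightarrow>
     sets M = sets (restrict_space borel D) \<and>
     (\<forall>C. compact C \<and> C \<subseteq> D \<longrightarrow> emeasure M C < \<infinity>) \<and>
     (\<forall>A\<in>sets M. emeasure M A = (SUP C\<in>{C. compact C \<and> C \<subseteq> A}. emeasure M C))"

section \<open>The disjoint union of the finite powers of a measure space\<close>

text \<open>
  A point of the \<open>n\<close>-th power is represented by a list of length \<open>n\<close>; a set of lists is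
  measurable iff its part in every power is, and its measure is the sum over \<open>n\<close> of the
  product measures of these parts. The power for \<open>n = 0\<close> is a single point of mass 1.
\<close>

definition power_part :: "'b measure \<Rightarrow> nat \<Rightarrow> 'b list set \<Rightarrow> (nat \<Rightarrow> 'b) set" where
  "power_part M n A = {f \<in> space (\<Pi>\<^sub>M i\<in>{..<n}. M). map f [0..<n] \<in> A}"

definition list_measure :: "'b measure \<Rightarrow> 'b list measure" where
  "list_measure M = measure_of (lists (space M))
     {A. A \<subseteq> lists (space M) \<and> (\<forall>n. power_part M n A \<in> sets (\<Pi>\<^sub>M i\<in>{..<n}. M))}
     (\<lambda>A. \<Sum>n. emeasure (\<Pi>\<^sub>M i\<in>{..<n}. M) (power_part M n A))"

text \<open>The set function used in \<open>list_measure\<close> is indeed a measure.\<close>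

lemma power_part_Diff: "power_part M n (lists (space M) - A) = space (\<Pi>\<^sub>M i\<in>{..<n}. M) - power_part M n A"
proof -
  have "map f [0..<n] \<in> lists (space M)" if "f \<in> space (\<Pi>\<^sub>M i\<in>{..<n}. M)" for f
  proof -
    have "f i \<in> space M" if "i < n" for i
      using PiE_mem[of f "{..<n}" "\<lambda>_. space M" i] that \<open>f \<in> _\<close> by (simp add: space_PiM)
    then show ?thesis by (intro in_listsI ballI) (auto simp only: set_map set_upt atLeastLessThan_iff)
  qed
  then show ?thesis unfolding power_part_def by blast
qed

lemma power_part_UN: "power_part M n (\<Union>i. A i) = (\<Union>i. power_part M n (A i))"
  by (auto simp: power_part_def)

lemma sigma_algebra_lists:
  "sigma_algebra (lists (space M))
     {A. A \<subseteq> lists (space M) \<and> (\<forall>n. power_part M n A \<in> sets (\<Pi>\<^sub>M i\<in>{..<n}. M))}"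
  unfolding sigma_algebra_iff2
proof (intro conjI ballI allI impI)
  show "{} \<in> {A. A \<subseteq> lists (space M) \<and> (\<forall>n. power_part M n A \<in> sets (\<Pi>\<^sub>M i\<in>{..<n}. M))}"
    by (simp add: power_part_def)
  fix s assume "s \<in> {A. A \<subseteq> lists (space M) \<and> (\<forall>n. power_part M n A \<in> sets (\<Pi>\<^sub>M i\<in>{..<n}. M))}"
  then show "lists (space M) - s \<in> {A. A \<subseteq> lists (space M) \<and> (\<forall>n. power_part M n A \<in> sets (\<Pi>\<^sub>M i\<in>{..<n}. M))}"
    by (simp add: power_part_Diff sets.Diff sets.top)
next
  fix A :: "nat \<Rightarrow> 'a list set"
  assume "range A \<subseteq> {A. A \<subseteq> lists (space M) \<and> (\<forall>n. power_part M n A \<in> sets (\<Pi>\<^sub>M i\<in>{..<n}. M))}"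
  then show "(\<Union>i. A i) \<in> {A. A \<subseteq> lists (space M) \<and> (\<forall>n. power_part M n A \<in> sets (\<Pi>\<^sub>M i\<in>{..<n}. M))}"
    by (auto simp: power_part_UN image_subset_iff intro!: sets.countable_UN)
qed auto

lemma space_list_measure: "space (list_measure M) = lists (space M)"
  unfolding list_measure_def by (rule space_measure_of) auto

lemma sets_list_measure:
  "A \<in> sets (list_measure M) \<longleftrightarrow>
     A \<subseteq> lists (space M) \<and> (\<forall>n. power_part M n A \<in> sets (\<Pi>\<^sub>M i\<in>{..<n}. M))"
proof -
  interpret sigma_algebra "lists (space M)" "{A. A \<subseteq> lists (space M) \<and> (\<forall>n. power_part M n A \<in> sets (\<Pi>\<^sub>M i\<in>{..<n}. M))}"
    by (rule sigma_algebra_lists)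
  show ?thesis unfolding list_measure_def by (subst sets_measure_of) (simp_all only: sigma_sets_eq mem_Collect_eq, blast)
qed

lemma suminf_swap_ennreal: "(\<Sum>i. \<Sum>n. f i n) = (\<Sum>n. \<Sum>i. f i n :: ennreal)"
  using nn_integral_suminf[of "\<lambda>i n. f i n" "count_space UNIV"]
  by (simp add: nn_integral_count_space_nat)

lemma emeasure_list_measure:
  assumes "A \<in> sets (list_measure M)"
  shows "emeasure (list_measure M) A = (\<Sum>n. emeasure (\<Pi>\<^sub>M i\<in>{..<n}. M) (power_part M n A))"
proof (rule emeasure_measure_of[OF list_measure_def])
  show "countably_additive (sets (list_measure M)) (\<lambda>A. \<Sum>n. emeasure (\<Pi>\<^sub>M i\<in>{..<n}. M) (power_part M n A))"
  proof (rule countably_additiveI)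
    fix B :: "nat \<Rightarrow> 'a list set"
    assume B: "range B \<subseteq> sets (list_measure M)" "disjoint_family B"
    have *: "(\<Sum>i. emeasure (\<Pi>\<^sub>M j\<in>{..<n}. M) (power_part M n (B i)))
      = emeasure (\<Pi>\<^sub>M j\<in>{..<n}. M) (power_part M n (\<Union>i. B i))" for n
      unfolding power_part_UN
    proof (rule suminf_emeasure)
      show "range (\<lambda>i. power_part M n (B i)) \<subseteq> sets (\<Pi>\<^sub>M j\<in>{..<n}. M)"
        using B(1) by (auto simp: sets_list_measure image_subset_iff)
      show "disjoint_family (\<lambda>i. power_part M n (B i))"
        using B(2) by (auto simp: disjoint_family_on_def power_part_def)
    qed
    show "(\<Sum>i. \<Sum>n. emeasure (\<Pi>\<^sub>M i\<in>{..<n}. M) (power_part M n (B i))) =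
      (\<Sum>n. emeasure (\<Pi>\<^sub>M i\<in>{..<n}. M) (power_part M n (\<Union>i. B i)))"
      unfolding *[symmetric] by (rule suminf_swap_ennreal)
  qed
qed (use assms in \<open>auto simp: positive_def power_part_def\<close>)

lemma append_measurable_set:
  assumes "\<eta> \<in> lists (space M)" "A \<in> sets (list_measure M)"
  shows "{x\<in>space M. \<eta> @ [x] \<in> A} \<in> sets M"
proof -
  let ?n = "length \<eta>"
  define g where "g x = (\<lambda>i\<in>{..<Suc ?n}. if i < ?n then \<eta> ! i else x)" for x
  have g: "g \<in> measurable M (\<Pi>\<^sub>M i\<in>{..<Suc ?n}. M)"
    unfolding g_def
  proof (rule measurable_restrict)
    fix i assume "i \<in> {..<Suc ?n}"
    show "(\<lambda>x. if i < ?n then \<eta> ! i else x) \<in> measurable M M"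
      using assms(1) by (cases "i < ?n") (auto simp: in_lists_conv_set)
  qed
  have m: "map (g x) [0..<Suc ?n] = \<eta> @ [x]" for x
    by (rule nth_equalityI) (auto simp: g_def nth_append simp del: upt_Suc)
  have "{x\<in>space M. \<eta> @ [x] \<in> A} = g -` power_part M (Suc ?n) A \<inter> space M"
    using measurable_space[OF g] by (auto simp: power_part_def m simp del: upt_Suc)
  also have "\<dots> \<in> sets M"
    using g assms(2) by (auto simp: sets_list_measure intro: measurable_sets)
  finally show ?thesis .
qed

section \<open>Markov jump processes and their stationary distributions\<close>

text \<open>
  A Markov jump process is given by its rate kernel \<open>Q\<close>: from \<open>x\<close> it jumps into \<open>dy\<close> at rate
  \<open>Q x (dy)\<close>. So it stays in \<open>x\<close> for an exponential time with parameter \<open>exit_rate Q x\<close>,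
  then moves to a point with law \<open>Q x / exit_rate Q x\<close> and starts afresh from there.
  Accordingly \<open>jump_prob Q n t x A\<close> is the probability that the process started in \<open>x\<close> makes
  exactly \<open>n\<close> jumps up to time \<open>t\<close> and is in \<open>A\<close> at time \<open>t\<close>; in the recursion the exponential
  density \<open>exit_rate Q x * exp (- exit_rate Q x * s)\<close> of the first jump time has been multiplied
  with the law of the first jump.
\<close>

definition exit_rate :: "('s \<Rightarrow> 's measure) \<Rightarrow> 's \<Rightarrow> real" where
  "exit_rate Q x = measure (Q x) (space (Q x))"

primrec jump_prob :: "('s \<Rightarrow> 's measure) \<Rightarrow> nat \<Rightarrow> real \<Rightarrow> 's \<Rightarrow> 's set \<Rightarrow> ennreal" where
  "jump_prob Q 0 t x A = ennreal (exp (- exit_rate Q x * t)) * indicator A x"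
| "jump_prob Q (Suc n) t x A =
     (\<integral>\<^sup>+ s \<in> {0..t}. ennreal (exp (- exit_rate Q x * s)) *
        (\<integral>\<^sup>+ y. jump_prob Q n (t - s) y A \<partial>Q x) \<partial>lborel)"

definition transition_prob :: "('s \<Rightarrow> 's measure) \<Rightarrow> real \<Rightarrow> 's \<Rightarrow> 's set \<Rightarrow> ennreal" where
  "transition_prob Q t x A = (\<Sum>n. jump_prob Q n t x A)"

definition stationary_distribution :: "'s measure \<Rightarrow> ('s \<Rightarrow> 's measure) \<Rightarrow> 's measure \<Rightarrow> bool" where
  "stationary_distribution S Q \<nu> \<longleftrightarrow>
     prob_space \<nu> \<and> sets \<nu> = sets S \<and>
     (\<forall>t\<ge>0. \<forall>A\<in>sets S. (\<integral>\<^sup>+ x. transition_prob Q t x A \<partial>\<nu>) = emeasure \<nu> A)"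

section \<open>The FIFM matching process\<close>

datatype color = Red | Blue

fun opposite :: "color \<Rightarrow> color" where
  "opposite Red = Blue"
| "opposite Blue = Red"

definition colored :: "'a measure \<Rightarrow> ('a \<times> color) measure" where
  "colored lam = lam \<Otimes>\<^sub>M count_space UNIV"

definition nbr :: "'a::metric_space set \<Rightarrow> 'a \<times> color \<Rightarrow> ('a \<times> color) set" where
  "nbr D x = {y \<in> D \<times> UNIV. snd y = opposite (snd x) \<and> dist (fst x) (fst y) < 1}"

definition Nbr :: "'a::metric_space set \<Rightarrow> ('a \<times> color) set \<Rightarrow> ('a \<times> color) set" where
  "Nbr D A = (\<Union>x\<in>A. nbr D x)"

definition fifm_states :: "'a measure \<Rightarrow> ('a \<times> color) list measure" where
  "fifm_states lam = list_measure (colored lam)"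

text \<open>Lists are indexed from 0, so \<open>take i \<eta>\<close> consists of the elements preceding \<open>\<eta> ! i\<close>.\<close>

definition fifm_rates ::
  "'a::metric_space set \<Rightarrow> 'a measure \<Rightarrow> real \<Rightarrow> ('a \<times> color) list \<Rightarrow> ('a \<times> color) list measure" where
  "fifm_rates D lam mu \<eta> = measure_of (space (fifm_states lam)) (sets (fifm_states lam))
     (\<lambda>A. (\<Sum>i<length \<eta>.
             (ennreal mu + emeasure (colored lam) (nbr D (\<eta> ! i) - Nbr D (set (take i \<eta>)))) *
             indicator A (take i \<eta> @ drop (Suc i) \<eta>)) +
          (\<integral>\<^sup>+ x. indicator (- Nbr D (set \<eta>)) x * indicator A (\<eta> @ [x]) \<partial>colored lam))"

text \<open>For every state, the set function used in \<open>fifm_rates\<close> is indeed a measure.\<close>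

lemma emeasure_fifm_rates:
  assumes lam: "sets lam = sets (restrict_space borel D)"
    and eta: "\<eta> \<in> space (fifm_states lam)" and A: "A \<in> sets (fifm_states lam)"
  shows "emeasure (fifm_rates D lam mu \<eta>) A =
    (\<Sum>i<length \<eta>. (ennreal mu + emeasure (colored lam) (nbr D (\<eta> ! i) - Nbr D (set (take i \<eta>)))) *
             indicator A (take i \<eta> @ drop (Suc i) \<eta>)) +
          (\<integral>\<^sup>+ x. indicator (- Nbr D (set \<eta>)) x * indicator A (\<eta> @ [x]) \<partial>colored lam)"
proof (rule emeasure_measure_of[OF fifm_rates_def])
  have sp: "space lam = D" using sets_eq_imp_space_eq[OF lam] by (simp add: space_restrict_space)
  have nb: "nbr D x \<in> sets (colored lam)" for x
  proof -
    have "nbr D x = (D \<inter> ball (fst x) 1) \<times> {opposite (snd x)}"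
      by (auto simp: nbr_def)
    moreover have "D \<inter> ball (fst x) 1 \<in> sets lam"
      unfolding lam by (simp add: sets_restrict_space)
    ultimately show ?thesis by (simp add: colored_def)
  qed
  have Nb[measurable]: "Nbr D (set \<eta>) \<in> sets (colored lam)"
    unfolding Nbr_def using nb by (intro sets.finite_UN) auto
  have app: "(\<lambda>x. indicator B (\<eta> @ [x]) :: ennreal) \<in> borel_measurable (colored lam)"
    if "B \<in> sets (fifm_states lam)" for B
  proof -
    have "{x\<in>space (colored lam). \<eta> @ [x] \<in> B} \<in> sets (colored lam)"
      using eta that by (intro append_measurable_set) (simp_all only: fifm_states_def space_list_measure)
    then have "(\<lambda>x. indicator {x\<in>space (colored lam). \<eta> @ [x] \<in> B} x :: ennreal) \<in> borel_measurable (colored lam)"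
      by measurable
    then show ?thesis by (rule measurable_cong[THEN iffD1, rotated]) (auto simp: indicator_def)
  qed
  show "countably_additive (sets (fifm_rates D lam mu \<eta>)) (\<lambda>A. (\<Sum>i<length \<eta>. (ennreal mu + emeasure (colored lam) (nbr D (\<eta> ! i) - Nbr D (set (take i \<eta>)))) *
             indicator A (take i \<eta> @ drop (Suc i) \<eta>)) +
          (\<integral>\<^sup>+ x. indicator (- Nbr D (set \<eta>)) x * indicator A (\<eta> @ [x]) \<partial>colored lam))"
  proof (rule countably_additiveI)
    fix B :: "nat \<Rightarrow> ('a \<times> color) list set"
    assume "range B \<subseteq> sets (fifm_rates D lam mu \<eta>)" and d: "disjoint_family B"
    then have B: "B i \<in> sets (fifm_states lam)" for i by (auto simp: fifm_rates_def)
    note [measurable] = app[OF B]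
    show "(\<Sum>j. (\<Sum>i<length \<eta>. (ennreal mu + emeasure (colored lam) (nbr D (\<eta> ! i) - Nbr D (set (take i \<eta>)))) *
             indicator (B j) (take i \<eta> @ drop (Suc i) \<eta>)) +
          (\<integral>\<^sup>+ x. indicator (- Nbr D (set \<eta>)) x * indicator (B j) (\<eta> @ [x]) \<partial>colored lam)) =
      (\<Sum>i<length \<eta>. (ennreal mu + emeasure (colored lam) (nbr D (\<eta> ! i) - Nbr D (set (take i \<eta>)))) *
             indicator (\<Union>j. B j) (take i \<eta> @ drop (Suc i) \<eta>)) +
          (\<integral>\<^sup>+ x. indicator (- Nbr D (set \<eta>)) x * indicator (\<Union>j. B j) (\<eta> @ [x]) \<partial>colored lam)"
      unfolding suminf_indicator[OF d, symmetric] ennreal_suminf_cmult[symmetric]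
      by (subst nn_integral_suminf, measurable)
        (simp add: suminf_add[OF summableI summableI, symmetric] suminf_sum[OF summableI] del: sum_mult_indicator)
  qed
qed (use A in \<open>auto simp: positive_def fifm_rates_def dest: sets.sets_into_space\<close>)

definition valid :: "'a::metric_space set \<Rightarrow> ('a \<times> color) list \<Rightarrow> bool" where
  "valid D \<gamma> \<longleftrightarrow> set \<gamma> \<inter> Nbr D (set \<gamma>) = {}"

definition fifm_density ::
  "'a::metric_space set \<Rightarrow> 'a measure \<Rightarrow> real \<Rightarrow> real \<Rightarrow> ('a \<times> color) list \<Rightarrow> real" where
  "fifm_density D lam mu K \<gamma> = K * of_bool (valid D \<gamma>) *
     (\<Prod>i=1..length \<gamma>. 1 / (measure (colored lam) (Nbr D (set (take i \<gamma>))) + real i * mu))"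

section \<open>Detailed-valid lists\<close>

datatype mark = Unmatched | Matched

type_synonym 'a marked = "'a \<times> color \<times> mark"

definition pos :: "'a marked \<Rightarrow> 'a" where "pos x = fst x"
definition col :: "'a marked \<Rightarrow> color" where "col x = fst (snd x)"
definition mrk :: "'a marked \<Rightarrow> mark" where "mrk x = snd (snd x)"

definition marked_measure :: "'a measure \<Rightarrow> 'a marked measure" where
  "marked_measure lam = lam \<Otimes>\<^sub>M (count_space UNIV \<Otimes>\<^sub>M count_space UNIV)"

definition detailed_valid :: "'a::metric_space marked list \<Rightarrow> bool" where
  "detailed_valid \<gamma> \<longleftrightarrow>
     (length \<gamma> \<ge> 1 \<longrightarrow> mrk (\<gamma> ! 0) = Unmatched) \<and>
     (\<forall>i<length \<gamma>. \<forall>j<length \<gamma>.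
        mrk (\<gamma> ! i) = Unmatched \<and> mrk (\<gamma> ! j) = Unmatched \<and> dist (pos (\<gamma> ! i)) (pos (\<gamma> ! j)) < 1
        \<longrightarrow> col (\<gamma> ! i) = col (\<gamma> ! j)) \<and>
     (\<forall>j<length \<gamma>. \<forall>i<j.
        mrk (\<gamma> ! i) = Unmatched \<and> mrk (\<gamma> ! j) = Matched \<and> dist (pos (\<gamma> ! i)) (pos (\<gamma> ! j)) < 1
        \<longrightarrow> col (\<gamma> ! i) = col (\<gamma> ! j))"

definition num_unmatched :: "nat \<Rightarrow> 'a marked list \<Rightarrow> nat" where
  "num_unmatched i \<gamma> = length (filter (\<lambda>x. mrk x = Unmatched) (take i \<gamma>))"

definition detailed_weight ::
  "'a::metric_space set \<Rightarrow> 'a measure \<Rightarrow> real \<Rightarrow> 'a marked list \<Rightarrow> real" where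
  "detailed_weight D lam mu \<gamma> = of_bool (detailed_valid \<gamma>) *
     (\<Prod>i=1..length \<gamma>. 1 / (2 * measure lam D + real (num_unmatched i \<gamma>) * mu))"

end

theory Submission imports Defs begin

text \<open>
  A distribution that satisfies the balance equation of a jump kernel is sub-invariant under the
  jump semigroup, by induction over the number of jumps with the equation for the last jump. If
  moreover its mean exit rate is finite, the mean number of jumps in bounded time is finite, so no
  mass is lost by explosion and the distribution is stationary. It is the only one if some state
  is reached from everywhere: a maximum of two invariant distributions is invariant.

  For the FIFM process the state reached from everywhere is the empty list. The flow into a valid
  list \<open>\<gamma>\<close> comes from the list without its last element, and from removing an element \<open>y\<close>
  outside of \<open>N(\<gamma>)\<close> from any of the \<open>|\<gamma>| + 1\<close> positions; the sum over the positions telescopes.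

  For the normalizing constant, the matched elements between two successive unmatched ones are
  integrated out: the unmatched elements form a valid list, and each run of matched elements
  contributes a geometric series that turns \<open>1 / (2 \<lambda>(D) + i \<mu>)\<close> into
  \<open>1 / (\<lambda>(N(\<gamma>\<^sub>1\<^sup>i)) + i \<mu>)\<close>.
\<close>

section \<open>Jump kernels\<close>

text \<open>The exit rate \<open>2 * L + real (length \<eta>) * mu\<close> is unbounded, so the
  semigroup is not a power series in a bounded generator and explosion has to be excluded; this
  forces the detour through sub-invariance and the mean number of jumps. A second obstacle is the
  direction of time: \<open>jump_prob\<close> recurses on the first jump, whereas balance speaks
  about a jump out of a state whose law is under control, that is, the last one.

  For FIFM the exit rate splits into \<open>2 * L - measure C (N \<eta>)\<close>, the rate of
  appending an arrival, and \<open>measure C (N \<eta>) + real (length \<eta>) * mu\<close>, the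
  rate of losing an element, and each part balances separately. Removals that lead to \<eta>
  compensate the arrivals appended to \<eta>; the arrival that creates \<eta> compensates the
  removals from \<eta>. The second relation dictates the denominators of the density, the first is
  the one that needs the telescoping.\<close>

primrec jump_integral :: "('s \<Rightarrow> 's measure) \<Rightarrow> nat \<Rightarrow> ('s \<Rightarrow> ennreal) \<Rightarrow> real \<Rightarrow> 's \<Rightarrow> ennreal" where
  "jump_integral Q 0 f t x = ennreal (exp (- exit_rate Q x * t)) * f x"
| "jump_integral Q (Suc n) f t x =
     (\<integral>\<^sup>+ s \<in> {0..t}. ennreal (exp (- exit_rate Q x * s)) *
        (\<integral>\<^sup>+ y. jump_integral Q n f (t - s) y \<partial>Q x) \<partial>lborel)"

text \<open>The recursion is run with functions in place of sets because the expansion at the last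
  jump feeds it an integrand that depends on time and is not an indicator.\<close>

lemma jump_prob_eq_jump_integral: "jump_prob Q n t x A = jump_integral Q n (indicator A) t x"
  by (induction n arbitrary: t x) simp_all

lemma measurable_indicator_Icc [measurable (raw)]:
  fixes A B C :: "'b \<Rightarrow> real"
  assumes [measurable]: "A \<in> borel_measurable N" "B \<in> borel_measurable N" "C \<in> borel_measurable N"
  shows "(\<lambda>p. indicator {A p..B p} (C p) :: ennreal) \<in> borel_measurable N"
  unfolding indicator_def[abs_def] atLeastAtMost_iff of_bool_def by measurable

text \<open>Exit rates are finite state by state, with no uniform bound: in the application they
  grow linearly with the length of the list.\<close>

locale jump_kernel =
  fixes S :: "'s measure" and Q :: "'s \<Rightarrow> 's measure"
  assumes sets_Q: "x \<in> space S \<Longrightarrow> sets (Q x) = sets S"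
    and finite_Q: "x \<in> space S \<Longrightarrow> emeasure (Q x) (space S) < \<infinity>"
    and measurable_Q: "A \<in> sets S \<Longrightarrow> (\<lambda>x. emeasure (Q x) A) \<in> borel_measurable S"
begin

abbreviation "q \<equiv> exit_rate Q"
abbreviation "J \<equiv> jump_integral Q"

lemma space_Q: "x \<in> space S \<Longrightarrow> space (Q x) = space S"
  using sets_Q sets_eq_imp_space_eq by blast

lemma finite_measure_Q: "x \<in> space S \<Longrightarrow> finite_measure (Q x)"
  using finite_Q[of x] by (intro finite_measureI) (simp add: space_Q)

lemma emeasure_Q_space: "x \<in> space S \<Longrightarrow> emeasure (Q x) (space S) = ennreal (q x)"
  using finite_measure.emeasure_eq_measure[OF finite_measure_Q] by (simp add: exit_rate_def space_Q)

lemma q_nonneg [simp]: "0 \<le> q x"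
  by (simp add: exit_rate_def)

lemma measurable_q [measurable]: "q \<in> borel_measurable S"
proof -
  have "(\<lambda>x. enn2real (emeasure (Q x) (space S))) \<in> borel_measurable S"
    using measurable_Q[OF sets.top] by measurable
  then show ?thesis
    by (rule measurable_cong[THEN iffD1, rotated]) (simp add: emeasure_Q_space)
qed

text \<open>Scaling \<open>Q x\<close> by \<open>1 / (1 + q x)\<close> makes it a subprobability
  kernel, for which integrals are measurable in the parameter; the factor is multiplied back
  afterwards. The summand 1 keeps the scaling meaningful in absorbing states.\<close>

lemma measurable_nn_integral_Q:
  assumes g: "(\<lambda>(p, y). g p y) \<in> borel_measurable (N \<Otimes>\<^sub>M S)" and h: "h \<in> measurable N S"
  shows "(\<lambda>p. \<integral>\<^sup>+ y. g p y \<partial>Q (h p)) \<in> borel_measurable N"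
proof -
  define c where "c x = ennreal (1 / (1 + q x))" for x
  define L where "L x = scale_measure (c x) (Q x)" for x
  have [measurable]: "c \<in> borel_measurable S" unfolding c_def by measurable
  have L: "L \<in> measurable S (subprob_algebra S)"
  proof (rule measurable_subprob_algebra)
    fix x assume x: "x \<in> space S"
    show "sets (L x) = sets S" by (simp add: L_def sets_Q x)
    have "emeasure (L x) (space S) = ennreal (q x / (1 + q x))"
      by (simp add: L_def c_def emeasure_Q_space x ennreal_mult[symmetric])
    also have "\<dots> \<le> 1" by (simp add: divide_le_eq_1 add_pos_nonneg)
    finally have "emeasure (L x) (space S) \<le> 1" .
    moreover have "space (L x) = space S" by (simp add: L_def space_scale_measure space_Q x)
    moreover have "space S \<noteq> {}" using x by auto
    ultimately show "subprob_space (L x)" by (intro subprob_spaceI) auto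
  next
    fix A assume A: "A \<in> sets S"
    note [measurable] = measurable_Q[OF A]
    show "(\<lambda>a. emeasure (L a) A) \<in> borel_measurable S" unfolding L_def by simp measurable
  qed
  have gx: "g p \<in> borel_measurable S" if "p \<in> space N" for p
    using measurable_compose[OF measurable_Pair1'[OF that] g] by simp
  have "(\<lambda>p. \<integral>\<^sup>+ y. g p y \<partial>L (h p)) \<in> borel_measurable N"
    by (rule nn_integral_measurable_subprob_algebra2[OF g measurable_compose[OF h L]])
  then have "(\<lambda>p. ennreal (1 + q (h p)) * (\<integral>\<^sup>+ y. g p y \<partial>L (h p))) \<in> borel_measurable N"
    using h by measurable
  then show ?thesis
  proof (rule measurable_cong[THEN iffD1, rotated])
    fix p assume p: "p \<in> space N"
    then have hp: "h p \<in> space S" using h by (rule measurable_space[rotated])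
    have gm: "g p \<in> borel_measurable (Q (h p))"
      using gx[OF p] by (simp add: measurable_cong_sets[OF sets_Q[OF hp] refl])
    have "1 + q (h p) > 0" by (simp add: add_pos_nonneg)
    then have "ennreal (1 + q (h p)) * c (h p) = 1"
      by (simp add: c_def ennreal_mult[symmetric] del: ennreal_plus)
    then show "ennreal (1 + q (h p)) * (\<integral>\<^sup>+ y. g p y \<partial>L (h p)) = (\<integral>\<^sup>+ y. g p y \<partial>Q (h p))"
      by (simp add: L_def nn_integral_scale_measure[OF gm] mult.assoc[symmetric] del: ennreal_plus)
  qed
qed

text \<open>The parameter \<open>p\<close> makes room for integrands that vary with time, so joint
  measurability in parameter, time and state is carried through the induction.\<close>

lemma measurable_jump_integral_aux:
  assumes f: "(\<lambda>(p, y). f p y) \<in> borel_measurable (N \<Otimes>\<^sub>M S)"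
  shows "(\<lambda>(p, t, x). J n (f p) t x) \<in> borel_measurable (N \<Otimes>\<^sub>M (borel \<Otimes>\<^sub>M S))"
proof (induction n)
  case 0
  note [measurable] = measurable_compose[OF measurable_Pair f, simplified]
  show ?case by (simp add: case_prod_beta') measurable
next
  case (Suc n)
  have [measurable]: "(\<lambda>r. \<integral>\<^sup>+ y. J n (f (fst (fst r))) (fst (snd (fst r)) - snd r) y \<partial>Q (snd (snd (fst r))))
      \<in> borel_measurable ((N \<Otimes>\<^sub>M (borel \<Otimes>\<^sub>M S)) \<Otimes>\<^sub>M borel)"
  proof (rule measurable_nn_integral_Q)
    show "(\<lambda>(r, y). J n (f (fst (fst r))) (fst (snd (fst r)) - snd r) y)
        \<in> borel_measurable (((N \<Otimes>\<^sub>M (borel \<Otimes>\<^sub>M S)) \<Otimes>\<^sub>M borel) \<Otimes>\<^sub>M S)"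
      using measurable_compose[OF _ Suc,
        of "\<lambda>r. (fst (fst (fst r)), fst (snd (fst (fst r))) - snd (fst r), snd r)" "((N \<Otimes>\<^sub>M (borel \<Otimes>\<^sub>M S)) \<Otimes>\<^sub>M borel) \<Otimes>\<^sub>M S"]
      by (simp add: case_prod_beta')
  qed simp
  show ?case by (simp add: case_prod_beta') measurable
qed

lemma measurable_jump_integral:
  assumes f: "(\<lambda>(p, y). f p y) \<in> borel_measurable (N \<Otimes>\<^sub>M S)"
    and T: "T \<in> borel_measurable N" and X: "X \<in> measurable N S"
  shows "(\<lambda>p. J n (f p) (T p) (X p)) \<in> borel_measurable N"
  using measurable_compose[OF measurable_Pair[OF measurable_ident measurable_Pair[OF T X]]
      measurable_jump_integral_aux[OF f]] by simp

lemma borel_measurable_Q: "x \<in> space S \<Longrightarrow> borel_measurable (Q x) = borel_measurable S"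
  by (rule measurable_cong_sets[OF sets_Q refl])

text \<open>Conditioning on the time \<open>s\<close> of the first jump and writing
  \<open>u = s + r\<close> moves the outer time integral inside. With \<open>h\<close> depending on
  time this is the induction step for the expansion at the last jump; with \<open>h\<close>
  constantly the exit rate it is the step for counting jumps.\<close>

lemma jump_integral_shift:
  assumes h: "(\<lambda>(u, y). h u y) \<in> borel_measurable (borel \<Otimes>\<^sub>M S)" and x: "x \<in> space S"
  shows "(\<integral>\<^sup>+ u \<in> {0..t}. J (Suc n) (h u) u x \<partial>lborel) =
    (\<integral>\<^sup>+ s \<in> {0..t}. ennreal (exp (- q x * s)) *
      (\<integral>\<^sup>+ y. (\<integral>\<^sup>+ r \<in> {0..t - s}. J n (h (s + r)) r y \<partial>lborel) \<partial>Q x) \<partial>lborel)"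
proof -
  interpret Qx: finite_measure "Q x" by (rule finite_measure_Q[OF x])
  interpret pair_sigma_finite "Q x" lborel ..
  define k where "k u s y = J n (h u) (u - s) y" for u s y
  have k: "(\<lambda>p. k (U p) (V p) (Y p)) \<in> borel_measurable N"
    if [measurable]: "U \<in> borel_measurable N" "V \<in> borel_measurable N" "Y \<in> measurable N S" for U V Y and N :: "'c measure"
    unfolding k_def
    by (rule measurable_jump_integral)
      (use measurable_compose[OF _ h, of "\<lambda>p. (U (fst p), snd p)" "N \<Otimes>\<^sub>M S"] in \<open>simp_all add: case_prod_beta'\<close>)
  define e where "e s = ennreal (exp (- q x * s))" for s
  have [measurable]: "e \<in> borel_measurable borel" unfolding e_def by measurable
  \<comment> \<open>The triangle \<open>0 \<le> s \<le> u \<le> t\<close>, sliced by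
    \<open>u\<close> on the left and by \<open>s\<close> on the right.\<close>
  have ind: "indicator {0..t} u * indicator {0..u} s = (indicator {0..t} s * indicator {s..t} u :: ennreal)" for u s :: real
    by (auto simp: indicator_def)
  have kQ [measurable]: "(\<lambda>p. \<integral>\<^sup>+ y. k (U p) (V p) y \<partial>Q x) \<in> borel_measurable N"
    if "U \<in> borel_measurable N" "V \<in> borel_measurable N" for U V and N :: "'c measure"
    using that x by (intro measurable_nn_integral_Q) (auto intro!: k simp: case_prod_beta')
  have "(\<integral>\<^sup>+ u \<in> {0..t}. J (Suc n) (h u) u x \<partial>lborel)
      = (\<integral>\<^sup>+ u. (\<integral>\<^sup>+ s. indicator {0..t} u * indicator {0..u} s * (e s * (\<integral>\<^sup>+ y. k u s y \<partial>Q x)) \<partial>lborel) \<partial>lborel)"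
  proof (rule nn_integral_cong)
    fix u
    have "(\<integral>\<^sup>+ s. indicator {0..t} u * indicator {0..u} s * (e s * (\<integral>\<^sup>+ y. k u s y \<partial>Q x)) \<partial>lborel)
      = indicator {0..t} u * (\<integral>\<^sup>+ s. indicator {0..u} s * (e s * (\<integral>\<^sup>+ y. k u s y \<partial>Q x)) \<partial>lborel)"
      unfolding mult.assoc by (rule nn_integral_cmult) measurable
    then show "J (Suc n) (h u) u x * indicator {0..t} u = (\<integral>\<^sup>+ s. indicator {0..t} u * indicator {0..u} s * (e s * (\<integral>\<^sup>+ y. k u s y \<partial>Q x)) \<partial>lborel)"
      by (simp add: e_def k_def mult_ac)
  qed
  also have "\<dots> = (\<integral>\<^sup>+ s. (\<integral>\<^sup>+ u. indicator {0..t} u * indicator {0..u} s * (e s * (\<integral>\<^sup>+ y. k u s y \<partial>Q x)) \<partial>lborel) \<partial>lborel)"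
    by (rule lborel_pair.Fubini') measurable
  also have "\<dots> = (\<integral>\<^sup>+ s. (\<integral>\<^sup>+ u. (indicator {0..t} s * e s) * (\<integral>\<^sup>+ y. indicator {s..t} u * k u s y \<partial>Q x) \<partial>lborel) \<partial>lborel)"
  proof (intro nn_integral_cong)
    fix s u
    have "(\<lambda>y. k u s y) \<in> borel_measurable (Q x)" using x by (simp add: borel_measurable_Q k)
    then show "indicator {0..t} u * indicator {0..u} s * (e s * (\<integral>\<^sup>+ y. k u s y \<partial>Q x)) =
      (indicator {0..t} s * e s) * (\<integral>\<^sup>+ y. indicator {s..t} u * k u s y \<partial>Q x)"
      by (simp add: ind nn_integral_cmult nn_integral_multc mult_ac)
  qed
  also have "\<dots> = (\<integral>\<^sup>+ s. (indicator {0..t} s * e s) * (\<integral>\<^sup>+ y. (\<integral>\<^sup>+ r \<in> {0..t - s}. J n (h (s + r)) r y \<partial>lborel) \<partial>Q x) \<partial>lborel)"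
  proof (intro nn_integral_cong)
    fix s
    have sQ: "sets (lborel \<Otimes>\<^sub>M Q x) = sets (borel \<Otimes>\<^sub>M S)" "sets (Q x \<Otimes>\<^sub>M lborel) = sets (S \<Otimes>\<^sub>M borel)"
      by (auto intro!: sets_pair_measure_cong simp: sets_Q[OF x])
    have "(\<integral>\<^sup>+ u. (\<integral>\<^sup>+ y. indicator {s..t} u * k u s y \<partial>Q x) \<partial>lborel) = (\<integral>\<^sup>+ y. (\<integral>\<^sup>+ u. indicator {s..t} u * k u s y \<partial>lborel) \<partial>Q x)"
    proof (rule Fubini')
      have [measurable]: "(\<lambda>p. k (snd p) s (fst p)) \<in> borel_measurable (S \<Otimes>\<^sub>M borel)"
        by (rule k) auto
      show "(\<lambda>(y, u). indicator {s..t} u * k u s y) \<in> borel_measurable (Q x \<Otimes>\<^sub>M lborel)"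
        unfolding measurable_cong_sets[OF sQ(2) refl] case_prod_beta' by measurable
    qed
    also have "\<dots> = (\<integral>\<^sup>+ y. (\<integral>\<^sup>+ r \<in> {0..t - s}. J n (h (s + r)) r y \<partial>lborel) \<partial>Q x)"
    proof (rule nn_integral_cong)
      fix y assume "y \<in> space (Q x)"
      then have y: "y \<in> space S" by (simp add: space_Q x)
      have [measurable]: "(\<lambda>u. k u s y) \<in> borel_measurable borel"
        by (rule k) (use y in auto)
      have "(\<integral>\<^sup>+ u. indicator {s..t} u * k u s y \<partial>lborel) = (\<integral>\<^sup>+ r. indicator {s..t} (s + 1 * r) * k (s + 1 * r) s y \<partial>lborel)"
        by (subst nn_integral_real_affine[where c = 1 and t = s]) simp_all
      also have "\<dots> = (\<integral>\<^sup>+ r \<in> {0..t - s}. J n (h (s + r)) r y \<partial>lborel)"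
        by (intro nn_integral_cong) (auto simp: k_def indicator_def)
      finally show "(\<integral>\<^sup>+ u. indicator {s..t} u * k u s y \<partial>lborel) = (\<integral>\<^sup>+ r \<in> {0..t - s}. J n (h (s + r)) r y \<partial>lborel)" .
    qed
    finally have "(\<integral>\<^sup>+ u. (\<integral>\<^sup>+ y. indicator {s..t} u * k u s y \<partial>Q x) \<partial>lborel) = (\<integral>\<^sup>+ y. (\<integral>\<^sup>+ r \<in> {0..t - s}. J n (h (s + r)) r y \<partial>lborel) \<partial>Q x)" .
    moreover have "(\<lambda>u. \<integral>\<^sup>+ y. indicator {s..t} u * k u s y \<partial>Q x) \<in> borel_measurable lborel"
    proof (rule measurable_nn_integral_Q)
      have [measurable]: "(\<lambda>p. k (fst p) s (snd p)) \<in> borel_measurable (lborel \<Otimes>\<^sub>M S)"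
        by (rule k) auto
      show "(\<lambda>(u, y). indicator {s..t} u * k u s y) \<in> borel_measurable (lborel \<Otimes>\<^sub>M S)"
        unfolding case_prod_beta' by measurable
    qed (use x in simp)
    ultimately show "(\<integral>\<^sup>+ u. (indicator {0..t} s * e s) * (\<integral>\<^sup>+ y. indicator {s..t} u * k u s y \<partial>Q x) \<partial>lborel)
      = (indicator {0..t} s * e s) * (\<integral>\<^sup>+ y. (\<integral>\<^sup>+ r \<in> {0..t - s}. J n (h (s + r)) r y \<partial>lborel) \<partial>Q x)"
      by (simp add: nn_integral_cmult)
  qed
  finally show ?thesis by (simp add: e_def mult_ac)
qed

end

lemma ennreal_eq_0_if_mult_bounded:
  fixes d C :: ennreal
  assumes "\<And>n. of_nat n * d \<le> C" "C < \<infinity>"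
  shows "d = 0"
proof (rule ccontr)
  assume d: "d \<noteq> 0"
  have "d \<noteq> \<top>" using assms(1)[of 1] assms(2) by (auto simp: top_unique)
  then obtain r where r: "d = ennreal r" "0 < r" using d by (cases d) auto
  obtain c where c: "C = ennreal c" "0 \<le> c" using assms(2) by (cases C) auto
  obtain n where "c < of_nat n * r" using reals_Archimedean3[OF r(2)] by blast
  then show False
    using assms(1)[of n] r c by (simp add: ennreal_of_nat_eq_real_of_nat ennreal_mult[symmetric] ennreal_le_iff)
qed

section \<open>Expansion at the last jump and the total mass of the transition probabilities\<close>

context jump_kernel
begin

text \<open>The integrand is the rate of making the last jump at time \<open>u\<close> out of
  \<open>y\<close>, weighted by the chance of then resting until \<open>t\<close> and by the value
  of \<open>f\<close> at the resting place.\<close>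

lemma measurable_discounted_Q:
  assumes f: "f \<in> borel_measurable S"
  shows "(\<lambda>(u, y). \<integral>\<^sup>+ z. ennreal (exp (- q z * (t - u))) * f z \<partial>Q y) \<in> borel_measurable (borel \<Otimes>\<^sub>M S)"
proof -
  note [measurable] = f
  have "(\<lambda>p. \<integral>\<^sup>+ z. ennreal (exp (- q z * (t - fst p))) * f z \<partial>Q (snd p)) \<in> borel_measurable (borel \<Otimes>\<^sub>M S)"
    by (rule measurable_nn_integral_Q) (simp_all add: case_prod_beta')
  then show ?thesis by (simp add: case_prod_beta')
qed

text \<open>Splitting at the last jump leaves a function of the state just before it, to which
  balance can be applied once the earlier jumps have been bounded. The induction peels off the first
  jump, at time \<open>s\<close>: discounting from \<open>s + r\<close> to \<open>t\<close> is the
  same as discounting from \<open>r\<close> to \<open>t - s\<close>.\<close>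

lemma jump_integral_Suc_forward:
  assumes f: "f \<in> borel_measurable S" and x: "x \<in> space S"
  shows "J (Suc n) f t x =
    (\<integral>\<^sup>+ u \<in> {0..t}. J n (\<lambda>y. \<integral>\<^sup>+ z. ennreal (exp (- q z * (t - u))) * f z \<partial>Q y) u x \<partial>lborel)"
  using x
proof (induction n arbitrary: t x)
  case 0
  show ?case by simp
next
  case (Suc n)
  show ?case
    unfolding jump_integral_shift[OF measurable_discounted_Q[OF f] Suc.prems]
    unfolding jump_integral.simps(2)[of Q "Suc n" f t x]
    by (intro nn_integral_cong arg_cong2[where f = "(*)"] refl)
      (simp add: Suc.IH space_Q Suc.prems algebra_simps del: jump_integral.simps)
qed

lemma measurable_J [measurable (raw)]:
  assumes f: "f \<in> borel_measurable S" and T: "T \<in> borel_measurable N" and X: "X \<in> measurable N S"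
  shows "(\<lambda>p. J n f (T p) (X p)) \<in> borel_measurable N"
  by (rule measurable_jump_integral[OF _ T X])
    (use measurable_compose[OF measurable_snd f] in \<open>simp add: case_prod_beta'\<close>)

lemma measurable_J_Q:
  assumes f: "f \<in> borel_measurable S" and T: "T \<in> borel_measurable N" and x: "x \<in> space S"
  shows "(\<lambda>s. \<integral>\<^sup>+ y. J n f (T s) y \<partial>Q x) \<in> borel_measurable N"
proof (rule measurable_nn_integral_Q)
  note [measurable] = f T
  show "(\<lambda>(s, y). J n f (T s) y) \<in> borel_measurable (N \<Otimes>\<^sub>M S)"
    unfolding case_prod_beta' by measurable
qed (use x in simp)

lemma J_measurable_Q: "f \<in> borel_measurable S \<Longrightarrow> x \<in> space S \<Longrightarrow> J n f t \<in> borel_measurable (Q x)"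
  using measurable_J[of f "\<lambda>_. t" S "\<lambda>x. x" n] by (simp add: borel_measurable_Q)

lemma jump_integral_add:
  assumes f: "f \<in> borel_measurable S" and g: "g \<in> borel_measurable S" and x: "x \<in> space S"
  shows "J n (\<lambda>x. f x + g x) t x = J n f t x + J n g t x"
  using x
proof (induction n arbitrary: t x)
  case 0
  show ?case by (simp add: algebra_simps)
next
  case (Suc n)
  note [measurable] = measurable_J_Q[OF f _ Suc.prems, of _ borel] measurable_J_Q[OF g _ Suc.prems, of _ borel]
  have "(\<integral>\<^sup>+ y. J n (\<lambda>x. f x + g x) s y \<partial>Q x) = (\<integral>\<^sup>+ y. J n f s y \<partial>Q x) + (\<integral>\<^sup>+ y. J n g s y \<partial>Q x)" for s
    by (subst nn_integral_add[symmetric])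
      (auto intro!: nn_integral_cong J_measurable_Q f g simp: Suc space_Q)
  then show ?case
    by (simp add: distrib_left distrib_right nn_integral_add)
qed

text \<open>An exponential clock of rate \<open>a\<close> either stays silent on
  \<open>[0, t]\<close> or rings. In the first form \<open>s\<close> is the time until the first
  ring, in the second \<open>t - s\<close> is the time since the last one, matching the expansions
  at the first and at the last jump.\<close>

lemma exp_integral:
  assumes "0 \<le> t" "0 \<le> (a::real)"
  shows "ennreal (exp (- a * t)) + (\<integral>\<^sup>+ s \<in> {0..t}. ennreal (exp (- a * s)) * ennreal a \<partial>lborel) = 1"
    and "ennreal (exp (- a * t)) + (\<integral>\<^sup>+ s \<in> {0..t}. ennreal a * ennreal (exp (- a * (t - s))) \<partial>lborel) = 1"
proof -
  have "(\<integral>\<^sup>+ s \<in> {0..t}. ennreal (exp (- a * s) * a) \<partial>lborel) = ennreal (- exp (- a * t) - (- exp (- a * 0)))"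
    using assms by (intro nn_integral_FTC_Icc) (auto intro!: derivative_eq_intros)
  moreover have "(\<integral>\<^sup>+ s \<in> {0..t}. ennreal (a * exp (- a * (t - s))) \<partial>lborel) = ennreal (exp (- a * (t - t)) - exp (- a * (t - 0)))"
    using assms by (intro nn_integral_FTC_Icc) (auto intro!: derivative_eq_intros)
  moreover have "exp (- a * t) \<le> 1" using assms by simp
  ultimately show "ennreal (exp (- a * t)) + (\<integral>\<^sup>+ s \<in> {0..t}. ennreal (exp (- a * s)) * ennreal a \<partial>lborel) = 1"
    "ennreal (exp (- a * t)) + (\<integral>\<^sup>+ s \<in> {0..t}. ennreal a * ennreal (exp (- a * (t - s))) \<partial>lborel) = 1"
    using assms by (simp_all add: ennreal_mult[symmetric] ennreal_plus[symmetric] del: ennreal_plus)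
qed

text \<open>The integral on the left is the probability of at least \<open>n + 1\<close> jumps up to time \<open>t\<close>:
  it averages the jump rate at the time of the jump that follows exactly \<open>n\<close> jumps.\<close>

lemma jump_integral_total:
  assumes "0 \<le> t" "x \<in> space S"
  shows "(\<Sum>k\<le>n. J k (indicator (space S)) t x) + (\<integral>\<^sup>+ u \<in> {0..t}. J n (\<lambda>x. ennreal (q x)) u x \<partial>lborel) = 1"
  using assms
proof (induction n arbitrary: t x)
  case 0
  then show ?case using exp_integral(1)[of t "q x"] by simp
next
  case (Suc n)
  let ?I = "indicator (space S) :: _ \<Rightarrow> ennreal"
  have Jq: "(\<lambda>(s, y). \<integral>\<^sup>+ u \<in> {0..t - s}. J n (\<lambda>x. ennreal (q x)) u y \<partial>lborel) \<in> borel_measurable (borel \<Otimes>\<^sub>M S)"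
    unfolding case_prod_beta' by measurable
  have [measurable]: "(\<lambda>s. \<integral>\<^sup>+ y. (\<integral>\<^sup>+ u \<in> {0..t - s}. J n (\<lambda>x. ennreal (q x)) u y \<partial>lborel) \<partial>Q x) \<in> borel_measurable borel"
    by (rule measurable_nn_integral_Q[OF Jq]) (use Suc.prems in simp)
  have Jqs: "(\<lambda>y. \<integral>\<^sup>+ u \<in> {0..t - s}. J n (\<lambda>x. ennreal (q x)) u y \<partial>lborel) \<in> borel_measurable (Q x)" for s
    using measurable_compose[OF measurable_Pair1'[of s borel S] Jq] Suc.prems by (simp add: borel_measurable_Q)
  note [measurable] = measurable_J_Q[OF _ _ Suc.prems(2), of ?I _ borel]
  have "(\<Sum>k\<le>Suc n. J k ?I t x) = ennreal (exp (- q x * t)) + (\<Sum>k\<le>n. J (Suc k) ?I t x)"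
    using Suc.prems by (subst sum.atMost_Suc_shift) simp
  also have "(\<Sum>k\<le>n. J (Suc k) ?I t x) = (\<integral>\<^sup>+ s. indicator {0..t} s * (ennreal (exp (- q x * s)) * (\<Sum>k\<le>n. \<integral>\<^sup>+ y. J k ?I (t - s) y \<partial>Q x)) \<partial>lborel)"
    by (simp add: nn_integral_sum[symmetric] sum_distrib_left sum_distrib_right mult_ac)
  finally have 1: "(\<Sum>k\<le>Suc n. J k ?I t x) = ennreal (exp (- q x * t)) +
    (\<integral>\<^sup>+ s. indicator {0..t} s * (ennreal (exp (- q x * s)) * (\<Sum>k\<le>n. \<integral>\<^sup>+ y. J k ?I (t - s) y \<partial>Q x)) \<partial>lborel)" .
  have 2: "(\<integral>\<^sup>+ u \<in> {0..t}. J (Suc n) (\<lambda>x. ennreal (q x)) u x \<partial>lborel) =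
    (\<integral>\<^sup>+ s. indicator {0..t} s * (ennreal (exp (- q x * s)) *
      (\<integral>\<^sup>+ y. (\<integral>\<^sup>+ u \<in> {0..t - s}. J n (\<lambda>x. ennreal (q x)) u y \<partial>lborel) \<partial>Q x)) \<partial>lborel)"
    by (subst jump_integral_shift[OF _ Suc.prems(2)]) (simp_all add: case_prod_beta' mult_ac del: jump_integral.simps)
  \<comment> \<open>The induction hypothesis, used in the state \<open>y\<close> after the first
    jump, gives total mass 1 for every \<open>y\<close>; integrating this against \<open>Q x\<close>
    leaves the exit rate.\<close>
  have 3: "(\<Sum>k\<le>n. \<integral>\<^sup>+ y. J k ?I (t - s) y \<partial>Q x) +
      (\<integral>\<^sup>+ y. (\<integral>\<^sup>+ u \<in> {0..t - s}. J n (\<lambda>x. ennreal (q x)) u y \<partial>lborel) \<partial>Q x) = ennreal (q x)"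
    if s: "s \<in> {0..t}" for s
  proof -
    have "(\<Sum>k\<le>n. \<integral>\<^sup>+ y. J k ?I (t - s) y \<partial>Q x) +
      (\<integral>\<^sup>+ y. (\<integral>\<^sup>+ u \<in> {0..t - s}. J n (\<lambda>x. ennreal (q x)) u y \<partial>lborel) \<partial>Q x) =
      (\<integral>\<^sup>+ y. (\<Sum>k\<le>n. J k ?I (t - s) y) + (\<integral>\<^sup>+ u \<in> {0..t - s}. J n (\<lambda>x. ennreal (q x)) u y \<partial>lborel) \<partial>Q x)"
    proof (subst nn_integral_add)
      have "(\<integral>\<^sup>+ y. (\<Sum>k\<le>n. J k ?I (t - s) y) \<partial>Q x) = (\<Sum>k\<le>n. \<integral>\<^sup>+ y. J k ?I (t - s) y \<partial>Q x)"
        by (intro nn_integral_sum J_measurable_Q Suc.prems) simp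
      then show "(\<Sum>k\<le>n. \<integral>\<^sup>+ y. J k ?I (t - s) y \<partial>Q x) +
          (\<integral>\<^sup>+ y. (\<integral>\<^sup>+ u \<in> {0..t - s}. J n (\<lambda>x. ennreal (q x)) u y \<partial>lborel) \<partial>Q x) =
        (\<integral>\<^sup>+ y. (\<Sum>k\<le>n. J k ?I (t - s) y) \<partial>Q x) +
          (\<integral>\<^sup>+ y. (\<integral>\<^sup>+ u \<in> {0..t - s}. J n (\<lambda>x. ennreal (q x)) u y \<partial>lborel) \<partial>Q x)"
        by simp
    qed (auto intro!: J_measurable_Q borel_measurable_sum Jqs Suc.prems)
    also have "\<dots> = (\<integral>\<^sup>+ y. 1 \<partial>Q x)"
      using s by (intro nn_integral_cong Suc.IH) (auto simp: space_Q Suc.prems)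
    also have "\<dots> = ennreal (q x)"
      using Suc.prems by (simp add: emeasure_Q_space space_Q)
    finally show ?thesis .
  qed
  have "(\<Sum>k\<le>Suc n. J k ?I t x) + (\<integral>\<^sup>+ u \<in> {0..t}. J (Suc n) (\<lambda>x. ennreal (q x)) u x \<partial>lborel) =
    ennreal (exp (- q x * t)) + (\<integral>\<^sup>+ s. indicator {0..t} s * (ennreal (exp (- q x * s)) * ennreal (q x)) \<partial>lborel)"
    unfolding 1 2 add.assoc
  proof (rule arg_cong2[where f = "(+)", OF refl])
    let ?A = "\<lambda>s. \<Sum>k\<le>n. \<integral>\<^sup>+ y. J k ?I (t - s) y \<partial>Q x"
    let ?B = "\<lambda>s. \<integral>\<^sup>+ y. (\<integral>\<^sup>+ u \<in> {0..t - s}. J n (\<lambda>x. ennreal (q x)) u y \<partial>lborel) \<partial>Q x"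
    let ?c = "\<lambda>s. indicator {0..t} s :: ennreal" and ?e = "\<lambda>s. ennreal (exp (- q x * s))"
    have "(\<integral>\<^sup>+ s. ?c s * (?e s * ?A s) \<partial>lborel) + (\<integral>\<^sup>+ s. ?c s * (?e s * ?B s) \<partial>lborel)
      = (\<integral>\<^sup>+ s. ?c s * (?e s * ?A s) + ?c s * (?e s * ?B s) \<partial>lborel)"
      by (rule nn_integral_add[symmetric]) measurable
    also have "\<dots> = (\<integral>\<^sup>+ s. ?c s * (?e s * ennreal (q x)) \<partial>lborel)"
    proof (rule nn_integral_cong)
      fix s
      show "?c s * (?e s * ?A s) + ?c s * (?e s * ?B s) = ?c s * (?e s * ennreal (q x))"
        unfolding distrib_left[symmetric] using 3[of s] by (cases "s \<in> {0..t}") simp_all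
    qed
    finally show "(\<integral>\<^sup>+ s. ?c s * (?e s * ?A s) \<partial>lborel) + (\<integral>\<^sup>+ s. ?c s * (?e s * ?B s) \<partial>lborel)
      = (\<integral>\<^sup>+ s. ?c s * (?e s * ennreal (q x)) \<partial>lborel)" .
  qed
  also have "\<dots> = 1"
    using exp_integral(1)[of t "q x"] Suc.prems by (simp add: mult_ac)
  finally show ?case .
qed

lemma sum_J_le_1:
  assumes "0 \<le> t" "x \<in> space S"
  shows "(\<Sum>k\<le>n. J k (indicator (space S)) t x) \<le> 1"
  unfolding jump_integral_total[OF assms, of n, symmetric] by simp

lemma transition_prob_eq: "transition_prob Q t x A = (\<Sum>n. J n (indicator A) t x)"
  by (simp add: transition_prob_def jump_prob_eq_jump_integral)

lemma measurable_transition_prob [measurable]: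
  "A \<in> sets S \<Longrightarrow> (\<lambda>x. transition_prob Q t x A) \<in> borel_measurable S"
  unfolding transition_prob_eq by (rule borel_measurable_suminf_order) (rule measurable_J, auto)

lemma transition_prob_le_1:
  assumes "0 \<le> t" "x \<in> space S"
  shows "transition_prob Q t x (space S) \<le> 1"
  unfolding transition_prob_eq
proof (rule suminf_le_const)
  fix n
  have "(\<Sum>k<n. J k (indicator (space S)) t x) \<le> (\<Sum>k\<le>n. J k (indicator (space S)) t x)"
    by (rule sum_mono2) auto
  also have "\<dots> \<le> 1" by (rule sum_J_le_1[OF assms])
  finally show "(\<Sum>k<n. J k (indicator (space S)) t x) \<le> 1" .
qed simp

lemma transition_prob_Un:
  assumes "A \<in> sets S" "B \<in> sets S" "A \<inter> B = {}" "x \<in> space S"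
  shows "transition_prob Q t x (A \<union> B) = transition_prob Q t x A + transition_prob Q t x B"
proof -
  have "indicator (A \<union> B) = (\<lambda>x. indicator A x + indicator B x :: ennreal)"
    by (rule ext) (use assms(3) in \<open>auto simp: indicator_def\<close>)
  then show ?thesis
    using assms by (simp add: transition_prob_eq jump_integral_add suminf_add)
qed

end

section \<open>Stationarity from balance\<close>

text \<open>\<open>balance\<close> is the equality of the flow into and out of every set, tested
  against functions. As an identity in \<open>[0, \<infinity>]\<close> it asks for no integrability.
  \<open>mean_rate\<close> bounds the number of jumps per unit time; balance alone does not exclude
  explosion.\<close>

locale balanced_jump_kernel = jump_kernel S Q + prob_space \<pi>
  for S :: "'s measure" and Q and \<pi> :: "'s measure" +
  assumes sets_pi: "sets \<pi> = sets S"
    and balance: "f \<in> borel_measurable S \<Longrightarrow> (\<integral>\<^sup>+ x. \<integral>\<^sup>+ y. f y \<partial>Q x \<partial>\<pi>) = (\<integral>\<^sup>+ x. ennreal (exit_rate Q x) * f x \<partial>\<pi>)"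
    and mean_rate: "(\<integral>\<^sup>+ x. ennreal (exit_rate Q x) \<partial>\<pi>) < \<infinity>"
begin

lemma space_pi: "space \<pi> = space S"
  by (rule sets_eq_imp_space_eq[OF sets_pi])

lemma borel_measurable_pi: "borel_measurable \<pi> = borel_measurable S"
  by (rule measurable_cong_sets[OF sets_pi refl])

lemma sets_pi_pair: "sets (\<pi> \<Otimes>\<^sub>M lborel) = sets (S \<Otimes>\<^sub>M borel)"
  by (intro sets_pair_measure_cong sets_pi) simp

lemma swap_pi:
  assumes "(\<lambda>(u, x). g u x) \<in> borel_measurable (borel \<Otimes>\<^sub>M S)"
  shows "(\<integral>\<^sup>+ x. (\<integral>\<^sup>+ u. g u x \<partial>lborel) \<partial>\<pi>) = (\<integral>\<^sup>+ u. (\<integral>\<^sup>+ x. g u x \<partial>\<pi>) \<partial>lborel)"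
proof -
  interpret pair_sigma_finite \<pi> lborel ..
  show ?thesis
  proof (rule Fubini'[symmetric])
    show "(\<lambda>(x, y). g y x) \<in> borel_measurable (\<pi> \<Otimes>\<^sub>M lborel)"
      using measurable_compose[OF measurable_pair_swap' assms]
      by (simp add: measurable_cong_sets[OF sets_pi_pair refl] case_prod_beta')
  qed
qed

lemma measurable_swap_pi:
  assumes "(\<lambda>(u, x). g u x) \<in> borel_measurable (borel \<Otimes>\<^sub>M S)"
  shows "(\<lambda>u. \<integral>\<^sup>+ x. g u x \<partial>\<pi>) \<in> borel_measurable borel"
proof (rule borel_measurable_nn_integral)
  have "sets (borel \<Otimes>\<^sub>M \<pi>) = sets (borel \<Otimes>\<^sub>M S)" by (intro sets_pair_measure_cong sets_pi refl)
  then show "(\<lambda>(u, x). g u x) \<in> borel_measurable (borel \<Otimes>\<^sub>M \<pi>)"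
    using assms measurable_cong_sets by blast
qed

text \<open>Paths without a jump contribute \<open>exp (- q x * t) * f x\<close>. The others are
  expanded at their last jump: the earlier jumps are absorbed by the induction hypothesis and the
  last one by \<open>balance\<close>, and the two parts add up to \<open>f\<close> by
  \<open>exp_integral\<close>. Only an inequality results, since paths with more jumps are cut
  off.\<close>

lemma subinvariant:
  assumes "f \<in> borel_measurable S" "0 \<le> t"
  shows "(\<Sum>k\<le>n. \<integral>\<^sup>+ x. J k f t x \<partial>\<pi>) \<le> (\<integral>\<^sup>+ x. f x \<partial>\<pi>)"
  using assms
proof (induction n arbitrary: t f)
  case 0
  have "(\<integral>\<^sup>+ x. J 0 f t x \<partial>\<pi>) \<le> (\<integral>\<^sup>+ x. 1 * f x \<partial>\<pi>)"
    unfolding jump_integral.simps using 0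
    by (intro nn_integral_mono mult_right_mono) (auto simp: ennreal_le_1)
  then show ?case by simp
next
  case (Suc n)
  note [measurable] = Suc.prems(1)
  define g where "g u y = (\<integral>\<^sup>+ z. ennreal (exp (- q z * (t - u))) * f z \<partial>Q y)" for u y
  have g: "(\<lambda>(u, y). g u y) \<in> borel_measurable (borel \<Otimes>\<^sub>M S)"
    unfolding g_def by (rule measurable_discounted_Q) fact
  have gu: "g u \<in> borel_measurable S" for u
    using measurable_compose[OF measurable_Pair1'[of u borel S] g] by simp
  have g': "(\<lambda>(p, y). g (fst p) y) \<in> borel_measurable ((borel \<Otimes>\<^sub>M S) \<Otimes>\<^sub>M S)"
    using measurable_compose[OF _ g, of "\<lambda>p. (fst (fst p), snd p)" "(borel \<Otimes>\<^sub>M S) \<Otimes>\<^sub>M S"] by (simp add: case_prod_beta')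
  have [measurable]: "(\<lambda>p. J k (g (fst p)) (fst p) (snd p)) \<in> borel_measurable (borel \<Otimes>\<^sub>M S)" for k
    by (rule measurable_jump_integral[OF g']) auto
  have Jg: "(\<lambda>(u, x). J k (g u) u x * indicator {0..t} u) \<in> borel_measurable (borel \<Otimes>\<^sub>M S)" for k
    unfolding case_prod_beta' by measurable
  have [measurable]: "(\<lambda>u. \<integral>\<^sup>+ x. J k (g u) u x * indicator {0..t} u \<partial>\<pi>) \<in> borel_measurable borel" for k
    by (rule measurable_swap_pi[OF Jg])
  have qm: "(\<lambda>(u, x). (ennreal (q x) * (ennreal (exp (- q x * (t - u))) * f x)) * indicator {0..t} u) \<in> borel_measurable (borel \<Otimes>\<^sub>M S)"
    unfolding case_prod_beta' by measurable
  have "(\<Sum>k\<le>Suc n. \<integral>\<^sup>+ x. J k f t x \<partial>\<pi>) = (\<integral>\<^sup>+ x. J 0 f t x \<partial>\<pi>) + (\<Sum>k\<le>n. \<integral>\<^sup>+ x. J (Suc k) f t x \<partial>\<pi>)"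
    by (subst sum.atMost_Suc_shift) simp
  also have "(\<Sum>k\<le>n. \<integral>\<^sup>+ x. J (Suc k) f t x \<partial>\<pi>) = (\<Sum>k\<le>n. \<integral>\<^sup>+ x. (\<integral>\<^sup>+ u \<in> {0..t}. J k (g u) u x \<partial>lborel) \<partial>\<pi>)"
    unfolding g_def
    by (intro sum.cong refl nn_integral_cong jump_integral_Suc_forward Suc.prems) (simp add: space_pi)
  also have "\<dots> = (\<integral>\<^sup>+ u. (\<Sum>k\<le>n. \<integral>\<^sup>+ x. J k (g u) u x * indicator {0..t} u \<partial>\<pi>) \<partial>lborel)"
    by (simp add: swap_pi[OF Jg] nn_integral_sum)
  \<comment> \<open>The induction hypothesis is needed at every time \<open>u\<close> and for the
    function \<open>g u\<close> that depends on it, hence the induction over arbitrary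
    \<open>t\<close> and \<open>f\<close>.\<close>
  also have "\<dots> \<le> (\<integral>\<^sup>+ u. (\<integral>\<^sup>+ x. g u x \<partial>\<pi>) * indicator {0..t} u \<partial>lborel)"
    by (intro nn_integral_mono) (auto simp: indicator_def Suc.IH[OF gu])
  \<comment> \<open>Balance trades the jump into a state for the exit rate of that state; what
    remains is the exponential density of the time since the last jump.\<close>
  also have "\<dots> = (\<integral>\<^sup>+ u. (\<integral>\<^sup>+ x. (ennreal (q x) * (ennreal (exp (- q x * (t - u))) * f x)) * indicator {0..t} u \<partial>\<pi>) \<partial>lborel)"
    unfolding g_def
    by (intro nn_integral_cong, subst balance) (auto simp: indicator_def)
  also have "\<dots> = (\<integral>\<^sup>+ x. f x * (\<integral>\<^sup>+ u \<in> {0..t}. ennreal (q x) * ennreal (exp (- q x * (t - u))) \<partial>lborel) \<partial>\<pi>)"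
    unfolding swap_pi[OF qm, symmetric]
    by (intro nn_integral_cong) (simp add: nn_integral_cmult[symmetric] mult_ac)
  also have "(\<integral>\<^sup>+ x. J 0 f t x \<partial>\<pi>) + \<dots> = (\<integral>\<^sup>+ x. f x * (ennreal (exp (- q x * t)) + (\<integral>\<^sup>+ u \<in> {0..t}. ennreal (q x) * ennreal (exp (- q x * (t - u))) \<partial>lborel)) \<partial>\<pi>)"
    by (subst nn_integral_add[symmetric]) (auto simp: borel_measurable_pi distrib_left mult_ac)
  also have "\<dots> = (\<integral>\<^sup>+ x. f x \<partial>\<pi>)"
    by (simp only: exp_integral(2)[OF Suc.prems(2) q_nonneg] mult_1_right)
  finally show ?case by simp
qed


text \<open>The summand \<open>k\<close> is the probability of at least \<open>k + 1\<close> jumps,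
  so the sum over all \<open>k\<close> is the mean number of jumps. Sub-invariance applied to the
  exit rate itself bounds the mean jump rate at each time \<open>u\<close>.\<close>

lemma sum_mean_jumps:
  assumes "0 \<le> t"
  shows "(\<Sum>k\<le>n. \<integral>\<^sup>+ x. (\<integral>\<^sup>+ u \<in> {0..t}. J k (\<lambda>x. ennreal (q x)) u x \<partial>lborel) \<partial>\<pi>)
    \<le> ennreal t * (\<integral>\<^sup>+ x. ennreal (q x) \<partial>\<pi>)"
proof -
  have Jq: "(\<lambda>(u, x). J k (\<lambda>x. ennreal (q x)) u x * indicator {0..t} u) \<in> borel_measurable (borel \<Otimes>\<^sub>M S)" for k
    unfolding case_prod_beta' by measurable
  note [measurable] = measurable_swap_pi[OF Jq]
  have "(\<Sum>k\<le>n. \<integral>\<^sup>+ x. (\<integral>\<^sup>+ u \<in> {0..t}. J k (\<lambda>x. ennreal (q x)) u x \<partial>lborel) \<partial>\<pi>)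
    = (\<integral>\<^sup>+ u. (\<Sum>k\<le>n. \<integral>\<^sup>+ x. J k (\<lambda>x. ennreal (q x)) u x * indicator {0..t} u \<partial>\<pi>) \<partial>lborel)"
    by (simp add: swap_pi[OF Jq] nn_integral_sum)
  also have "\<dots> \<le> (\<integral>\<^sup>+ u. (\<integral>\<^sup>+ x. ennreal (q x) \<partial>\<pi>) * indicator {0..t} u \<partial>lborel)"
    by (intro nn_integral_mono) (auto simp: indicator_def subinvariant)
  also have "\<dots> = ennreal t * (\<integral>\<^sup>+ x. ennreal (q x) \<partial>\<pi>)"
    using assms by (subst nn_integral_cmult_indicator) (simp_all add: mult.commute)
  finally show ?thesis .
qed

lemma transition_prob_integral_le:
  assumes A: "A \<in> sets S" and t: "0 \<le> t"
  shows "(\<integral>\<^sup>+ x. transition_prob Q t x A \<partial>\<pi>) \<le> emeasure \<pi> A"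
proof -
  have J: "J n (indicator A) t \<in> borel_measurable S" for n
    using measurable_J[of "indicator A" "\<lambda>_. t" S "\<lambda>x. x" n] A by simp
  have "(\<integral>\<^sup>+ x. transition_prob Q t x A \<partial>\<pi>) = (\<Sum>n. \<integral>\<^sup>+ x. J n (indicator A) t x \<partial>\<pi>)"
    unfolding transition_prob_eq by (rule nn_integral_suminf) (simp add: borel_measurable_pi J)
  also have "\<dots> \<le> (\<integral>\<^sup>+ x. indicator A x \<partial>\<pi>)"
  proof (rule suminf_le_const)
    fix n
    have "(\<Sum>k<n. \<integral>\<^sup>+ x. J k (indicator A) t x \<partial>\<pi>) \<le> (\<Sum>k\<le>n. \<integral>\<^sup>+ x. J k (indicator A) t x \<partial>\<pi>)"
      by (rule sum_mono2) auto
    also have "\<dots> \<le> (\<integral>\<^sup>+ x. indicator A x \<partial>\<pi>)" using A t by (intro subinvariant) auto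
    finally show "(\<Sum>k<n. \<integral>\<^sup>+ x. J k (indicator A) t x \<partial>\<pi>) \<le> (\<integral>\<^sup>+ x. indicator A x \<partial>\<pi>)" .
  qed simp
  also have "\<dots> = emeasure \<pi> A" using A by (simp add: sets_pi)
  finally show ?thesis .
qed

text \<open>Under a balanced distribution the mean number of jumps up to time \<open>t\<close> is finite, so there
  are almost surely finitely many, and no mass is lost.\<close>

lemma transition_prob_integral_space:
  assumes t: "0 \<le> t"
  shows "(\<integral>\<^sup>+ x. transition_prob Q t x (space S) \<partial>\<pi>) = 1"
proof (rule antisym)
  show "(\<integral>\<^sup>+ x. transition_prob Q t x (space S) \<partial>\<pi>) \<le> 1"
    using transition_prob_integral_le[OF sets.top t] emeasure_space_1 by (simp add: space_pi)
next
  define F where "F n x = (\<integral>\<^sup>+ u \<in> {0..t}. J n (\<lambda>x. ennreal (q x)) u x \<partial>lborel)" for n x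
  have [measurable]: "F n \<in> borel_measurable S" for n unfolding F_def by measurable
  define p where "p = (\<integral>\<^sup>+ x. transition_prob Q t x (space S) \<partial>\<pi>)"
  have "1 \<le> p + (\<integral>\<^sup>+ x. F n x \<partial>\<pi>)" for n
  proof -
    have "1 = (\<integral>\<^sup>+ x. 1 \<partial>\<pi>)" by (simp add: emeasure_space_1)
    also have "\<dots> \<le> (\<integral>\<^sup>+ x. transition_prob Q t x (space S) + F n x \<partial>\<pi>)"
    proof (rule nn_integral_mono)
      fix x assume "x \<in> space \<pi>"
      then have "1 = (\<Sum>k\<le>n. J k (indicator (space S)) t x) + F n x"
        using jump_integral_total[OF t] by (simp add: space_pi F_def)
      also have "\<dots> \<le> transition_prob Q t x (space S) + F n x"
        unfolding transition_prob_eq by (intro add_right_mono sum_le_suminf) auto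
      finally show "1 \<le> transition_prob Q t x (space S) + F n x" .
    qed
    also have "\<dots> = p + (\<integral>\<^sup>+ x. F n x \<partial>\<pi>)"
      unfolding p_def by (rule nn_integral_add) (simp_all add: borel_measurable_pi)
    finally show ?thesis .
  qed
  \<comment> \<open>The mass lost up to time \<open>t\<close> is at most the probability of at least
    \<open>n + 1\<close> jumps, for every \<open>n\<close>. These probabilities have bounded partial
    sums, so the fixed loss \<open>1 - p\<close> must vanish.\<close>
  then have le: "1 - p \<le> (\<integral>\<^sup>+ x. F n x \<partial>\<pi>)" for n
    by (simp add: ennreal_minus_le_iff)
  have "1 - p = 0"
  proof (rule ennreal_eq_0_if_mult_bounded)
    fix n
    have "of_nat n * (1 - p) \<le> (\<Sum>k\<le>n. 1 - p)" by (simp add: mult_right_mono)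
    also have "\<dots> \<le> (\<Sum>k\<le>n. \<integral>\<^sup>+ x. F k x \<partial>\<pi>)" by (intro sum_mono le)
    also have "\<dots> \<le> ennreal t * (\<integral>\<^sup>+ x. ennreal (q x) \<partial>\<pi>)"
      unfolding F_def by (rule sum_mean_jumps[OF t])
    finally show "of_nat n * (1 - p) \<le> ennreal t * (\<integral>\<^sup>+ x. ennreal (q x) \<partial>\<pi>)" .
    show "ennreal t * (\<integral>\<^sup>+ x. ennreal (q x) \<partial>\<pi>) < \<infinity>"
      using mean_rate by (simp add: ennreal_mult_less_top)
  qed
  then show "1 \<le> (\<integral>\<^sup>+ x. transition_prob Q t x (space S) \<partial>\<pi>)"
    by (simp add: p_def[symmetric] diff_eq_0_iff_ennreal)
qed

text \<open>Sub-invariance holds for \<open>A\<close> and for its complement, and the two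
  inequalities add up to the equality \<open>1 = 1\<close>; hence neither can be strict.\<close>

theorem stationary: "stationary_distribution S Q \<pi>"
  unfolding stationary_distribution_def
proof (intro conjI allI impI ballI)
  fix t :: real and A assume t: "0 \<le> t" and A: "A \<in> sets S"
  let ?P = "\<lambda>A. \<integral>\<^sup>+ x. transition_prob Q t x A \<partial>\<pi>"
  have A': "space S - A \<in> sets S" using A by auto
  have "?P A + ?P (space S - A) = ?P (space S)"
    using A A' sets.sets_into_space[OF A]
    by (subst nn_integral_add[symmetric])
      (auto simp: borel_measurable_pi measurable_transition_prob space_pi transition_prob_Un[symmetric] Un_absorb1 intro!: nn_integral_cong)
  also have "\<dots> = 1" by (rule transition_prob_integral_space[OF t])
  finally have 1: "?P A + ?P (space S - A) = 1" .
  have 2: "emeasure \<pi> A + emeasure \<pi> (space S - A) = 1"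
    using A A' sets.sets_into_space[OF A] emeasure_space_1
    by (subst plus_emeasure) (auto simp: sets_pi space_pi Un_absorb1)
  have le: "?P A \<le> emeasure \<pi> A" "?P (space S - A) \<le> emeasure \<pi> (space S - A)"
    using transition_prob_integral_le[OF _ t] A A' by auto
  show "?P A = emeasure \<pi> A"
  proof (rule antisym[OF le(1)])
    have "emeasure \<pi> A + emeasure \<pi> (space S - A) \<le> ?P A + emeasure \<pi> (space S - A)"
      unfolding 2 1[symmetric] by (intro add_left_mono le)
    then show "emeasure \<pi> A \<le> ?P A"
      by (simp add: ennreal_add_left_cancel_le add.commute)
  qed
qed (simp_all add: sets_pi prob_space_axioms)

end

section \<open>Uniqueness of stationary distributions\<close>

lemma ennreal_eq_if_add_le:
  fixes a b c d :: ennreal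
  assumes "b \<le> a" "d \<le> c" "a + c \<le> b + d" "d \<noteq> \<top>"
  shows "a = b"
proof (rule antisym)
  have "d + a \<le> d + b"
    using order_trans[OF add_left_mono[OF assms(2), of a] assms(3)] by (simp add: add.commute)
  then show "a \<le> b" using assms(4) by (simp add: ennreal_add_left_cancel_le)
qed (rule assms(1))

lemma nn_integral_mono_on:
  fixes g :: "_ \<Rightarrow> ennreal"
  assumes N: "sets N = sets M" and Y: "Y \<in> sets M"
    and le: "\<And>A. A \<in> sets M \<Longrightarrow> A \<subseteq> Y \<Longrightarrow> emeasure N A \<le> emeasure M A"
    and g: "g \<in> borel_measurable M"
  shows "(\<integral>\<^sup>+ x \<in> Y. g x \<partial>N) \<le> (\<integral>\<^sup>+ x \<in> Y. g x \<partial>M)"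
proof -
  have g': "g \<in> borel_measurable N" using g measurable_cong_sets[OF N refl] by blast
  have "emeasure (density N (indicator Y)) A \<le> emeasure (density M (indicator Y)) A" if "A \<in> sets M" for A
    using that Y N by (simp add: emeasure_restricted le)
  then have "density N (indicator Y) \<le> density M (indicator Y)"
    by (subst le_measure) (simp_all add: N)
  from nn_integral_mono_measure[OF _ this, of g] show ?thesis
    using Y N g g' by (simp add: nn_integral_density mult.commute)
qed

context jump_kernel
begin

text \<open>On \<open>Y\<close> the measure \<nu> dominates \<pi>, outside it is the other way
  round. If \<nu> had a true excess on \<open>Y\<close>, the maximum of the two would send strictly
  more mass to \<open>e\<close> than \<pi> does, because \<open>e\<close> is reached with positive
  probability from every state; but at \<open>e\<close>, which lies outside \<open>Y\<close>, the
  maximum coincides with \<pi> and is invariant.\<close>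

lemma stationary_eq_if_Hahn:
  assumes nu: "stationary_distribution S Q \<nu>" and pi: "stationary_distribution S Q \<pi>"
    and Y: "Y \<in> sets S" and leY: "\<And>A. A \<in> sets S \<Longrightarrow> A \<subseteq> Y \<Longrightarrow> emeasure \<pi> A \<le> emeasure \<nu> A"
    and leY': "\<And>A. A \<in> sets S \<Longrightarrow> A \<inter> Y = {} \<Longrightarrow> emeasure \<nu> A \<le> emeasure \<pi> A"
    and e: "{e} \<in> sets S" "e \<notin> Y" and pos: "\<And>x. x \<in> space S \<Longrightarrow> 0 < transition_prob Q 1 x {e}"
  shows "\<nu> = \<pi>"
proof -
  interpret nu: prob_space \<nu> using nu by (simp add: stationary_distribution_def)
  interpret pi: prob_space \<pi> using pi by (simp add: stationary_distribution_def)
  have sets_eqs [measurable_cong]: "sets \<nu> = sets S" "sets \<pi> = sets S"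
    using nu pi by (simp_all add: stationary_distribution_def)
  have sp: "space \<nu> = space S" "space \<pi> = space S" by (rule sets_eq_imp_space_eq[OF sets_eqs(1)], rule sets_eq_imp_space_eq[OF sets_eqs(2)])
  note [measurable] = Y e(1)
  define P where "P x A = transition_prob Q 1 x A" for x A
  have [measurable]: "(\<lambda>x. P x A) \<in> borel_measurable S" if "A \<in> sets S" for A
    unfolding P_def using that by (rule measurable_transition_prob)
  have inv: "(\<integral>\<^sup>+ x. P x A \<partial>\<nu>) = emeasure \<nu> A" "(\<integral>\<^sup>+ x. P x A \<partial>\<pi>) = emeasure \<pi> A" if "A \<in> sets S" for A
    using nu pi that by (simp_all add: stationary_distribution_def P_def)
  note mono_Y = nn_integral_mono_on[OF sets_eqs(2)[folded sets_eqs(1)], unfolded sets_eqs, OF Y leY]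
  have mono_Y': "(\<integral>\<^sup>+ x \<in> space S - Y. g x \<partial>\<nu>) \<le> (\<integral>\<^sup>+ x \<in> space S - Y. g x \<partial>\<pi>)"
    if "g \<in> borel_measurable S" for g :: "_ \<Rightarrow> ennreal"
    by (rule nn_integral_mono_on) (use that leY' in \<open>auto simp: sets_eqs measurable_cong_sets[OF sets_eqs(2) refl]\<close>)
  have split: "(\<integral>\<^sup>+ x. g x \<partial>M) = (\<integral>\<^sup>+ x \<in> Y. g x \<partial>M) + (\<integral>\<^sup>+ x \<in> space S - Y. g x \<partial>M)"
    if [measurable]: "g \<in> borel_measurable S" and [measurable_cong]: "sets M = sets S" for g :: "_ \<Rightarrow> ennreal" and M
    by (subst nn_integral_add[symmetric])
      (auto intro!: nn_integral_cong simp: indicator_def sets_eq_imp_space_eq[OF that(2)])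
  \<comment> \<open>\<open>\<sigma>\<close> is integration against the maximum of \<open>\<nu>\<close> and \<open>\<pi>\<close>; one step can only increase it on
    each set but cannot increase its total mass, so it is invariant.\<close>
  define \<sigma> where "\<sigma> g = (\<integral>\<^sup>+ x \<in> Y. g x \<partial>\<nu>) + (\<integral>\<^sup>+ x \<in> space S - Y. g x \<partial>\<pi>)" for g :: "_ \<Rightarrow> ennreal"
  have ge: "emeasure \<nu> A \<le> \<sigma> (\<lambda>x. P x A)" "emeasure \<pi> A \<le> \<sigma> (\<lambda>x. P x A)" if [measurable]: "A \<in> sets S" for A
  proof -
    have Pm: "(\<lambda>x. P x A) \<in> borel_measurable S" by measurable
    show "emeasure \<nu> A \<le> \<sigma> (\<lambda>x. P x A)"
      unfolding inv(1)[OF that, symmetric] \<sigma>_def split[OF Pm sets_eqs(1)]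
      by (intro add_left_mono mono_Y' Pm)
    show "emeasure \<pi> A \<le> \<sigma> (\<lambda>x. P x A)"
      unfolding inv(2)[OF that, symmetric] \<sigma>_def split[OF Pm sets_eqs(2)]
      by (intro add_right_mono mono_Y) (use Pm in \<open>auto simp: measurable_cong_sets[OF sets_eqs(1) refl]\<close>)
  qed
  have e_space: "e \<in> space S" using sets.sets_into_space[OF e(1)] by auto
  \<comment> \<open>The space is cut into \<open>Y\<close>, \<open>Z\<close> and \<open>{e}\<close>.
    The lower bounds of \<open>ge\<close> are spent on \<open>Y\<close> (with \<nu>) and on
    \<open>Z\<close> (with \<pi>); cancelling these finite masses against the total leaves an upper
    bound for the mass sent to \<open>{e}\<close>.\<close>
  define Z where "Z = space S - Y - {e}"
  have [measurable]: "Z \<in> sets S" unfolding Z_def by simp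
  have Pdec: "P x Y + P x Z + P x {e} = P x (space S)" if "x \<in> space S" for x
  proof -
    have "P x Y + P x Z + P x {e} = P x (Y \<union> Z \<union> {e})"
    proof -
      have "Y \<inter> Z = {}" "(Y \<union> Z) \<inter> {e} = {}" using e by (auto simp: Z_def)
      then show ?thesis
        unfolding P_def using that by (simp add: transition_prob_Un del: Un_insert_right)
    qed
    also have "Y \<union> Z \<union> {e} = space S" using sets.sets_into_space[OF Y] e_space by (auto simp: Z_def)
    finally show ?thesis .
  qed
  have \<sigma>_add: "\<sigma> (\<lambda>x. f x + g x) = \<sigma> f + \<sigma> g" if [measurable]: "f \<in> borel_measurable S" "g \<in> borel_measurable S" for f g
    unfolding \<sigma>_def by (simp add: distrib_right nn_integral_add add_ac)
  have "\<sigma> (\<lambda>x. P x Y) + \<sigma> (\<lambda>x. P x Z) + \<sigma> (\<lambda>x. P x {e}) = \<sigma> (\<lambda>x. P x Y + P x Z + P x {e})"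
    by (simp add: \<sigma>_add)
  also have "\<dots> \<le> \<sigma> (\<lambda>x. 1)"
    unfolding \<sigma>_def using transition_prob_le_1[of 1]
    by (intro add_mono nn_integral_mono mult_right_mono) (auto simp: Pdec sp, auto simp: P_def)
  also have "\<dots> = emeasure \<nu> Y + emeasure \<pi> (space S - Y)"
    by (simp add: \<sigma>_def sets_eqs)
  also have "emeasure \<pi> (space S - Y) = emeasure \<pi> Z + emeasure \<pi> {e}"
    using e e_space by (subst plus_emeasure) (auto simp: Z_def sets_eqs intro!: arg_cong[where f = "emeasure \<pi>"])
  finally have le: "\<sigma> (\<lambda>x. P x Y) + \<sigma> (\<lambda>x. P x Z) + \<sigma> (\<lambda>x. P x {e}) \<le> emeasure \<nu> Y + emeasure \<pi> Z + emeasure \<pi> {e}"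
    by (simp add: add_ac)
  have "emeasure \<nu> Y + emeasure \<pi> Z + \<sigma> (\<lambda>x. P x {e}) \<le> \<sigma> (\<lambda>x. P x Y) + \<sigma> (\<lambda>x. P x Z) + \<sigma> (\<lambda>x. P x {e})"
    by (intro add_mono ge) auto
  then have "(emeasure \<nu> Y + emeasure \<pi> Z) + \<sigma> (\<lambda>x. P x {e}) \<le> (emeasure \<nu> Y + emeasure \<pi> Z) + emeasure \<pi> {e}"
    using le by (rule order_trans)
  then have "\<sigma> (\<lambda>x. P x {e}) \<le> emeasure \<pi> {e}"
    by (simp add: ennreal_add_left_cancel_le)
  also have "\<dots> = (\<integral>\<^sup>+ x \<in> Y. P x {e} \<partial>\<pi>) + (\<integral>\<^sup>+ x \<in> space S - Y. P x {e} \<partial>\<pi>)"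
    unfolding inv(2)[OF e(1), symmetric] by (rule split) (simp_all add: sets_eqs)
  finally have le_e: "(\<integral>\<^sup>+ x \<in> Y. P x {e} \<partial>\<nu>) + (\<integral>\<^sup>+ x \<in> space S - Y. P x {e} \<partial>\<pi>)
    \<le> (\<integral>\<^sup>+ x \<in> Y. P x {e} \<partial>\<pi>) + (\<integral>\<^sup>+ x \<in> space S - Y. P x {e} \<partial>\<pi>)" by (simp add: \<sigma>_def)
  have Pe1: "P x {e} \<le> 1" if "x \<in> space S" for x
  proof -
    have "P x {e} \<le> P x (space S)" using Pdec[OF that] by (metis le_iff_add add.commute)
    also have "\<dots> \<le> 1" using transition_prob_le_1[of 1 x] that by (simp add: P_def)
    finally show ?thesis .
  qed
  have fin: "(\<integral>\<^sup>+ x \<in> A. P x {e} \<partial>M) \<noteq> \<top>" if "M = \<nu> \<or> M = \<pi>" for A M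
  proof -
    have "(\<integral>\<^sup>+ x \<in> A. P x {e} \<partial>M) \<le> (\<integral>\<^sup>+ x. 1 \<partial>M)"
      using that Pe1 by (intro nn_integral_mono) (auto simp: indicator_def sp)
    also have "\<dots> < \<top>" using that nu.emeasure_space_1 pi.emeasure_space_1 by auto
    finally show ?thesis by simp
  qed
  have "(\<integral>\<^sup>+ x \<in> Y. P x {e} \<partial>\<nu>) \<le> (\<integral>\<^sup>+ x \<in> Y. P x {e} \<partial>\<pi>)"
    using le_e fin[of \<pi> "space S - Y"] by (simp add: add.commute[of _ "\<integral>\<^sup>+ x \<in> space S - Y. P x {e} \<partial>\<pi>"] ennreal_add_left_cancel_le)
  then have eqY: "(\<integral>\<^sup>+ x \<in> Y. P x {e} \<partial>\<nu>) = (\<integral>\<^sup>+ x \<in> Y. P x {e} \<partial>\<pi>)"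
    by (intro antisym mono_Y) (auto simp: measurable_cong_sets[OF sets_eqs(1) refl])
  \<comment> \<open>Equality of the integrals over \<open>Y\<close> passes to every part of
    \<open>Y\<close>, since the inequality between them goes the same way on
    \<open>Y \<inter> A\<close> and on the rest.\<close>
  have eqYA: "(\<integral>\<^sup>+ x \<in> Y \<inter> A. P x {e} \<partial>\<nu>) = (\<integral>\<^sup>+ x \<in> Y \<inter> A. P x {e} \<partial>\<pi>)" if [measurable]: "A \<in> sets S" for A
  proof (rule ennreal_eq_if_add_le)
    have mono: "(\<integral>\<^sup>+ x \<in> Y \<inter> B. P x {e} \<partial>\<pi>) \<le> (\<integral>\<^sup>+ x \<in> Y \<inter> B. P x {e} \<partial>\<nu>)" if [measurable]: "B \<in> sets S" for B
      by (rule nn_integral_mono_on) (auto simp: sets_eqs leY)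
    show "(\<integral>\<^sup>+ x \<in> Y \<inter> A. P x {e} \<partial>\<pi>) \<le> (\<integral>\<^sup>+ x \<in> Y \<inter> A. P x {e} \<partial>\<nu>)"
      "(\<integral>\<^sup>+ x \<in> Y \<inter> (space S - A). P x {e} \<partial>\<pi>) \<le> (\<integral>\<^sup>+ x \<in> Y \<inter> (space S - A). P x {e} \<partial>\<nu>)"
      by (simp_all add: mono)
    have split_Y: "(\<integral>\<^sup>+ x \<in> Y \<inter> A. P x {e} \<partial>M) + (\<integral>\<^sup>+ x \<in> Y \<inter> (space S - A). P x {e} \<partial>M) = (\<integral>\<^sup>+ x \<in> Y. P x {e} \<partial>M)"
      if [measurable_cong]: "sets M = sets S" for M
      by (subst nn_integral_add[symmetric])
        (auto intro!: nn_integral_cong simp: indicator_def sets_eq_imp_space_eq[OF that])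
    show "(\<integral>\<^sup>+ x \<in> Y \<inter> A. P x {e} \<partial>\<nu>) + (\<integral>\<^sup>+ x \<in> Y \<inter> (space S - A). P x {e} \<partial>\<nu>)
      \<le> (\<integral>\<^sup>+ x \<in> Y \<inter> A. P x {e} \<partial>\<pi>) + (\<integral>\<^sup>+ x \<in> Y \<inter> (space S - A). P x {e} \<partial>\<pi>)"
      by (simp add: split_Y sets_eqs eqY)
    show "(\<integral>\<^sup>+ x \<in> Y \<inter> (space S - A). P x {e} \<partial>\<pi>) \<noteq> \<top>" by (rule fin) simp
  qed
  \<comment> \<open>The measures agree on \<open>Y\<close> after weighting with
    \<open>P x {e}\<close>. This weight lies in \<open>(0, 1]\<close>, so dividing by it gives \<nu>
    = \<pi> on \<open>Y\<close>.\<close>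
  have "density \<nu> (\<lambda>x. P x {e} * indicator Y x) = density \<pi> (\<lambda>x. P x {e} * indicator Y x)"
    by (rule measure_eqI)
      (simp_all add: sets_eqs emeasure_density eqYA indicator_inter_arith[symmetric] mult.assoc)
  then have *: "(\<integral>\<^sup>+ x. inverse (P x {e}) * indicator A x \<partial>density \<nu> (\<lambda>x. P x {e} * indicator Y x)) =
    (\<integral>\<^sup>+ x. inverse (P x {e}) * indicator A x \<partial>density \<pi> (\<lambda>x. P x {e} * indicator Y x))" for A
    by simp
  have div: "(\<integral>\<^sup>+ x. inverse (P x {e}) * indicator A x \<partial>density M (\<lambda>x. P x {e} * indicator Y x)) = emeasure M (Y \<inter> A)"
    if [measurable]: "A \<in> sets S" and [measurable_cong]: "sets M = sets S" for A M
  proof -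
    have "(\<integral>\<^sup>+ x. inverse (P x {e}) * indicator A x \<partial>density M (\<lambda>x. P x {e} * indicator Y x))
      = (\<integral>\<^sup>+ x. (P x {e} * indicator Y x) * (inverse (P x {e}) * indicator A x) \<partial>M)"
      by (rule nn_integral_density) measurable
    also have "\<dots> = (\<integral>\<^sup>+ x. indicator (Y \<inter> A) x \<partial>M)"
    proof (rule nn_integral_cong)
      fix x assume "x \<in> space M"
      then have x: "x \<in> space S" using sets_eq_imp_space_eq[OF that(2)] by simp
      have "P x {e} \<noteq> 0" "P x {e} \<noteq> \<top>" using pos[OF x] Pe1[OF x] by (auto simp: P_def top_unique)
      then have "P x {e} * inverse (P x {e}) = 1"
        by (simp add: divide_ennreal_def[symmetric] ennreal_divide_self less_top)
      then show "(P x {e} * indicator Y x) * (inverse (P x {e}) * indicator A x) = indicator (Y \<inter> A) x"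
        by (simp add: indicator_def)
    qed
    also have "\<dots> = emeasure M (Y \<inter> A)" by (rule nn_integral_indicator) measurable
    finally show ?thesis .
  qed
  have on_Y: "emeasure \<nu> (Y \<inter> A) = emeasure \<pi> (Y \<inter> A)" if "A \<in> sets S" for A
    using *[of A] that by (simp add: div sets_eqs)
  \<comment> \<open>Equal mass on \<open>Y\<close> leaves equal mass outside \<open>Y\<close>, where
    \<nu> is dominated by \<pi>; domination with equal finite totals is equality.\<close>
  have on_Y': "emeasure \<nu> (A - Y) = emeasure \<pi> (A - Y)" if [measurable]: "A \<in> sets S" for A
  proof (rule ennreal_eq_if_add_le[symmetric])
    show "emeasure \<nu> (A - Y) \<le> emeasure \<pi> (A - Y)" "emeasure \<nu> (space S - A - Y) \<le> emeasure \<pi> (space S - A - Y)"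
      by (auto intro!: leY')
    have tot: "emeasure M (Y \<inter> space S) + (emeasure M (A - Y) + emeasure M (space S - A - Y)) = emeasure M (space S)"
      if [measurable_cong]: "sets M = sets S" for M
    proof -
      have [measurable]: "A - Y \<in> sets M" "space S - A - Y \<in> sets M" "Y \<inter> space S \<in> sets M" by measurable
      have "emeasure M (A - Y) + emeasure M (space S - A - Y) = emeasure M ((A - Y) \<union> (space S - A - Y))"
        by (rule plus_emeasure) auto
      also have "emeasure M (Y \<inter> space S) + \<dots> = emeasure M ((Y \<inter> space S) \<union> ((A - Y) \<union> (space S - A - Y)))"
        by (rule plus_emeasure) auto
      also have "(Y \<inter> space S) \<union> ((A - Y) \<union> (space S - A - Y)) = space S"
        using sets.sets_into_space[of A S] sets.sets_into_space[OF Y] by auto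
      finally show ?thesis .
    qed
    show "emeasure \<pi> (A - Y) + emeasure \<pi> (space S - A - Y) \<le> emeasure \<nu> (A - Y) + emeasure \<nu> (space S - A - Y)"
      using tot[OF sets_eqs(1)] tot[OF sets_eqs(2)] on_Y[of "space S"] nu.emeasure_space_1 pi.emeasure_space_1
      by (metis sp sets.top ennreal_add_left_cancel_le pi.emeasure_finite infinity_ennreal_def order_refl)
    show "emeasure \<nu> (space S - A - Y) \<noteq> \<top>" by simp
  qed
  show ?thesis
  proof (rule measure_eqI)
    fix A assume "A \<in> sets \<nu>"
    then have [measurable]: "A \<in> sets S" by (simp add: sets_eqs)
    have "emeasure M A = emeasure M (Y \<inter> A) + emeasure M (A - Y)" if [measurable_cong]: "sets M = sets S" for M
      by (subst plus_emeasure) (auto intro!: arg_cong[where f = "emeasure M"])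
    then show "emeasure \<nu> A = emeasure \<pi> A"
      by (simp add: sets_eqs on_Y on_Y')
  qed (simp add: sets_eqs)
qed

text \<open>Hahn decomposition puts \<open>e\<close> either inside or outside \<open>Y\<close>.
  Exchanging the two distributions replaces \<open>Y\<close> by its complement, so both cases are
  instances of the same lemma.\<close>

theorem stationary_unique:
  assumes nu: "stationary_distribution S Q \<nu>" and pi: "stationary_distribution S Q \<pi>"
    and e: "{e} \<in> sets S" and pos: "\<And>x. x \<in> space S \<Longrightarrow> 0 < transition_prob Q 1 x {e}"
  shows "\<nu> = \<pi>"
proof -
  have sets_eqs: "sets \<nu> = sets S" "sets \<pi> = sets S" and "finite_measure \<nu>" "finite_measure \<pi>"
    using nu pi by (simp_all add: stationary_distribution_def prob_space.finite_measure)
  then obtain Y where Y: "Y \<in> sets S" "\<And>A. A \<in> sets S \<Longrightarrow> A \<subseteq> Y \<Longrightarrow> emeasure \<pi> A \<le> emeasure \<nu> A"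
      "\<And>A. A \<in> sets S \<Longrightarrow> A \<inter> Y = {} \<Longrightarrow> emeasure \<nu> A \<le> emeasure \<pi> A"
    using finite_unsigned_Hahn_decomposition[of \<nu> \<pi>] by (auto simp: sets_eqs)
  show ?thesis
  proof (cases "e \<in> Y")
    case False
    then show ?thesis by (intro stationary_eq_if_Hahn[OF nu pi Y e _ pos])
  next
    case True
    have sub: "A \<subseteq> Y" if "A \<in> sets S" "A \<inter> (space S - Y) = {}" for A
      using sets.sets_into_space[OF that(1)] that(2) by auto
    have "\<pi> = \<nu>"
      using Y True by (intro stationary_eq_if_Hahn[OF pi nu _ _ _ e _ pos, of "space S - Y"]) (auto dest: sub)
    then show ?thesis by simp
  qed
qed

end

section \<open>Integration over finite lists\<close>

lemma space_PiM_lessThan_mem: "f \<in> space (\<Pi>\<^sub>M i\<in>{..<n}. M) \<Longrightarrow> i < n \<Longrightarrow> f i \<in> space M"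
  using PiE_mem[of f "{..<n}" "\<lambda>_. space M" i] by (simp add: space_PiM)

lemma map_upt_in_lists: "f \<in> space (\<Pi>\<^sub>M i\<in>{..<n}. M) \<Longrightarrow> map f [0..<n] \<in> lists (space M)"
  by (intro in_listsI ballI) (auto simp only: set_map set_upt atLeastLessThan_iff space_PiM_lessThan_mem)

lemma measurable_map_upt [measurable]:
  "(\<lambda>f. map f [0..<n]) \<in> measurable (\<Pi>\<^sub>M i\<in>{..<n}. M) (list_measure M)"
proof (rule measurableI)
  fix A assume "A \<in> sets (list_measure M)"
  then have "power_part M n A \<in> sets (\<Pi>\<^sub>M i\<in>{..<n}. M)" unfolding sets_list_measure by blast
  also have "power_part M n A = (\<lambda>f. map f [0..<n]) -` A \<inter> space (\<Pi>\<^sub>M i\<in>{..<n}. M)"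
    unfolding power_part_def by blast
  finally show "(\<lambda>f. map f [0..<n]) -` A \<inter> space (\<Pi>\<^sub>M i\<in>{..<n}. M) \<in> sets (\<Pi>\<^sub>M i\<in>{..<n}. M)" .
qed (simp only: space_list_measure map_upt_in_lists)

lemma measurable_map_uptI:
  assumes "\<And>j. j < m \<Longrightarrow> (\<lambda>p. g p j) \<in> measurable N M"
  shows "(\<lambda>p. map (g p) [0..<m]) \<in> measurable N (list_measure M)"
proof -
  have "(\<lambda>p. \<lambda>j\<in>{..<m}. g p j) \<in> measurable N (\<Pi>\<^sub>M i\<in>{..<m}. M)"
    by (rule measurable_restrict) (use assms in simp)
  from measurable_compose[OF this measurable_map_upt]
  have "(\<lambda>p. map (\<lambda>j\<in>{..<m}. g p j) [0..<m]) \<in> measurable N (list_measure M)" .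
  moreover have "map (\<lambda>j\<in>{..<m}. h j) [0..<m] = map h [0..<m]" for h :: "nat \<Rightarrow> 'b" by simp
  ultimately show ?thesis by (simp only:)
qed

lemma sets_list_measure_length: "{\<eta> \<in> lists (space M). length \<eta> = n} \<in> sets (list_measure M)"
proof -
  have "power_part M m {\<eta> \<in> lists (space M). length \<eta> = n} = (if m = n then space (\<Pi>\<^sub>M i\<in>{..<m}. M) else {})" for m
    unfolding power_part_def using map_upt_in_lists[of _ m M] by (cases "m = n") (simp_all only: mem_Collect_eq length_map length_upt diff_zero if_True if_False simp_thms conj_ac, blast+)
  then have "power_part M m {\<eta> \<in> lists (space M). length \<eta> = n} \<in> sets (\<Pi>\<^sub>M i\<in>{..<m}. M)" for m
    by (simp only:) simp
  then show ?thesis unfolding sets_list_measure by blast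
qed

lemma sets_list_measure_nth:
  assumes "A \<in> sets M" "i < n"
  shows "{\<eta> \<in> lists (space M). length \<eta> = n \<and> \<eta> ! i \<in> A} \<in> sets (list_measure M)"
proof -
  have nth: "map f [0..<n] ! i = f i" for f :: "nat \<Rightarrow> 'a" using assms(2) by simp
  have "power_part M m {\<eta> \<in> lists (space M). length \<eta> = n \<and> \<eta> ! i \<in> A} =
      (if m = n then {f \<in> space (\<Pi>\<^sub>M i\<in>{..<n}. M). f i \<in> A} else {})" for m
    unfolding power_part_def
    using map_upt_in_lists[of _ m M] nth by (cases "m = n") (simp_all only: mem_Collect_eq length_map length_upt diff_zero if_True if_False simp_thms, blast+)
  moreover have "{f \<in> space (\<Pi>\<^sub>M i\<in>{..<n}. M). f i \<in> A} \<in> sets (\<Pi>\<^sub>M i\<in>{..<n}. M)"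
    using measurable_sets[OF measurable_component_singleton[of i "{..<n}" "\<lambda>_. M"] assms(1)] assms(2)
    by (simp add: vimage_def Int_def conj_commute)
  ultimately have "power_part M m {\<eta> \<in> lists (space M). length \<eta> = n \<and> \<eta> ! i \<in> A} \<in> sets (\<Pi>\<^sub>M i\<in>{..<m}. M)" for m
    by (cases "m = n") (simp_all only: if_True if_False simp_thms sets.empty_sets)
  then show ?thesis unfolding sets_list_measure by blast
qed

lemma measurable_nth_of_length:
  "(\<lambda>\<eta>. \<lambda>i\<in>{..<n}. \<eta> ! i) \<in> measurable (restrict_space (list_measure M) {\<eta>. length \<eta> = n}) (\<Pi>\<^sub>M i\<in>{..<n}. M)"
proof (rule measurable_restrict)
  fix i assume i: "i \<in> {..<n}"
  let ?R = "restrict_space (list_measure M) {\<eta>. length \<eta> = n}"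
  have sp: "space ?R = {\<eta> \<in> lists (space M). length \<eta> = n}"
    by (auto simp: space_restrict_space space_list_measure)
  show "(\<lambda>\<eta>. \<eta> ! i) \<in> measurable ?R M"
  proof (rule measurableI)
    fix A assume A: "A \<in> sets M"
    have "(\<lambda>\<eta>. \<eta> ! i) -` A \<inter> space ?R = {\<eta>. length \<eta> = n} \<inter> {\<eta> \<in> lists (space M). length \<eta> = n \<and> \<eta> ! i \<in> A}"
      by (auto simp: sp)
    then show "(\<lambda>\<eta>. \<eta> ! i) -` A \<inter> space ?R \<in> sets ?R"
      using sets_list_measure_nth[OF A, of i n] i by (auto simp: sets_restrict_space)
  qed (use i in \<open>auto simp: sp in_lists_conv_set\<close>)
qed

text \<open>The pair space is a countable union of slices on which the list has a fixed length. On
  such a slice the list is recovered measurably from its coordinates, so measurability can be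
  checked on finite products.\<close>

lemma measurable_list_pairI:
  assumes F: "\<And>n. (\<lambda>p. F (map (fst p) [0..<n], snd p)) \<in> measurable ((\<Pi>\<^sub>M i\<in>{..<n}. M) \<Otimes>\<^sub>M N) K"
  shows "F \<in> measurable (list_measure M \<Otimes>\<^sub>M N) K"
proof (rule measurable_piecewise_restrict[of "range (\<lambda>n. {\<eta> \<in> lists (space M). length \<eta> = n} \<times> space N)"])
  let ?L = "\<lambda>n. {\<eta> \<in> lists (space M). length \<eta> = n}"
  show "space (list_measure M \<Otimes>\<^sub>M N) \<subseteq> \<Union> (range (\<lambda>n. ?L n \<times> space N))"
    by (auto simp: space_pair_measure space_list_measure)
  fix \<Omega> assume "\<Omega> \<in> range (\<lambda>n. ?L n \<times> space N)"
  then obtain n where n: "\<Omega> = ?L n \<times> space N" by auto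
  have \<Omega>: "\<Omega> \<in> sets (list_measure M \<Otimes>\<^sub>M N)"
    unfolding n by (intro pair_measureI sets_list_measure_length) simp
  then show "\<Omega> \<inter> space (list_measure M \<Otimes>\<^sub>M N) \<in> sets (list_measure M \<Otimes>\<^sub>M N)" by simp
  let ?R = "restrict_space (list_measure M \<Otimes>\<^sub>M N) \<Omega>"
  have spR: "space ?R = \<Omega>"
    using sets.sets_into_space[OF \<Omega>] by (simp add: space_restrict_space Int_absorb2)
  have "fst \<in> measurable ?R (restrict_space (list_measure M) {\<eta>. length \<eta> = n})"
  proof (rule measurable_restrict_space2)
    show "fst \<in> space ?R \<rightarrow> {\<eta>. length \<eta> = n}" unfolding spR by (auto simp: n)
  qed (intro measurable_restrict_space1 measurable_fst)
  from measurable_compose[OF this measurable_nth_of_length]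
  have 1: "(\<lambda>p. \<lambda>i\<in>{..<n}. fst p ! i) \<in> measurable ?R (\<Pi>\<^sub>M i\<in>{..<n}. M)" .
  have 2: "snd \<in> measurable ?R N" by (intro measurable_restrict_space1 measurable_snd)
  from measurable_compose[OF measurable_Pair[OF 1 2] F[of n]]
  have "(\<lambda>p. F (map (\<lambda>i\<in>{..<n}. fst p ! i) [0..<n], snd p)) \<in> measurable ?R K" by simp
  then show "F \<in> measurable ?R K"
  proof (rule measurable_cong[THEN iffD1, rotated])
    fix p assume "p \<in> space ?R"
    then have "length (fst p) = n" unfolding spR by (auto simp: n)
    then have "map (\<lambda>i\<in>{..<n}. fst p ! i) [0..<n] = fst p" by (intro nth_equalityI) auto
    then show "F (map (\<lambda>i\<in>{..<n}. fst p ! i) [0..<n], snd p) = F p" by simp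
  qed
qed simp

text \<open>A one-point second factor reduces this to the pair version.\<close>

lemma measurable_list_measureI:
  assumes F: "\<And>n. (\<lambda>f. F (map f [0..<n])) \<in> measurable (\<Pi>\<^sub>M i\<in>{..<n}. M) K"
  shows "F \<in> measurable (list_measure M) K"
proof -
  have "(\<lambda>p. F (fst p)) \<in> measurable (list_measure M \<Otimes>\<^sub>M count_space (UNIV :: unit set)) K"
    by (rule measurable_list_pairI) (simp add: measurable_compose[OF measurable_fst F])
  from measurable_compose[OF measurable_Pair[OF measurable_ident measurable_const] this, of "()"]
  show ?thesis by simp
qed

lemma measurable_on_lists_of_length:
  "F \<in> measurable (list_measure M) K \<Longrightarrow> (\<lambda>f. F (map f [0..<n])) \<in> measurable (\<Pi>\<^sub>M i\<in>{..<n}. M) K"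
  by (rule measurable_compose[OF measurable_map_upt])

lemma measurable_length [measurable]: "length \<in> measurable (list_measure M) (count_space UNIV)"
  by (rule measurable_list_measureI) simp

lemma measurable_append_single [measurable (raw)]:
  assumes "g \<in> measurable N (list_measure M)" "h \<in> measurable N M"
  shows "(\<lambda>p. g p @ [h p]) \<in> measurable N (list_measure M)"
proof -
  have "(\<lambda>p. fst p @ [snd p]) \<in> measurable (list_measure M \<Otimes>\<^sub>M M) (list_measure M)"
  proof (rule measurable_list_pairI)
    fix n
    have "(\<lambda>p. map (\<lambda>j. if j < n then fst p j else snd p) [0..<Suc n]) \<in> measurable ((\<Pi>\<^sub>M i\<in>{..<n}. M) \<Otimes>\<^sub>M M) (list_measure M)"
    proof (rule measurable_map_uptI)
      fix j assume "j < Suc n"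
      then show "(\<lambda>p. if j < n then fst p j else snd p) \<in> measurable ((\<Pi>\<^sub>M i\<in>{..<n}. M) \<Otimes>\<^sub>M M) M"
        by (cases "j < n") auto
    qed
    moreover have "map (\<lambda>j. if j < n then f j else x) [0..<Suc n] = map f [0..<n] @ [x]" for f :: "nat \<Rightarrow> 'b" and x
      by simp
    ultimately show "(\<lambda>p. fst (map (fst p) [0..<n], snd p) @ [snd (map (fst p) [0..<n], snd p)]) \<in> measurable ((\<Pi>\<^sub>M i\<in>{..<n}. M) \<Otimes>\<^sub>M M) (list_measure M)"
      by (simp only: fst_conv snd_conv)
  qed
  from measurable_compose[OF measurable_Pair[OF assms] this] show ?thesis by simp
qed

lemma measurable_take [measurable]: "take i \<in> measurable (list_measure M) (list_measure M)"
proof (rule measurable_list_measureI)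
  fix n
  have "take i (map f [0..<n]) = map f [0..<min i n]" for f :: "nat \<Rightarrow> 'a"
    by (intro nth_equalityI) auto
  then show "(\<lambda>f. take i (map f [0..<n])) \<in> measurable (\<Pi>\<^sub>M i\<in>{..<n}. M) (list_measure M)"
    by (auto intro!: measurable_map_uptI)
qed

lemma measurable_insert_at [measurable (raw)]:
  assumes "g \<in> measurable N (list_measure M)" "h \<in> measurable N M"
  shows "(\<lambda>p. take i (g p) @ h p # drop i (g p)) \<in> measurable N (list_measure M)"
proof -
  have "(\<lambda>p. take i (fst p) @ snd p # drop i (fst p)) \<in> measurable (list_measure M \<Otimes>\<^sub>M M) (list_measure M)"
  proof (rule measurable_list_pairI)
    fix n
    show "(\<lambda>p. take i (fst (map (fst p) [0..<n], snd p)) @ snd (map (fst p) [0..<n], snd p) # drop i (fst (map (fst p) [0..<n], snd p)))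
      \<in> measurable ((\<Pi>\<^sub>M i\<in>{..<n}. M) \<Otimes>\<^sub>M M) (list_measure M)"
    proof (cases "i \<le> n")
      case True
      have eq: "take i (map f [0..<n]) @ x # drop i (map f [0..<n]) =
        map (\<lambda>j. if j < i then f j else if j = i then x else f (j - 1)) [0..<Suc n]" for f :: "nat \<Rightarrow> 'b" and x
      proof (rule nth_equalityI)
        fix j assume "j < length (take i (map f [0..<n]) @ x # drop i (map f [0..<n]))"
        then have j: "j < Suc n" using True by simp
        consider "j < i" | "j = i" | k where "j = Suc k" "i \<le> k" by (metis less_imp_Suc_add linorder_neqE_nat le_add1)
        then show "(take i (map f [0..<n]) @ x # drop i (map f [0..<n])) ! j =
          map (\<lambda>j. if j < i then f j else if j = i then x else f (j - 1)) [0..<Suc n] ! j"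
          by cases (use True j in \<open>simp_all add: nth_append Suc_diff_le del: upt_Suc\<close>)
      qed (use True in simp)
      show ?thesis
        unfolding fst_conv snd_conv eq
      proof (rule measurable_map_uptI)
        fix j assume j: "j < Suc n"
        consider "j < i" | "j = i" | "i < j" by linarith
        then show "(\<lambda>p. if j < i then fst p j else if j = i then snd p else fst p (j - 1)) \<in> measurable ((\<Pi>\<^sub>M i\<in>{..<n}. M) \<Otimes>\<^sub>M M) M"
          by cases (use j True in auto)
      qed
    next
      case False
      have "(\<lambda>p. map (fst p) [0..<n] @ [snd p]) \<in> measurable ((\<Pi>\<^sub>M i\<in>{..<n}. M) \<Otimes>\<^sub>M M) (list_measure M)"
        by (intro measurable_append_single measurable_compose[OF measurable_fst measurable_map_upt] measurable_snd)
      then show ?thesis using False by simp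
    qed
  qed
  from measurable_compose[OF measurable_Pair[OF assms] this] show ?thesis by simp
qed

lemma measurable_delete_nth [measurable]:
  "(\<lambda>\<eta>. take i \<eta> @ drop (Suc i) \<eta>) \<in> measurable (list_measure M) (list_measure M)"
proof (rule measurable_list_measureI)
  fix n
  show "(\<lambda>f. take i (map f [0..<n]) @ drop (Suc i) (map f [0..<n])) \<in> measurable (\<Pi>\<^sub>M i\<in>{..<n}. M) (list_measure M)"
  proof (cases "i < n")
    case True
    then have eq: "take i (map f [0..<n]) @ drop (Suc i) (map f [0..<n]) =
      map (\<lambda>j. if j < i then f j else f (Suc j)) [0..<n - 1]" for f :: "nat \<Rightarrow> 'a"
      by (intro nth_equalityI) (auto simp: nth_append)
    show ?thesis unfolding eq
    proof (rule measurable_map_uptI)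
      fix j assume "j < n - 1"
      then show "(\<lambda>f. if j < i then f j else f (Suc j)) \<in> measurable (\<Pi>\<^sub>M i\<in>{..<n}. M) M"
        by (cases "j < i") auto
    qed
  qed simp
qed

lemma Measurable_pred_ex_in_list:
  assumes P: "Measurable.pred (M \<Otimes>\<^sub>M N) (\<lambda>p. P (fst p) (snd p))"
  shows "Measurable.pred (list_measure M \<Otimes>\<^sub>M N) (\<lambda>p. \<exists>x\<in>set (fst p). P x (snd p))"
proof (rule measurable_list_pairI)
  fix n :: nat
  have [measurable]: "Measurable.pred ((\<Pi>\<^sub>M i\<in>{..<n}. M) \<Otimes>\<^sub>M N) (\<lambda>p. P (fst p i) (snd p))" if "i < n" for i
    using measurable_compose[OF _ P, of "\<lambda>p. (fst p i, snd p)" "(\<Pi>\<^sub>M i\<in>{..<n}. M) \<Otimes>\<^sub>M N"] that by simp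
  have "Measurable.pred ((\<Pi>\<^sub>M i\<in>{..<n}. M) \<Otimes>\<^sub>M N) (\<lambda>p. \<exists>i\<in>{..<n}. P (fst p i) (snd p))"
    by (intro pred_intros_finite finite_lessThan) simp
  moreover have "(\<exists>x\<in>f ` A. R x) \<longleftrightarrow> (\<exists>i\<in>A. R (f i))" for f :: "nat \<Rightarrow> 'a" and A R
    by blast
  ultimately show "Measurable.pred ((\<Pi>\<^sub>M i\<in>{..<n}. M) \<Otimes>\<^sub>M N) (\<lambda>p. \<exists>x\<in>set (fst (map (fst p) [0..<n], snd p)). P x (snd (map (fst p) [0..<n], snd p)))"
    by (simp only: fst_conv snd_conv set_map set_upt atLeast0LessThan)
qed

definition list_integral :: "'b measure \<Rightarrow> nat \<Rightarrow> ('b list \<Rightarrow> ennreal) \<Rightarrow> ennreal" where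
  "list_integral M n F = (\<integral>\<^sup>+ f. F (map f [0..<n]) \<partial>(\<Pi>\<^sub>M i\<in>{..<n}. M))"

lemma nn_integral_list_measure:
  assumes "F \<in> borel_measurable (list_measure M)"
  shows "(\<integral>\<^sup>+ \<eta>. F \<eta> \<partial>list_measure M) = (\<Sum>n. list_integral M n F)"
  using assms
proof (induction rule: borel_measurable_induct)
  case (cong f g)
  have "list_integral M n f = list_integral M n g" for n
    unfolding list_integral_def
    by (intro nn_integral_cong cong(3)) (simp only: space_list_measure map_upt_in_lists)
  moreover have "(\<integral>\<^sup>+ \<eta>. f \<eta> \<partial>list_measure M) = (\<integral>\<^sup>+ \<eta>. g \<eta> \<partial>list_measure M)"
    by (rule nn_integral_cong) (rule cong(3))
  ultimately show ?case using cong(4) by (simp only:)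
next
  case (set A)
  have "list_integral M n (indicator A) = emeasure (\<Pi>\<^sub>M i\<in>{..<n}. M) (power_part M n A)" for n
  proof -
    have "list_integral M n (indicator A) = (\<integral>\<^sup>+ f. indicator (power_part M n A) f \<partial>(\<Pi>\<^sub>M i\<in>{..<n}. M))"
      unfolding list_integral_def
      by (intro nn_integral_cong) (simp only: power_part_def indicator_def mem_Collect_eq simp_thms)
    also have "\<dots> = emeasure (\<Pi>\<^sub>M i\<in>{..<n}. M) (power_part M n A)"
      using set by (intro nn_integral_indicator) (simp only: sets_list_measure)
    finally show ?thesis .
  qed
  then show ?case using set by (simp add: emeasure_list_measure)
next
  case (mult u c)
  note [measurable] = measurable_on_lists_of_length[OF mult(2)]
  show ?case using mult by (simp add: nn_integral_cmult list_integral_def)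
next
  case (add u v)
  note [measurable] = measurable_on_lists_of_length[OF add(1)] measurable_on_lists_of_length[OF add(3)]
  show ?case using add by (simp add: nn_integral_add list_integral_def suminf_add)
next
  case (seq U)
  have "(\<integral>\<^sup>+ \<eta>. (SUP i. U i) \<eta> \<partial>list_measure M) = (SUP i. \<Sum>n. list_integral M n (U i))"
    unfolding SUP_apply using seq by (subst nn_integral_monotone_convergence_SUP) auto
  also have "\<dots> = (\<Sum>n. SUP i. list_integral M n (U i))"
    by (rule ennreal_suminf_SUP_eq[symmetric])
      (use seq(3) in \<open>auto simp: list_integral_def incseq_def le_fun_def intro!: nn_integral_mono\<close>)
  also have "\<dots> = (\<Sum>n. list_integral M n (SUP i. U i))"
    unfolding list_integral_def SUP_apply
    by (subst nn_integral_monotone_convergence_SUP)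
      (use seq(3) in \<open>auto simp: incseq_def le_fun_def intro!: measurable_on_lists_of_length seq(1)\<close>)
  finally show ?case .
qed

lemma list_integral_0: "list_integral M 0 F = F []"
  by (simp add: list_integral_def PiM_empty)

lemma list_integral_cong:
  "(\<And>\<eta>. \<eta> \<in> lists (space M) \<Longrightarrow> length \<eta> = n \<Longrightarrow> F \<eta> = G \<eta>) \<Longrightarrow> list_integral M n F = list_integral M n G"
  unfolding list_integral_def by (intro nn_integral_cong) (simp only: map_upt_in_lists length_map length_upt diff_zero)

lemma list_integral_add:
  assumes "F \<in> borel_measurable (list_measure M)" "G \<in> borel_measurable (list_measure M)"
  shows "list_integral M n (\<lambda>\<eta>. F \<eta> + G \<eta>) = list_integral M n F + list_integral M n G"
  unfolding list_integral_def by (intro nn_integral_add measurable_on_lists_of_length assms)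

lemma list_integral_sum:
  assumes "\<And>i. i \<in> I \<Longrightarrow> F i \<in> borel_measurable (list_measure M)"
  shows "list_integral M n (\<lambda>\<eta>. \<Sum>i\<in>I. F i \<eta>) = (\<Sum>i\<in>I. list_integral M n (F i))"
  unfolding list_integral_def by (intro nn_integral_sum measurable_on_lists_of_length assms)

lemma list_integral_suminf:
  assumes "\<And>i. F i \<in> borel_measurable (list_measure M)"
  shows "list_integral M n (\<lambda>\<eta>. \<Sum>i. F i \<eta>) = (\<Sum>i. list_integral M n (F i))"
  unfolding list_integral_def by (intro nn_integral_suminf measurable_on_lists_of_length assms)

lemma list_integral_Suc:
  assumes M: "sigma_finite_measure M" and F: "F \<in> borel_measurable (list_measure M)"
  shows "list_integral M (Suc n) F = list_integral M n (\<lambda>\<eta>. \<integral>\<^sup>+ x. F (\<eta> @ [x]) \<partial>M)"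
proof -
  interpret product_sigma_finite "\<lambda>_. M" using M by (simp add: product_sigma_finite_def)
  have "list_integral M (Suc n) F = (\<integral>\<^sup>+ f. (\<integral>\<^sup>+ x. F (map (f(n := x)) [0..<Suc n]) \<partial>M) \<partial>(\<Pi>\<^sub>M i\<in>{..<n}. M))"
    unfolding list_integral_def lessThan_Suc
    by (rule product_nn_integral_insert) (use measurable_on_lists_of_length[OF F, of "Suc n"] in \<open>simp_all add: lessThan_Suc\<close>)
  also have "\<dots> = list_integral M n (\<lambda>\<eta>. \<integral>\<^sup>+ x. F (\<eta> @ [x]) \<partial>M)"
    by (simp add: list_integral_def)
  finally show ?thesis .
qed

lemma measurable_nn_integral_snd:
  assumes "sigma_finite_measure M" "(\<lambda>p. G (fst p) (snd p)) \<in> borel_measurable (N \<Otimes>\<^sub>M M)"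
  shows "(\<lambda>\<eta>. \<integral>\<^sup>+ x. G \<eta> x \<partial>M) \<in> borel_measurable N"
  by (rule sigma_finite_measure.borel_measurable_nn_integral[OF assms(1)]) (use assms(2) in \<open>simp add: case_prod_beta'\<close>)

text \<open>Powers of a measure are symmetric under permuting coordinates, so the extra variable may
  sit at any position. The induction peels off the last coordinate \<open>z\<close> and lets Fubini
  exchange it with the inserted \<open>y\<close>. Removing the element at position \<open>i\<close>
  is undone in this way.\<close>

lemma list_integral_insert:
  assumes M: "sigma_finite_measure M" and "F \<in> borel_measurable (list_measure M)" "i \<le> n"
  shows "list_integral M (Suc n) F = list_integral M n (\<lambda>\<eta>. \<integral>\<^sup>+ y. F (take i \<eta> @ y # drop i \<eta>) \<partial>M)"
  using assms(2,3)
proof (induction n arbitrary: F)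
  case 0
  then show ?case by (simp add: list_integral_Suc[OF M] list_integral_0)
next
  case (Suc n)
  interpret sigma_finite_measure M by fact
  interpret pair_sigma_finite M M ..
  note [measurable] = Suc.prems(1)
  show ?case
  proof (cases "i = Suc n")
    case True
    then show ?thesis
      by (subst list_integral_Suc[OF M Suc.prems(1)]) (auto intro!: list_integral_cong)
  next
    case False
    then have i: "i \<le> n" using Suc.prems by simp
    have "list_integral M (Suc (Suc n)) F = list_integral M (Suc n) (\<lambda>\<eta>. \<integral>\<^sup>+ z. F (\<eta> @ [z]) \<partial>M)"
      by (rule list_integral_Suc[OF M Suc.prems(1)])
    also have "\<dots> = list_integral M n (\<lambda>\<eta>. \<integral>\<^sup>+ y. (\<integral>\<^sup>+ z. F ((take i \<eta> @ y # drop i \<eta>) @ [z]) \<partial>M) \<partial>M)"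
      by (rule Suc.IH[OF _ i]) measurable
    also have "\<dots> = list_integral M n (\<lambda>\<eta>. \<integral>\<^sup>+ z. (\<integral>\<^sup>+ y. F ((take i \<eta> @ y # drop i \<eta>) @ [z]) \<partial>M) \<partial>M)"
    proof (rule list_integral_cong)
      fix \<eta> assume "\<eta> \<in> lists (space M)"
      then have [measurable]: "\<eta> \<in> space (list_measure M)" by (simp only: space_list_measure)
      show "(\<integral>\<^sup>+ y. (\<integral>\<^sup>+ z. F ((take i \<eta> @ y # drop i \<eta>) @ [z]) \<partial>M) \<partial>M) =
        (\<integral>\<^sup>+ z. (\<integral>\<^sup>+ y. F ((take i \<eta> @ y # drop i \<eta>) @ [z]) \<partial>M) \<partial>M)"
        by (rule Fubini') measurable
    qed
    also have "\<dots> = list_integral M n (\<lambda>\<eta>. \<integral>\<^sup>+ z. (\<integral>\<^sup>+ y. F (take i (\<eta> @ [z]) @ y # drop i (\<eta> @ [z])) \<partial>M) \<partial>M)"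
      using i by (intro list_integral_cong nn_integral_cong) simp
    also have "\<dots> = list_integral M (Suc n) (\<lambda>\<eta>. \<integral>\<^sup>+ y. F (take i \<eta> @ y # drop i \<eta>) \<partial>M)"
      by (rule list_integral_Suc[OF M, symmetric]) measurable
    finally show ?thesis .
  qed
qed

section \<open>The rate kernel of the FIFM process\<close>

text \<open>In a general metric space the distance need not be measurable for the product of the
  Borel \<sigma>-algebras. Total boundedness of \<open>D\<close> supplies countably many centres
  that approximate every point of \<open>D\<close>, and the set becomes a countable union of
  rectangles of balls whose radii \<open>r\<close> and \<open>c - r\<close> add up to
  \<open>c\<close>.\<close>

lemma measurable_dist_less_compact:
  assumes D: "compact (D :: 'a::metric_space set)" and M: "sets M = sets (restrict_space borel D)"
  shows "Measurable.pred (M \<Otimes>\<^sub>M M) (\<lambda>p. dist (fst p) (snd p) < c)"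
proof -
  have sp: "space M = D" using sets_eq_imp_space_eq[OF M] by (simp add: space_restrict_space)
  have "\<exists>k. finite k \<and> D \<subseteq> (\<Union>x\<in>k. ball x (1 / real (Suc n)))" for n
    using compact_eq_totally_bounded[of D] D by (meson divide_pos_pos of_nat_0_less_iff zero_less_Suc zero_less_one)
  then obtain k where k: "\<And>n. finite (k n)" "\<And>n. D \<subseteq> (\<Union>x\<in>k n. ball x (1 / real (Suc n)))"
    by metis
  define T where "T = (\<Union>n. k n)"
  have T: "countable T" unfolding T_def using k(1) by (auto intro: countable_finite)
  have bm: "D \<inter> ball t r \<in> sets M" for t r
    unfolding M by (simp add: sets_restrict_space)
  have "{p \<in> space (M \<Otimes>\<^sub>M M). dist (fst p) (snd p) < c} =
    (\<Union>t\<in>T. \<Union>r\<in>\<rat>. (D \<inter> ball t r) \<times> (D \<inter> ball t (c - r)))"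
  proof (intro set_eqI iffI)
    fix p assume "p \<in> {p \<in> space (M \<Otimes>\<^sub>M M). dist (fst p) (snd p) < c}"
    then obtain x y where p: "p = (x, y)" "x \<in> D" "y \<in> D" "dist x y < c"
      by (auto simp: space_pair_measure sp)
    \<comment> \<open>\<open>d\<close> is the slack in \<open>dist x y < c\<close>. A centre within
      \<open>d / 4\<close> of \<open>x\<close> and a rational radius between \<open>d / 4\<close>
      and \<open>d / 2\<close> leave room for \<open>dist t y < c - r\<close>.\<close>
    define d where "d = c - dist x y"
    have d: "d > 0" using p by (simp add: d_def)
    obtain n where n: "inverse (real (Suc n)) < d / 4" using reals_Archimedean[of "d / 4"] d by auto
    obtain t where t: "t \<in> k n" "dist t x < d / 4" using k(2)[of n] p(2) n by (force simp: inverse_eq_divide)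
    obtain r where r: "r \<in> \<rat>" "d / 4 < r" "r < d / 2" using Rats_dense_in_real[of "d / 4" "d / 2"] d by auto
    have "dist t y \<le> dist t x + dist x y" by (rule dist_triangle)
    also have "\<dots> < c - r" using t(2) r(3) d by (simp add: d_def)
    finally show "p \<in> (\<Union>t\<in>T. \<Union>r\<in>\<rat>. (D \<inter> ball t r) \<times> (D \<inter> ball t (c - r)))"
      using p t r by (auto simp: T_def intro!: bexI[of _ t] bexI[of _ r])
  next
    fix p assume "p \<in> (\<Union>t\<in>T. \<Union>r\<in>\<rat>. (D \<inter> ball t r) \<times> (D \<inter> ball t (c - r)))"
    then obtain t r x y where p: "p = (x, y)" "x \<in> D" "y \<in> D" "dist t x < r" "dist t y < c - r" by auto
    have "dist x y \<le> dist t x + dist t y" by (metis dist_commute dist_triangle)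
    then show "p \<in> {p \<in> space (M \<Otimes>\<^sub>M M). dist (fst p) (snd p) < c}"
      using p by (auto simp: space_pair_measure sp)
  qed
  also have "\<dots> \<in> sets (M \<Otimes>\<^sub>M M)"
    by (intro sets.countable_UN'' countable_rat T pair_measureI bm)
  finally show ?thesis by (simp add: pred_def)
qed

lemma UNIV_color: "(UNIV :: color set) = {Red, Blue}"
  using color.exhaust by auto

lemma finite_UNIV_color: "finite (UNIV :: color set)"
  by (simp add: UNIV_color)

lemma opposite_eq_iff: "c = opposite c' \<longleftrightarrow> (c = Red \<and> c' = Blue \<or> c = Blue \<and> c' = Red)"
  by (cases c; cases c') auto

lemma opposite_opposite [simp]: "opposite (opposite c) = c"
  by (cases c) auto

locale fifm =
  fixes D :: "'a::metric_space set" and lam :: "'a measure" and mu :: real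
  assumes compact_D: "compact D" and radon: "radon_measure_on D lam" and mu_pos: "mu > 0"
begin

abbreviation "C \<equiv> colored lam"
abbreviation "S \<equiv> fifm_states lam"
abbreviation "R \<equiv> fifm_rates D lam mu"
abbreviation "L \<equiv> measure lam D"
abbreviation "N \<eta> \<equiv> Nbr D (set \<eta>)"

lemma sets_lam: "sets lam = sets (restrict_space borel D)"
  using radon by (simp add: radon_measure_on_def)

lemma space_lam: "space lam = D"
  using sets_eq_imp_space_eq[OF sets_lam] by (simp add: space_restrict_space)

lemma finite_lam: "finite_measure lam"
  using radon compact_D by (intro finite_measureI) (auto simp: radon_measure_on_def space_lam)

sublocale lam: finite_measure lam by (rule finite_lam)

lemma space_C: "space C = D \<times> UNIV"
  by (simp add: colored_def space_pair_measure space_lam)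

lemma emeasure_C_space: "emeasure C (space C) = ennreal (2 * L)"
proof -
  interpret c: finite_measure "count_space (UNIV :: color set)"
    by (rule finite_measure_count_space[OF finite_UNIV_color])
  have "emeasure C (space C) = emeasure lam D * emeasure (count_space UNIV) (UNIV :: color set)"
    unfolding space_C unfolding colored_def
    by (rule c.emeasure_pair_measure_Times) (simp_all add: space_lam[symmetric])
  also have "\<dots> = ennreal L * 2"
    by (simp add: lam.emeasure_eq_measure UNIV_color)
  finally show ?thesis by (simp add: mult.commute ennreal_mult)
qed

sublocale C: finite_measure C
  by (rule finite_measureI) (simp add: emeasure_C_space)

lemma sigma_finite_C: "sigma_finite_measure C" ..

lemma nbr_sym: "x \<in> space C \<Longrightarrow> y \<in> nbr D x \<Longrightarrow> x \<in> nbr D y"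
  by (auto simp: nbr_def space_C dist_commute)

lemma not_nbr_self: "x \<notin> nbr D x"
  by (cases "snd x") (auto simp: nbr_def)

lemma measurable_nbr: "Measurable.pred (C \<Otimes>\<^sub>M C) (\<lambda>p. snd p \<in> nbr D (fst p))"
proof -
  have [measurable]: "Measurable.pred (C \<Otimes>\<^sub>M C) (\<lambda>p. dist (fst (fst p)) (fst (snd p)) < 1)"
    using measurable_compose[OF _ measurable_dist_less_compact[OF compact_D sets_lam, of 1],
      of "\<lambda>p. (fst (fst p), fst (snd p))" "C \<Otimes>\<^sub>M C"] by (simp add: colored_def)
  have [measurable]: "Measurable.pred (C \<Otimes>\<^sub>M C) (\<lambda>p. snd (fst p) = c)" "Measurable.pred (C \<Otimes>\<^sub>M C) (\<lambda>p. snd (snd p) = c)" for c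
    unfolding colored_def by measurable
  have "Measurable.pred (C \<Otimes>\<^sub>M C) (\<lambda>p. (snd (snd p) = Red \<and> snd (fst p) = Blue \<or> snd (snd p) = Blue \<and> snd (fst p) = Red) \<and> dist (fst (fst p)) (fst (snd p)) < 1)"
    by measurable
  then show ?thesis
    by (rule measurable_cong[THEN iffD1, rotated])
      (auto simp: nbr_def opposite_eq_iff space_pair_measure space_C)
qed

lemma measurable_Nbr: "Measurable.pred (S \<Otimes>\<^sub>M C) (\<lambda>p. snd p \<in> N (fst p))"
  using Measurable_pred_ex_in_list[where P = "\<lambda>x y. y \<in> nbr D x", OF measurable_nbr]
  by (simp add: fifm_states_def Nbr_def)

lemma sets_nbr [measurable]: "nbr D x \<in> sets C"
proof -
  have "nbr D x = (D \<inter> ball (fst x) 1) \<times> {opposite (snd x)}"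
    by (auto simp: nbr_def)
  moreover have "D \<inter> ball (fst x) 1 \<in> sets lam"
    unfolding sets_lam by (simp add: sets_restrict_space)
  ultimately show ?thesis by (simp add: colored_def)
qed

lemma sets_Nbr [measurable]: "N \<eta> \<in> sets C"
  unfolding Nbr_def by (intro sets.finite_UN) auto

lemma Nbr_snoc: "N (\<eta> @ [x]) = N \<eta> \<union> nbr D x"
  by (auto simp: Nbr_def)

lemma measure_Nbr_snoc: "measure C (N (\<eta> @ [x])) = measure C (N \<eta>) + measure C (nbr D x - N \<eta>)"
  unfolding Nbr_snoc by (subst C.finite_measure_Union[symmetric]) auto

text \<open>Here \<gamma> is the part of the list ahead of \<open>y\<close>: earlier elements have
  priority, so \<open>y\<close> is matched only by arrivals that none of them can take.\<close>

definition removal_rate :: "'a \<times> color \<Rightarrow> ('a \<times> color) list \<Rightarrow> real" where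
  "removal_rate y \<gamma> = mu + measure C (nbr D y - N \<gamma>)"

lemma removal_rate_pos: "removal_rate y \<gamma> > 0"
  using mu_pos by (simp add: removal_rate_def add_pos_nonneg)

lemma ennreal_removal_rate: "ennreal mu + emeasure C (nbr D y - N \<gamma>) = ennreal (removal_rate y \<gamma>)"
  using mu_pos by (simp add: removal_rate_def C.emeasure_eq_measure)

lemma measurable_removal_rate [measurable (raw)]:
  assumes "g \<in> measurable M C" "h \<in> measurable M S"
  shows "(\<lambda>p. removal_rate (g p) (h p)) \<in> borel_measurable M"
proof -
  let ?P = "\<lambda>p. snd p \<in> nbr D (fst (fst p)) \<and> snd p \<notin> N (snd (fst p))"
  have [measurable]: "Measurable.pred ((C \<Otimes>\<^sub>M S) \<Otimes>\<^sub>M C) (\<lambda>p. snd p \<in> nbr D (fst (fst p)))"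
    using measurable_compose[OF _ measurable_nbr, of "\<lambda>p. (fst (fst p), snd p)" "(C \<Otimes>\<^sub>M S) \<Otimes>\<^sub>M C"] by simp
  have [measurable]: "Measurable.pred ((C \<Otimes>\<^sub>M S) \<Otimes>\<^sub>M C) (\<lambda>p. snd p \<in> N (snd (fst p)))"
    using measurable_compose[OF _ measurable_Nbr, of "\<lambda>p. (snd (fst p), snd p)" "(C \<Otimes>\<^sub>M S) \<Otimes>\<^sub>M C"] by simp
  have "Measurable.pred ((C \<Otimes>\<^sub>M S) \<Otimes>\<^sub>M C) ?P" by measurable
  then have "{p \<in> space ((C \<Otimes>\<^sub>M S) \<Otimes>\<^sub>M C). ?P p} \<in> sets ((C \<Otimes>\<^sub>M S) \<Otimes>\<^sub>M C)" by (simp add: pred_def)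
  from C.measurable_emeasure_Pair[OF this]
  have "(\<lambda>p. enn2real (emeasure C (Pair p -` {p \<in> space ((C \<Otimes>\<^sub>M S) \<Otimes>\<^sub>M C). ?P p}))) \<in> borel_measurable (C \<Otimes>\<^sub>M S)"
    by measurable
  then have "(\<lambda>p. mu + enn2real (emeasure C (Pair p -` {p \<in> space ((C \<Otimes>\<^sub>M S) \<Otimes>\<^sub>M C). ?P p}))) \<in> borel_measurable (C \<Otimes>\<^sub>M S)"
    by measurable
  moreover have "removal_rate (fst p) (snd p) = mu + enn2real (emeasure C (Pair p -` {p \<in> space ((C \<Otimes>\<^sub>M S) \<Otimes>\<^sub>M C). ?P p}))"
    if "p \<in> space (C \<Otimes>\<^sub>M S)" for p
  proof -
    have "Pair p -` {p \<in> space ((C \<Otimes>\<^sub>M S) \<Otimes>\<^sub>M C). ?P p} = nbr D (fst p) - N (snd p)"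
      using that by (auto simp: space_pair_measure dest: subsetD[OF sets.sets_into_space[OF sets_nbr]])
    then show ?thesis by (simp add: removal_rate_def measure_def)
  qed
  ultimately have "(\<lambda>p. removal_rate (fst p) (snd p)) \<in> borel_measurable (C \<Otimes>\<^sub>M S)"
    by (subst measurable_cong) auto
  from measurable_compose[OF measurable_Pair[OF assms] this] show ?thesis by simp
qed

lemma measurable_snoc_fixed:
  assumes "\<eta> \<in> space S" "f \<in> borel_measurable S"
  shows "(\<lambda>x. f (\<eta> @ [x])) \<in> borel_measurable C"
proof -
  have "(\<lambda>x. \<eta> @ [x]) \<in> measurable C (list_measure C)"
    using assms(1) by (intro measurable_append_single) (simp_all add: fifm_states_def)
  from measurable_compose[OF this] show ?thesis using assms(2) by (simp add: fifm_states_def)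
qed

lemma space_S: "space S = lists (space C)"
  by (simp only: fifm_states_def space_list_measure)

lemma sets_R: "sets (R \<eta>) = sets S"
  by (simp add: fifm_rates_def)

lemma delete_in_space: "\<eta> \<in> space S \<Longrightarrow> take i \<eta> @ drop (Suc i) \<eta> \<in> space S"
  using measurable_space[OF measurable_delete_nth[of i C]] by (simp add: fifm_states_def)

lemma snoc_in_space: "\<eta> \<in> space S \<Longrightarrow> x \<in> space C \<Longrightarrow> \<eta> @ [x] \<in> space S"
  by (simp add: space_S)

lemma nn_integral_R:
  assumes f: "f \<in> borel_measurable S" and \<eta>: "\<eta> \<in> space S"
  shows "(\<integral>\<^sup>+ \<gamma>. f \<gamma> \<partial>R \<eta>) =
    (\<Sum>i<length \<eta>. ennreal (removal_rate (\<eta> ! i) (take i \<eta>)) * f (take i \<eta> @ drop (Suc i) \<eta>)) +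
    (\<integral>\<^sup>+ x. indicator (- N \<eta>) x * f (\<eta> @ [x]) \<partial>C)"
proof -
  have [measurable]: "(\<lambda>x. indicator (- N \<eta>) x :: ennreal) \<in> borel_measurable C"
    unfolding indicator_compl by measurable
  have sp: "space (R \<eta>) = space S" by (rule sets_eq_imp_space_eq[OF sets_R])
  have mR: "borel_measurable (R \<eta>) = borel_measurable S" by (rule measurable_cong_sets[OF sets_R refl])
  show ?thesis
    using f
  proof (induction rule: borel_measurable_induct)
    case (cong f g)
    have "(\<integral>\<^sup>+ \<gamma>. f \<gamma> \<partial>R \<eta>) = (\<integral>\<^sup>+ \<gamma>. g \<gamma> \<partial>R \<eta>)"
      by (rule nn_integral_cong) (simp only: cong(3) sp)
    moreover have "(\<integral>\<^sup>+ x. indicator (- N \<eta>) x * f (\<eta> @ [x]) \<partial>C) = (\<integral>\<^sup>+ x. indicator (- N \<eta>) x * g (\<eta> @ [x]) \<partial>C)"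
      by (rule nn_integral_cong) (simp only: cong(3) snoc_in_space[OF \<eta>])
    ultimately show ?case using cong(4) by (simp only: cong(3) delete_in_space[OF \<eta>])
  next
    case (set A)
    then have "(\<integral>\<^sup>+ \<gamma>. indicator A \<gamma> \<partial>R \<eta>) = emeasure (R \<eta>) A"
      by (intro nn_integral_indicator) (simp only: sets_R)
    then show ?case
      by (simp only: emeasure_fifm_rates[OF sets_lam \<eta> set] ennreal_removal_rate)
  next
    case (mult u c)
    note [measurable] = measurable_snoc_fixed[OF \<eta> mult(2)]
    have "(\<integral>\<^sup>+ \<gamma>. c * u \<gamma> \<partial>R \<eta>) = c * (\<integral>\<^sup>+ \<gamma>. u \<gamma> \<partial>R \<eta>)"
      by (rule nn_integral_cmult) (simp only: mR mult(2))
    also have "\<dots> = (\<Sum>i<length \<eta>. ennreal (removal_rate (\<eta> ! i) (take i \<eta>)) * (c * u (take i \<eta> @ drop (Suc i) \<eta>))) +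
      (\<integral>\<^sup>+ x. c * (indicator (- N \<eta>) x * u (\<eta> @ [x])) \<partial>C)"
      unfolding mult.IH by (simp add: nn_integral_cmult distrib_left sum_distrib_left mult_ac)
    finally show ?case by (simp add: mult_ac)
  next
    case (add u v)
    note [measurable] = measurable_snoc_fixed[OF \<eta> add(1)] measurable_snoc_fixed[OF \<eta> add(3)]
    have "(\<integral>\<^sup>+ \<gamma>. v \<gamma> + u \<gamma> \<partial>R \<eta>) = (\<integral>\<^sup>+ \<gamma>. v \<gamma> \<partial>R \<eta>) + (\<integral>\<^sup>+ \<gamma>. u \<gamma> \<partial>R \<eta>)"
      by (rule nn_integral_add) (simp_all only: mR add)
    then show ?case
      using add by (simp add: nn_integral_add distrib_left sum.distrib add_ac)
  next
    case (seq U)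
    note [measurable] = measurable_snoc_fixed[OF \<eta> seq(1)]
    have inc: "incseq (\<lambda>i. U i \<gamma>)" for \<gamma> using seq(3) by (auto simp: incseq_def le_fun_def)
    have "(\<integral>\<^sup>+ \<gamma>. (SUP j. U j) \<gamma> \<partial>R \<eta>) = (SUP j. \<integral>\<^sup>+ \<gamma>. U j \<gamma> \<partial>R \<eta>)"
      unfolding SUP_apply by (rule nn_integral_monotone_convergence_SUP) (use seq in \<open>simp_all only: mR\<close>)
    also have "\<dots> = (SUP j. (\<Sum>i<length \<eta>. ennreal (removal_rate (\<eta> ! i) (take i \<eta>)) * U j (take i \<eta> @ drop (Suc i) \<eta>)) +
      (\<integral>\<^sup>+ x. indicator (- N \<eta>) x * U j (\<eta> @ [x]) \<partial>C))"
      by (simp only: seq)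
    also have "\<dots> = (SUP j. (\<Sum>i<length \<eta>. ennreal (removal_rate (\<eta> ! i) (take i \<eta>)) * U j (take i \<eta> @ drop (Suc i) \<eta>))) +
      (SUP j. \<integral>\<^sup>+ x. indicator (- N \<eta>) x * U j (\<eta> @ [x]) \<partial>C)"
      using inc
      by (intro ennreal_SUP_add) (auto simp: incseq_def intro!: sum_mono mult_left_mono nn_integral_mono)
    also have "(SUP j. (\<Sum>i<length \<eta>. ennreal (removal_rate (\<eta> ! i) (take i \<eta>)) * U j (take i \<eta> @ drop (Suc i) \<eta>))) =
      (\<Sum>i<length \<eta>. ennreal (removal_rate (\<eta> ! i) (take i \<eta>)) * (SUP j. U j) (take i \<eta> @ drop (Suc i) \<eta>))"
      unfolding SUP_apply SUP_mult_left_ennreal using inc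
      by (intro ennreal_SUP_sum) (auto simp: incseq_def intro!: mult_left_mono)
    also have "(SUP j. \<integral>\<^sup>+ x. indicator (- N \<eta>) x * U j (\<eta> @ [x]) \<partial>C) =
      (\<integral>\<^sup>+ x. indicator (- N \<eta>) x * (SUP j. U j) (\<eta> @ [x]) \<partial>C)"
      unfolding SUP_apply SUP_mult_left_ennreal using inc
      by (intro nn_integral_monotone_convergence_SUP[symmetric]) (auto simp: incseq_def le_fun_def intro!: mult_left_mono)
    finally show ?case .
  qed
qed

text \<open>The regions \<open>nbr D (\<eta> ! i) - N (take i \<eta>)\<close> partition
  \<open>N \<eta>\<close>, so every arrival that finds a partner is counted exactly once.\<close>

lemma sum_removal_rate: "(\<Sum>i<length \<eta>. removal_rate (\<eta> ! i) (take i \<eta>)) = real (length \<eta>) * mu + measure C (N \<eta>)"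
proof (induction \<eta> rule: rev_induct)
  case Nil
  show ?case by (simp add: Nbr_def)
next
  case (snoc x \<eta>)
  have "(\<Sum>i<length \<eta>. removal_rate ((\<eta> @ [x]) ! i) (take i (\<eta> @ [x]))) = (\<Sum>i<length \<eta>. removal_rate (\<eta> ! i) (take i \<eta>))"
    by (intro sum.cong) (auto simp: nth_append)
  then show ?case
    using snoc by (simp add: measure_Nbr_snoc removal_rate_def algebra_simps del: set_append)
qed

lemma compl_Nbr_integral: "(\<integral>\<^sup>+ x. indicator (- N \<eta>) x \<partial>C) = ennreal (2 * L - measure C (N \<eta>))"
proof -
  have "(\<integral>\<^sup>+ x. indicator (- N \<eta>) x \<partial>C) = (\<integral>\<^sup>+ x. indicator (space C - N \<eta>) x \<partial>C)"
    by (intro nn_integral_cong) (auto simp: indicator_def)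
  also have "\<dots> = ennreal (measure C (space C) - measure C (N \<eta>))"
    by (simp add: C.emeasure_eq_measure C.finite_measure_compl)
  finally show ?thesis using emeasure_C_space by (simp add: measure_def)
qed

lemma measure_Nbr_le: "measure C (N \<eta>) \<le> 2 * L"
  using C.bounded_measure[of "N \<eta>"] emeasure_C_space by (simp add: measure_def)

text \<open>Every arrival changes the state: it is either matched or appended. Arrivals therefore
  contribute \<open>2 * L\<close> whatever the state is, and each present element adds its own rate
  \<open>mu\<close>.\<close>

lemma emeasure_R_space:
  assumes "\<eta> \<in> space S"
  shows "emeasure (R \<eta>) (space S) = ennreal (2 * L + real (length \<eta>) * mu)"
proof -
  have sp: "space (R \<eta>) = space S" by (rule sets_eq_imp_space_eq[OF sets_R])
  have "emeasure (R \<eta>) (space S) = (\<integral>\<^sup>+ \<gamma>. 1 \<partial>R \<eta>)" by (simp add: sp)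
  also have "\<dots> = (\<Sum>i<length \<eta>. ennreal (removal_rate (\<eta> ! i) (take i \<eta>))) + (\<integral>\<^sup>+ x. indicator (- N \<eta>) x \<partial>C)"
    by (subst nn_integral_R[OF _ assms]) simp_all
  also have "(\<integral>\<^sup>+ x. indicator (- N \<eta>) x \<partial>C) = ennreal (2 * L - measure C (N \<eta>))"
    by (rule compl_Nbr_integral)
  also have "(\<Sum>i<length \<eta>. ennreal (removal_rate (\<eta> ! i) (take i \<eta>))) = ennreal (real (length \<eta>) * mu + measure C (N \<eta>))"
    by (subst sum_removal_rate[symmetric]) (simp add: sum_ennreal less_imp_le[OF removal_rate_pos])
  also have "\<dots> + ennreal (2 * L - measure C (N \<eta>)) = ennreal (2 * L + real (length \<eta>) * mu)"
    using measure_Nbr_le[of \<eta>] mu_pos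
    by (simp add: ennreal_plus[symmetric] add_ac del: ennreal_plus)
  finally show ?thesis .
qed

lemma measurable_departures:
  assumes "g \<in> borel_measurable S"
  shows "(\<lambda>\<eta>. \<Sum>i<length \<eta>. ennreal (removal_rate (\<eta> ! i) (take i \<eta>)) * g (take i \<eta> @ drop (Suc i) \<eta>))
    \<in> borel_measurable (list_measure C)"
proof -
  have g': "g \<in> borel_measurable (list_measure C)" using assms by (simp add: fifm_states_def)
  show ?thesis
  proof (rule measurable_list_measureI)
    fix n
    have "(\<lambda>f. removal_rate (f i) (take i (map f [0..<n]))) \<in> borel_measurable (\<Pi>\<^sub>M i\<in>{..<n}. C)" if "i < n" for i
    proof (rule measurable_removal_rate)
      show "(\<lambda>f. f i) \<in> measurable (\<Pi>\<^sub>M i\<in>{..<n}. C) C" using that by simp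
      show "(\<lambda>f. take i (map f [0..<n])) \<in> measurable (\<Pi>\<^sub>M i\<in>{..<n}. C) S"
        unfolding fifm_states_def by (rule measurable_compose[OF measurable_map_upt measurable_take])
    qed
    moreover have "(\<lambda>f. g (take i (map f [0..<n]) @ drop (Suc i) (map f [0..<n]))) \<in> borel_measurable (\<Pi>\<^sub>M i\<in>{..<n}. C)" for i
      by (rule measurable_compose[OF measurable_compose[OF measurable_map_upt measurable_delete_nth] g'])
    ultimately have "(\<lambda>f. \<Sum>i<n. ennreal (removal_rate (f i) (take i (map f [0..<n]))) * g (take i (map f [0..<n]) @ drop (Suc i) (map f [0..<n])))
      \<in> borel_measurable (\<Pi>\<^sub>M i\<in>{..<n}. C)"
      by (intro borel_measurable_sum borel_measurable_times measurable_compose[OF _ measurable_ennreal]) auto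
    moreover have "(\<Sum>i<n. ennreal (removal_rate (f i) (take i (map f [0..<n]))) * g (take i (map f [0..<n]) @ drop (Suc i) (map f [0..<n]))) =
      (\<Sum>i<length (map f [0..<n]). ennreal (removal_rate (map f [0..<n] ! i) (take i (map f [0..<n]))) * g (take i (map f [0..<n]) @ drop (Suc i) (map f [0..<n])))" for f
      by (intro sum.cong) simp_all
    ultimately show "(\<lambda>f. \<Sum>i<length (map f [0..<n]). ennreal (removal_rate (map f [0..<n] ! i) (take i (map f [0..<n]))) * g (take i (map f [0..<n]) @ drop (Suc i) (map f [0..<n])))
      \<in> borel_measurable (\<Pi>\<^sub>M i\<in>{..<n}. C)" by (simp only:)
  qed
qed

lemma measurable_arrivals:
  assumes "g \<in> borel_measurable S"
  shows "(\<lambda>\<eta>. \<integral>\<^sup>+ x. indicator (- N \<eta>) x * g (\<eta> @ [x]) \<partial>C) \<in> borel_measurable (list_measure C)"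
proof (rule measurable_nn_integral_snd[OF sigma_finite_C])
  have "g \<in> borel_measurable (list_measure C)" using assms by (simp add: fifm_states_def)
  note [measurable] = measurable_compose[OF _ this] measurable_Nbr[unfolded fifm_states_def]
  have "(\<lambda>p. (if snd p \<in> N (fst p) then 0 else 1) * g (fst p @ [snd p])) \<in> borel_measurable (list_measure C \<Otimes>\<^sub>M C)"
    by measurable
  then show "(\<lambda>p. indicator (- N (fst p)) (snd p) * g (fst p @ [snd p])) \<in> borel_measurable (list_measure C \<Otimes>\<^sub>M C)"
    by (rule measurable_cong[THEN iffD1, rotated]) (simp add: indicator_def)
qed

lemma measurable_R_emeasure:
  assumes A: "A \<in> sets S"
  shows "(\<lambda>\<eta>. emeasure (R \<eta>) A) \<in> borel_measurable S"
proof -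
  have "indicator A \<in> borel_measurable S" using A by simp
  then have "(\<lambda>\<eta>. (\<Sum>i<length \<eta>. ennreal (removal_rate (\<eta> ! i) (take i \<eta>)) * indicator A (take i \<eta> @ drop (Suc i) \<eta>)) +
      (\<integral>\<^sup>+ x. indicator (- N \<eta>) x * indicator A (\<eta> @ [x]) \<partial>C)) \<in> borel_measurable S"
    unfolding fifm_states_def
    by (intro borel_measurable_add measurable_departures measurable_arrivals) (simp_all add: fifm_states_def)
  then show ?thesis
    by (rule measurable_cong[THEN iffD1, rotated]) (simp only: emeasure_fifm_rates[OF sets_lam _ A] ennreal_removal_rate)
qed

sublocale jump_kernel S R
  by unfold_locales (simp_all add: sets_R emeasure_R_space measurable_R_emeasure)

lemma exit_rate_R: "\<eta> \<in> space S \<Longrightarrow> exit_rate R \<eta> = 2 * L + real (length \<eta>) * mu"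
  using emeasure_R_space[of \<eta>] mu_pos by (simp add: exit_rate_def space_Q measure_def del: ennreal_plus)

end

lemma list_integral_mono:
  "(\<And>\<eta>. \<eta> \<in> lists (space M) \<Longrightarrow> length \<eta> = n \<Longrightarrow> F \<eta> \<le> G \<eta>) \<Longrightarrow> list_integral M n F \<le> list_integral M n G"
  unfolding list_integral_def by (intro nn_integral_mono) (simp only: map_upt_in_lists length_map length_upt diff_zero)

lemma list_integral_cmult:
  "F \<in> borel_measurable (list_measure M) \<Longrightarrow> list_integral M n (\<lambda>\<eta>. c * F \<eta>) = c * list_integral M n F"
  unfolding list_integral_def by (intro nn_integral_cmult measurable_on_lists_of_length)

lemma suminf_Suc_ennreal:
  fixes a :: "nat \<Rightarrow> ennreal"
  shows "(\<Sum>n. a n) = a 0 + (\<Sum>n. a (Suc n))"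
proof -
  have "(\<lambda>n. a (Suc n)) sums (\<Sum>n. a (Suc n))" by (rule summable_sums) simp
  then have "a sums (\<Sum>n. a n) \<longleftrightarrow> a sums ((\<Sum>n. a (Suc n)) + a 0)" using sums_Suc summable_sums by blast
  then show ?thesis
    by (metis add.commute summableI summable_sums sums_unique2 sums_Suc)
qed

lemma set_insert_at: "set (take i xs @ x # drop i xs) = insert x (set xs)"
  using append_take_drop_id[of i xs] by (metis list.simps(15) set_append Un_insert_right)

section \<open>The weight of a list and the two partial balance relations\<close>

context fifm
begin

text \<open>Validity is kept apart because the telescoping identity for this product holds for
  arbitrary lists.\<close>

definition wt :: "('a \<times> color) list \<Rightarrow> real" where
  "wt \<gamma> = (\<Prod>i=1..length \<gamma>. 1 / (measure C (N (take i \<gamma>)) + real i * mu))"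

definition vwt :: "('a \<times> color) list \<Rightarrow> real" where
  "vwt \<gamma> = of_bool (valid D \<gamma>) * wt \<gamma>"

lemma fifm_density_eq: "fifm_density D lam mu K \<gamma> = K * vwt \<gamma>"
  by (simp add: fifm_density_def vwt_def wt_def)

lemma wt_snoc: "wt (\<gamma> @ [x]) = wt \<gamma> / (measure C (N (\<gamma> @ [x])) + (real (length \<gamma>) + 1) * mu)"
proof -
  have "wt (\<gamma> @ [x]) = (\<Prod>i=1..length \<gamma>. 1 / (measure C (N (take i (\<gamma> @ [x]))) + real i * mu)) *
      (1 / (measure C (N (\<gamma> @ [x])) + (real (length \<gamma>) + 1) * mu))"
    by (simp add: wt_def add.commute)
  also have "(\<Prod>i=1..length \<gamma>. 1 / (measure C (N (take i (\<gamma> @ [x]))) + real i * mu)) = wt \<gamma>"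
    unfolding wt_def by (intro prod.cong) simp_all
  finally show ?thesis by simp
qed

lemma wt_nonneg: "wt \<gamma> \<ge> 0"
  unfolding wt_def using mu_pos by (intro prod_nonneg) simp

lemma vwt_nonneg [simp]: "vwt \<gamma> \<ge> 0"
  by (simp add: vwt_def wt_nonneg)

text \<open>Validity depends on the set of elements alone, and \<open>nbr\<close> is symmetric and
  irreflexive; so wherever a new element is inserted, it conflicts exactly when it lies in
  \<open>N \<gamma>\<close>.\<close>

lemma valid_insert:
  assumes "\<gamma> \<in> space S" "x \<in> space C" "set \<eta> = insert x (set \<gamma>)"
  shows "valid D \<eta> \<longleftrightarrow> valid D \<gamma> \<and> x \<notin> N \<gamma>"
proof -
  have "y \<in> space C" if "y \<in> set \<gamma>" for y
    using assms(1) that unfolding space_S by (auto simp only: in_lists_conv_set)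
  then show ?thesis
    using nbr_sym[OF assms(2)] nbr_sym not_nbr_self[of x]
    unfolding valid_def Nbr_def assms(3) by blast
qed

lemma vwt_snoc:
  assumes "\<gamma> \<in> space S" "x \<in> space C"
  shows "vwt (\<gamma> @ [x]) = of_bool (x \<notin> N \<gamma>) * vwt \<gamma> / (measure C (N (\<gamma> @ [x])) + (real (length \<gamma>) + 1) * mu)"
proof -
  have "valid D (\<gamma> @ [x]) \<longleftrightarrow> valid D \<gamma> \<and> x \<notin> N \<gamma>" by (rule valid_insert[OF assms]) simp
  then show ?thesis
    by (cases "valid D \<gamma>"; cases "x \<in> N \<gamma>") (simp_all add: vwt_def wt_snoc del: set_append)
qed

text \<open>Reinserting \<open>y\<close> at every possible position gives a telescoping sum, because
  \<open>removal_rate\<close> is the increment of the denominators in \<open>wt\<close>.\<close>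

lemma sum_wt_insert:
  "(\<Sum>i\<le>length \<gamma>. wt (take i \<gamma> @ y # drop i \<gamma>) * removal_rate y (take i \<gamma>)) = wt \<gamma>"
proof (induction \<gamma> rule: rev_induct)
  case Nil
  have "measure C (nbr D y) + mu > 0" using mu_pos by (simp add: add_nonneg_pos)
  then show ?case by (simp add: wt_def removal_rate_def Nbr_def add.commute)
next
  case (snoc z \<gamma>)
  define G where "G = measure C (N (\<gamma> @ [z])) + (real (length \<gamma>) + 1) * mu"
  define H where "H = measure C (N (\<gamma> @ [z, y])) + (real (length \<gamma>) + 2) * mu"
  have HG: "removal_rate y (\<gamma> @ [z]) = H - G"
    using measure_Nbr_snoc[of "\<gamma> @ [z]" y] by (simp add: G_def H_def removal_rate_def algebra_simps del: set_append)
  have pos: "G > 0" "H > 0" using mu_pos by (auto simp: G_def H_def intro!: add_nonneg_pos)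
  \<comment> \<open>However early \<open>y\<close> is inserted before \<open>z\<close>, the full
    list has the same elements as \<open>\<gamma> @ [z, y]\<close> and the same length, so its last
    factor is always \<open>1 / H\<close>. Together with the last position this gives
    \<open>wt \<gamma> / H\<close> plus \<open>wt (\<gamma> @ [z]) * (H - G) / H\<close>, where
    \<open>wt \<gamma>\<close> is \<open>wt (\<gamma> @ [z]) * G\<close>.\<close>
  have ins: "wt (take i (\<gamma> @ [z]) @ y # drop i (\<gamma> @ [z])) = wt (take i \<gamma> @ y # drop i \<gamma>) / H" if "i \<le> length \<gamma>" for i
  proof -
    have "set ((take i \<gamma> @ y # drop i \<gamma>) @ [z]) = set (\<gamma> @ [z, y])"
      unfolding set_append[of "take i \<gamma> @ y # drop i \<gamma>"] set_insert_at by auto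
    moreover have "take i (\<gamma> @ [z]) @ y # drop i (\<gamma> @ [z]) = (take i \<gamma> @ y # drop i \<gamma>) @ [z]"
      using that by simp
    moreover have "real (length (take i \<gamma> @ y # drop i \<gamma>)) + 1 = real (length \<gamma>) + 2"
      using that by simp
    ultimately show ?thesis by (simp only: wt_snoc H_def)
  qed
  have last: "wt (\<gamma> @ [z, y]) = wt (\<gamma> @ [z]) / H"
    using wt_snoc[of "\<gamma> @ [z]" y] by (simp add: H_def add_ac)
  have "(\<Sum>i\<le>length (\<gamma> @ [z]). wt (take i (\<gamma> @ [z]) @ y # drop i (\<gamma> @ [z])) * removal_rate y (take i (\<gamma> @ [z])))
    = (\<Sum>i\<le>length \<gamma>. wt (take i (\<gamma> @ [z]) @ y # drop i (\<gamma> @ [z])) * removal_rate y (take i (\<gamma> @ [z])))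
      + wt (\<gamma> @ [z, y]) * removal_rate y (\<gamma> @ [z])"
    by simp
  also have "(\<Sum>i\<le>length \<gamma>. wt (take i (\<gamma> @ [z]) @ y # drop i (\<gamma> @ [z])) * removal_rate y (take i (\<gamma> @ [z])))
    = (\<Sum>i\<le>length \<gamma>. wt (take i \<gamma> @ y # drop i \<gamma>) * removal_rate y (take i \<gamma>) / H)"
    by (intro sum.cong refl) (subst ins, simp_all)
  also have "\<dots> = wt \<gamma> / H" using snoc by (simp add: sum_divide_distrib[symmetric])
  also have "wt \<gamma> = wt (\<gamma> @ [z]) * G" using pos by (simp add: wt_snoc G_def[symmetric] del: set_append)
  finally show ?case using pos by (simp add: HG last field_simps)
qed

lemma measurable_measure_Nbr [measurable]: "(\<lambda>\<eta>. measure C (N \<eta>)) \<in> borel_measurable S"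
proof -
  have "{p \<in> space (S \<Otimes>\<^sub>M C). snd p \<in> N (fst p)} \<in> sets (S \<Otimes>\<^sub>M C)"
    using measurable_Nbr by (simp add: pred_def)
  from C.measurable_emeasure_Pair[OF this]
  have "(\<lambda>\<eta>. enn2real (emeasure C (Pair \<eta> -` {p \<in> space (S \<Otimes>\<^sub>M C). snd p \<in> N (fst p)}))) \<in> borel_measurable S"
    by measurable
  then show ?thesis
  proof (rule measurable_cong[THEN iffD1, rotated])
    fix \<eta> assume "\<eta> \<in> space S"
    then have "Pair \<eta> -` {p \<in> space (S \<Otimes>\<^sub>M C). snd p \<in> N (fst p)} = N \<eta>"
      using sets.sets_into_space[OF sets_Nbr[of \<eta>]] by (auto simp: space_pair_measure)
    then show "enn2real (emeasure C (Pair \<eta> -` {p \<in> space (S \<Otimes>\<^sub>M C). snd p \<in> N (fst p)})) = measure C (N \<eta>)"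
      by (simp add: measure_def)
  qed
qed

lemma measurable_map_upt_S: "(\<lambda>f. map f [0..<n]) \<in> measurable (\<Pi>\<^sub>M i\<in>{..<n}. C) S"
  unfolding fifm_states_def by (rule measurable_map_upt)

lemma measurable_take_S: "take i \<in> measurable S S"
  unfolding fifm_states_def by (rule measurable_take)

lemma measurable_wt: "wt \<in> borel_measurable S"
  unfolding fifm_states_def
proof (rule measurable_list_measureI)
  fix n
  have [measurable]: "(\<lambda>f. measure C (N (take i (map f [0..<n])))) \<in> borel_measurable (\<Pi>\<^sub>M i\<in>{..<n}. C)" for i
    by (rule measurable_compose[OF measurable_compose[OF measurable_map_upt_S measurable_take_S] measurable_measure_Nbr])
  have "(\<lambda>f. \<Prod>i=1..n. 1 / (measure C (N (take i (map f [0..<n]))) + real i * mu)) \<in> borel_measurable (\<Pi>\<^sub>M i\<in>{..<n}. C)"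
    by measurable
  then show "(\<lambda>f. wt (map f [0..<n])) \<in> borel_measurable (\<Pi>\<^sub>M i\<in>{..<n}. C)"
    unfolding wt_def length_map length_upt diff_zero .
qed

lemma measurable_valid: "Measurable.pred S (valid D)"
  unfolding fifm_states_def
proof (rule measurable_list_measureI)
  fix n :: nat
  have p: "Measurable.pred (\<Pi>\<^sub>M i\<in>{..<n}. C) (\<lambda>f. f i \<in> N (map f [0..<n]))" if "i < n" for i
    using measurable_compose[OF measurable_Pair[OF measurable_map_upt_S measurable_component_singleton] measurable_Nbr, of i n] that
    by simp
  have "Measurable.pred (\<Pi>\<^sub>M i\<in>{..<n}. C) (\<lambda>f. \<forall>i\<in>{..<n}. \<not> f i \<in> N (map f [0..<n]))"
    by (intro pred_intros_finite finite_lessThan pred_intros_logic p) (simp only: lessThan_iff)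
  moreover have "valid D (map f [0..<n]) \<longleftrightarrow> (\<forall>i\<in>{..<n}. \<not> f i \<in> N (map f [0..<n]))" for f
  proof -
    have "(\<forall>x\<in>set (map f [0..<n]). Z x) \<longleftrightarrow> (\<forall>i\<in>{..<n}. Z (f i))" for Z
      by (simp only: set_map set_upt atLeast0LessThan) blast
    moreover have "valid D \<eta> \<longleftrightarrow> (\<forall>x\<in>set \<eta>. \<not> x \<in> N \<eta>)" for \<eta>
      unfolding valid_def by blast
    ultimately show ?thesis by (simp only:)
  qed
  ultimately show "Measurable.pred (\<Pi>\<^sub>M i\<in>{..<n}. C) (\<lambda>f. valid D (map f [0..<n]))" by (simp only:)
qed

lemma measurable_vwt [measurable]: "vwt \<in> borel_measurable S"
proof -
  note [measurable] = measurable_valid measurable_wt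
  have "(\<lambda>\<gamma>. if valid D \<gamma> then wt \<gamma> else 0) \<in> borel_measurable S" by measurable
  then show ?thesis by (rule measurable_cong[THEN iffD1, rotated]) (simp add: vwt_def)
qed

lemma measurable_ennreal_vwt [measurable]: "(\<lambda>\<gamma>. ennreal (vwt \<gamma>)) \<in> borel_measurable (list_measure C)"
  using measurable_vwt[unfolded fifm_states_def] by measurable

text \<open>Removing position \<open>i\<close> is reversed by inserting some \<open>y\<close> there,
  and the sum over \<open>i\<close> telescopes by \<open>sum_wt_insert\<close>. What is left is the
  measure of the admissible \<open>y\<close>, namely those outside \<open>N \<gamma>\<close>, which
  is exactly the rate at which arrivals are appended to \<gamma>.\<close>

lemma list_integral_departures:
  assumes f: "f \<in> borel_measurable S"
  shows "list_integral C (Suc n) (\<lambda>\<eta>. ennreal (vwt \<eta>) *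
      (\<Sum>i<length \<eta>. ennreal (removal_rate (\<eta> ! i) (take i \<eta>)) * f (take i \<eta> @ drop (Suc i) \<eta>))) =
    list_integral C n (\<lambda>\<gamma>. ennreal (vwt \<gamma>) * ennreal (2 * L - measure C (N \<gamma>)) * f \<gamma>)"
proof -
  have f' [measurable]: "f \<in> borel_measurable (list_measure C)" using f by (simp add: fifm_states_def)
  \<comment> \<open>The value 0 beyond the end of the list makes \<open>G i\<close> measurable on
    all lists, so that sum and integral can be exchanged term by term.\<close>
  define G where "G i \<eta> = (if i < length \<eta> then ennreal (vwt \<eta>) *
    (ennreal (removal_rate (\<eta> ! i) (take i \<eta>)) * f (take i \<eta> @ drop (Suc i) \<eta>)) else 0)" for i \<eta>
  have G [measurable]: "G i \<in> borel_measurable (list_measure C)" for i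
  proof (rule measurable_list_measureI)
    fix n
    show "(\<lambda>f. G i (map f [0..<n])) \<in> borel_measurable (\<Pi>\<^sub>M i\<in>{..<n}. C)"
    proof (cases "i < n")
      case True
      have [measurable]: "(\<lambda>f. removal_rate (f i) (take i (map f [0..<n]))) \<in> borel_measurable (\<Pi>\<^sub>M i\<in>{..<n}. C)"
        using True by (intro measurable_removal_rate measurable_component_singleton
          measurable_compose[OF measurable_map_upt_S measurable_take_S]) simp
      have [measurable]: "(\<lambda>h. f (take i (map h [0..<n]) @ drop (Suc i) (map h [0..<n]))) \<in> borel_measurable (\<Pi>\<^sub>M i\<in>{..<n}. C)"
        by (rule measurable_compose[OF measurable_compose[OF measurable_map_upt measurable_delete_nth] f'])
      have [measurable]: "(\<lambda>f. vwt (map f [0..<n])) \<in> borel_measurable (\<Pi>\<^sub>M i\<in>{..<n}. C)"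
        by (rule measurable_compose[OF measurable_map_upt_S measurable_vwt])
      have "(\<lambda>h. ennreal (vwt (map h [0..<n])) * (ennreal (removal_rate (h i) (take i (map h [0..<n]))) * f (take i (map h [0..<n]) @ drop (Suc i) (map h [0..<n])))) \<in> borel_measurable (\<Pi>\<^sub>M i\<in>{..<n}. C)"
        by measurable
      moreover have "map h [0..<n] ! i = h i" for h :: "nat \<Rightarrow> 'a \<times> color" using True by simp
      ultimately show ?thesis
        unfolding G_def length_map length_upt diff_zero using True by (simp only: if_True)
    next
      case False
      then show ?thesis unfolding G_def length_map length_upt diff_zero by simp
    qed
  qed
  have "list_integral C (Suc n) (\<lambda>\<eta>. ennreal (vwt \<eta>) *
      (\<Sum>i<length \<eta>. ennreal (removal_rate (\<eta> ! i) (take i \<eta>)) * f (take i \<eta> @ drop (Suc i) \<eta>))) =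
    list_integral C (Suc n) (\<lambda>\<eta>. \<Sum>i\<le>n. G i \<eta>)"
    by (intro list_integral_cong) (simp add: G_def sum_distrib_left lessThan_Suc_atMost)
  also have "\<dots> = (\<Sum>i\<le>n. list_integral C (Suc n) (G i))"
    by (rule list_integral_sum) (rule G)
  also have "\<dots> = (\<Sum>i\<le>n. list_integral C n (\<lambda>\<gamma>. \<integral>\<^sup>+ y. G i (take i \<gamma> @ y # drop i \<gamma>) \<partial>C))"
    by (intro sum.cong refl list_integral_insert[OF sigma_finite_C]) (auto simp: G)
  also have "\<dots> = list_integral C n (\<lambda>\<gamma>. \<Sum>i\<le>n. \<integral>\<^sup>+ y. G i (take i \<gamma> @ y # drop i \<gamma>) \<partial>C)"
    by (rule list_integral_sum[symmetric]) measurable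
  also have "\<dots> = list_integral C n (\<lambda>\<gamma>. ennreal (vwt \<gamma>) * ennreal (2 * L - measure C (N \<gamma>)) * f \<gamma>)"
  proof (rule list_integral_cong)
    fix \<gamma> assume "\<gamma> \<in> lists (space C)" and n: "length \<gamma> = n"
    then have \<gamma>: "\<gamma> \<in> space S" and [measurable]: "\<gamma> \<in> space (list_measure C)"
      by (simp_all only: space_S space_list_measure)
    have [measurable]: "(\<lambda>x. indicator (- N \<gamma>) x :: ennreal) \<in> borel_measurable C"
      unfolding indicator_compl by measurable
    have "(\<Sum>i\<le>n. \<integral>\<^sup>+ y. G i (take i \<gamma> @ y # drop i \<gamma>) \<partial>C) = (\<integral>\<^sup>+ y. (\<Sum>i\<le>n. G i (take i \<gamma> @ y # drop i \<gamma>)) \<partial>C)"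
      by (rule nn_integral_sum[symmetric]) measurable
    also have "\<dots> = (\<integral>\<^sup>+ y. ennreal (vwt \<gamma>) * f \<gamma> * indicator (- N \<gamma>) y \<partial>C)"
    proof (rule nn_integral_cong)
      fix y assume y: "y \<in> space C"
      have "G i (take i \<gamma> @ y # drop i \<gamma>) =
        ennreal (of_bool (valid D \<gamma> \<and> y \<notin> N \<gamma>) * (wt (take i \<gamma> @ y # drop i \<gamma>) * removal_rate y (take i \<gamma>))) * f \<gamma>" if "i \<le> n" for i
        using that n valid_insert[OF \<gamma> y set_insert_at, of i] less_imp_le[OF removal_rate_pos]
        by (simp add: G_def vwt_def nth_append ennreal_mult wt_nonneg mult_ac)
      then have "(\<Sum>i\<le>n. G i (take i \<gamma> @ y # drop i \<gamma>)) =
        (\<Sum>i\<le>n. ennreal (of_bool (valid D \<gamma> \<and> y \<notin> N \<gamma>) * (wt (take i \<gamma> @ y # drop i \<gamma>) * removal_rate y (take i \<gamma>))) * f \<gamma>)"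
        by (intro sum.cong) auto
      also have "\<dots> = ennreal (\<Sum>i\<le>n. of_bool (valid D \<gamma> \<and> y \<notin> N \<gamma>) * (wt (take i \<gamma> @ y # drop i \<gamma>) * removal_rate y (take i \<gamma>))) * f \<gamma>"
        by (simp add: sum_distrib_right[symmetric] wt_nonneg less_imp_le[OF removal_rate_pos])
      also have "(\<Sum>i\<le>n. of_bool (valid D \<gamma> \<and> y \<notin> N \<gamma>) * (wt (take i \<gamma> @ y # drop i \<gamma>) * removal_rate y (take i \<gamma>))) =
        of_bool (valid D \<gamma> \<and> y \<notin> N \<gamma>) * wt \<gamma>"
        using sum_wt_insert[of \<gamma> y] n by (simp add: sum_distrib_left[symmetric])
      finally show "(\<Sum>i\<le>n. G i (take i \<gamma> @ y # drop i \<gamma>)) = ennreal (vwt \<gamma>) * f \<gamma> * indicator (- N \<gamma>) y"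
        by (simp add: vwt_def indicator_def)
    qed
    also have "\<dots> = ennreal (vwt \<gamma>) * f \<gamma> * (\<integral>\<^sup>+ y. indicator (- N \<gamma>) y \<partial>C)"
      by (rule nn_integral_cmult) measurable
    finally show "(\<Sum>i\<le>n. \<integral>\<^sup>+ y. G i (take i \<gamma> @ y # drop i \<gamma>) \<partial>C) =
        ennreal (vwt \<gamma>) * ennreal (2 * L - measure C (N \<gamma>)) * f \<gamma>"
      unfolding compl_Nbr_integral by (simp only: mult_ac)
  qed
  finally show ?thesis .
qed

text \<open>The total removal rate of \<gamma> is precisely the last denominator in its weight.
  Cancelling it leaves the weight of the list without its last element, together with the condition
  that this element could be appended.\<close>

lemma list_integral_arrivals:
  assumes f: "f \<in> borel_measurable S"
  shows "list_integral C n (\<lambda>\<eta>. ennreal (vwt \<eta>) * (\<integral>\<^sup>+ x. indicator (- N \<eta>) x * f (\<eta> @ [x]) \<partial>C)) =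
    list_integral C (Suc n) (\<lambda>\<gamma>. ennreal (vwt \<gamma>) * ennreal (measure C (N \<gamma>) + real (length \<gamma>) * mu) * f \<gamma>)"
proof -
  have f' [measurable]: "f \<in> borel_measurable (list_measure C)" using f by (simp add: fifm_states_def)
  note [measurable] = measurable_measure_Nbr[unfolded fifm_states_def]
  show ?thesis
  proof (subst list_integral_Suc[OF sigma_finite_C], measurable, rule list_integral_cong)
    fix \<eta> assume "\<eta> \<in> lists (space C)"
    then have \<eta>: "\<eta> \<in> space S" by (simp only: space_S)
    have [measurable]: "(\<lambda>x. indicator (- N \<eta>) x :: ennreal) \<in> borel_measurable C"
      unfolding indicator_compl by measurable
    note [measurable] = measurable_snoc_fixed[OF \<eta> f]
    have "ennreal (vwt \<eta>) * (\<integral>\<^sup>+ x. indicator (- N \<eta>) x * f (\<eta> @ [x]) \<partial>C) =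
        (\<integral>\<^sup>+ x. ennreal (vwt \<eta>) * (indicator (- N \<eta>) x * f (\<eta> @ [x])) \<partial>C)"
      by (rule nn_integral_cmult[symmetric]) measurable
    also have "\<dots> = (\<integral>\<^sup>+ x. ennreal (vwt (\<eta> @ [x])) * ennreal (measure C (N (\<eta> @ [x])) + real (length (\<eta> @ [x])) * mu) * f (\<eta> @ [x]) \<partial>C)"
    proof (rule nn_integral_cong)
      fix x assume x: "x \<in> space C"
      have pos: "measure C (N (\<eta> @ [x])) + (real (length \<eta>) + 1) * mu > 0"
        using mu_pos by (simp add: add_nonneg_pos)
      have len: "real (length (\<eta> @ [x])) = real (length \<eta>) + 1" by simp
      have "ennreal (vwt (\<eta> @ [x])) * ennreal (measure C (N (\<eta> @ [x])) + real (length (\<eta> @ [x])) * mu) =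
          ennreal (vwt (\<eta> @ [x]) * (measure C (N (\<eta> @ [x])) + (real (length \<eta>) + 1) * mu))"
        unfolding len by (rule ennreal_mult[symmetric]) (use pos in simp_all)
      also have "vwt (\<eta> @ [x]) * (measure C (N (\<eta> @ [x])) + (real (length \<eta>) + 1) * mu) = of_bool (x \<notin> N \<eta>) * vwt \<eta>"
        unfolding vwt_snoc[OF \<eta> x] using pos by (simp del: set_append)
      finally have *: "ennreal (vwt (\<eta> @ [x])) * ennreal (measure C (N (\<eta> @ [x])) + real (length (\<eta> @ [x])) * mu) = ennreal (of_bool (x \<notin> N \<eta>) * vwt \<eta>)" .
      show "ennreal (vwt \<eta>) * (indicator (- N \<eta>) x * f (\<eta> @ [x])) =
          ennreal (vwt (\<eta> @ [x])) * ennreal (measure C (N (\<eta> @ [x])) + real (length (\<eta> @ [x])) * mu) * f (\<eta> @ [x])"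
        unfolding * by (simp add: indicator_def)
    qed
    finally show "ennreal (vwt \<eta>) * (\<integral>\<^sup>+ x. indicator (- N \<eta>) x * f (\<eta> @ [x]) \<partial>C) = \<dots>" .
  qed
qed

section \<open>Global balance, total weight and mean exit rate\<close>

abbreviation "Z k \<equiv> list_integral C k (\<lambda>\<gamma>. ennreal (vwt \<gamma>))"

lemma vwt_Nil: "vwt [] = 1"
  by (simp add: vwt_def wt_def valid_def)

lemma Nbr_empty: "Nbr D {} = {}"
  by (simp add: Nbr_def)

lemma measurable_Q_integral:
  assumes "f \<in> borel_measurable S"
  shows "(\<lambda>\<eta>. \<integral>\<^sup>+ \<gamma>. f \<gamma> \<partial>R \<eta>) \<in> borel_measurable S"
proof (rule measurable_nn_integral_Q)
  show "(\<lambda>(\<eta>, \<gamma>). f \<gamma>) \<in> borel_measurable (S \<Otimes>\<^sub>M S)"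
    using measurable_compose[OF measurable_snd assms] by (simp add: case_prod_beta')
qed simp

lemma nn_integral_S: "f \<in> borel_measurable S \<Longrightarrow> (\<integral>\<^sup>+ \<eta>. f \<eta> \<partial>S) = (\<Sum>n. list_integral C n f)"
  unfolding fifm_states_def by (rule nn_integral_list_measure)

text \<open>The two partial balance relations are added: the rates
  \<open>2 * L - measure C (N \<eta>)\<close> and
  \<open>measure C (N \<eta>) + real (length \<eta>) * mu\<close> sum to the exit rate.\<close>

lemma vwt_balance:
  assumes f: "f \<in> borel_measurable S"
  shows "(\<integral>\<^sup>+ \<eta>. ennreal (vwt \<eta>) * (\<integral>\<^sup>+ \<gamma>. f \<gamma> \<partial>R \<eta>) \<partial>S) =
    (\<integral>\<^sup>+ \<eta>. ennreal (vwt \<eta>) * (ennreal (q \<eta>) * f \<eta>) \<partial>S)"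
proof -
  note [measurable] = f measurable_Q_integral[OF f]
  have f' [measurable]: "f \<in> borel_measurable (list_measure C)" using f by (simp add: fifm_states_def)
  note [measurable] = measurable_measure_Nbr[unfolded fifm_states_def]
  let ?del = "\<lambda>\<eta>. \<Sum>i<length \<eta>. ennreal (removal_rate (\<eta> ! i) (take i \<eta>)) * f (take i \<eta> @ drop (Suc i) \<eta>)"
  let ?app = "\<lambda>\<eta>. \<integral>\<^sup>+ x. indicator (- N \<eta>) x * f (\<eta> @ [x]) \<partial>C"
  let ?A = "\<lambda>\<gamma>. ennreal (vwt \<gamma>) * ennreal (2 * L - measure C (N \<gamma>)) * f \<gamma>"
  let ?B = "\<lambda>\<gamma>. ennreal (vwt \<gamma>) * ennreal (measure C (N \<gamma>) + real (length \<gamma>) * mu) * f \<gamma>"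
  note [measurable] = measurable_arrivals[OF f] measurable_departures[OF f]
  have split: "list_integral C n (\<lambda>\<eta>. ennreal (vwt \<eta>) * (\<integral>\<^sup>+ \<gamma>. f \<gamma> \<partial>R \<eta>)) =
    list_integral C n (\<lambda>\<eta>. ennreal (vwt \<eta>) * ?del \<eta>) + list_integral C n (\<lambda>\<eta>. ennreal (vwt \<eta>) * ?app \<eta>)" for n
  proof -
    have 1: "list_integral C n (\<lambda>\<eta>. ennreal (vwt \<eta>) * (\<integral>\<^sup>+ \<gamma>. f \<gamma> \<partial>R \<eta>)) =
      list_integral C n (\<lambda>\<eta>. ennreal (vwt \<eta>) * ?del \<eta> + ennreal (vwt \<eta>) * ?app \<eta>)"
      by (rule list_integral_cong) (simp only: nn_integral_R[OF f] space_S distrib_left)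
    show ?thesis
      unfolding 1 by (rule list_integral_add) measurable
  qed
  have "(\<integral>\<^sup>+ \<eta>. ennreal (vwt \<eta>) * (\<integral>\<^sup>+ \<gamma>. f \<gamma> \<partial>R \<eta>) \<partial>S) =
    (\<Sum>n. list_integral C n (\<lambda>\<eta>. ennreal (vwt \<eta>) * (\<integral>\<^sup>+ \<gamma>. f \<gamma> \<partial>R \<eta>)))"
    by (rule nn_integral_S) measurable
  also have "\<dots> = (\<Sum>n. list_integral C n (\<lambda>\<eta>. ennreal (vwt \<eta>) * ?del \<eta>)) + (\<Sum>n. list_integral C n (\<lambda>\<eta>. ennreal (vwt \<eta>) * ?app \<eta>))"
    unfolding split by (rule suminf_add[symmetric]) auto
  \<comment> \<open>Removals shorten the list by one, so the sums match after a shift; the term at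
    length 0 drops out since the empty list has nothing to remove. For the arrivals, shifted the
    other way, it drops out since the factor in \<open>?B\<close> is 0 at the empty list.\<close>
  also have "(\<Sum>n. list_integral C n (\<lambda>\<eta>. ennreal (vwt \<eta>) * ?del \<eta>)) = (\<Sum>n. list_integral C n ?A)"
    by (subst suminf_Suc_ennreal) (simp add: list_integral_departures[OF f] list_integral_0)
  also have "(\<Sum>n. list_integral C n (\<lambda>\<eta>. ennreal (vwt \<eta>) * ?app \<eta>)) = (\<Sum>n. list_integral C n ?B)"
    by (subst (2) suminf_Suc_ennreal) (simp add: list_integral_arrivals[OF f] list_integral_0 Nbr_empty)
  also have "(\<Sum>n. list_integral C n ?A) + (\<Sum>n. list_integral C n ?B) = (\<Sum>n. list_integral C n ?A + list_integral C n ?B)"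
    by (rule suminf_add) auto
  also have "\<dots> = (\<Sum>n. list_integral C n (\<lambda>\<eta>. ennreal (vwt \<eta>) * (ennreal (q \<eta>) * f \<eta>)))"
  proof (intro suminf_cong)
    fix n
    have "list_integral C n ?A + list_integral C n ?B = list_integral C n (\<lambda>\<gamma>. ?A \<gamma> + ?B \<gamma>)"
      by (rule list_integral_add[symmetric]) measurable
    also have "\<dots> = list_integral C n (\<lambda>\<eta>. ennreal (vwt \<eta>) * (ennreal (q \<eta>) * f \<eta>))"
    proof (rule list_integral_cong)
      fix \<gamma> assume "\<gamma> \<in> lists (space C)"
      then have "q \<gamma> = 2 * L + real (length \<gamma>) * mu" by (simp only: exit_rate_R space_S)
      then have "ennreal (q \<gamma>) = ennreal (2 * L - measure C (N \<gamma>)) + ennreal (measure C (N \<gamma>) + real (length \<gamma>) * mu)"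
        using measure_Nbr_le[of \<gamma>] mu_pos by (subst ennreal_plus[symmetric]) simp_all
      then show "?A \<gamma> + ?B \<gamma> = ennreal (vwt \<gamma>) * (ennreal (q \<gamma>) * f \<gamma>)"
        by (simp only: distrib_left distrib_right mult_ac)
    qed
    finally show "list_integral C n ?A + list_integral C n ?B = list_integral C n (\<lambda>\<eta>. ennreal (vwt \<eta>) * (ennreal (q \<eta>) * f \<eta>))" .
  qed
  also have "\<dots> = (\<integral>\<^sup>+ \<eta>. ennreal (vwt \<eta>) * (ennreal (q \<eta>) * f \<eta>) \<partial>S)"
    by (rule nn_integral_S[symmetric]) measurable
  finally show ?thesis .
qed

text \<open>The arrival relation with test function 1 equates total flows between lengths
  \<open>n\<close> and \<open>n + 1\<close>. Dropping \<open>measure C (N \<gamma>)\<close> on both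
  sides keeps only the rates \<open>real (Suc n) * mu\<close> down and \<open>2 * L\<close>
  up.\<close>

lemma Z_Suc_le: "ennreal (real (Suc n) * mu) * Z (Suc n) \<le> ennreal (2 * L) * Z n"
proof -
  note [measurable] = measurable_measure_Nbr[unfolded fifm_states_def]
  have "ennreal (real (Suc n) * mu) * Z (Suc n) = list_integral C (Suc n) (\<lambda>\<gamma>. ennreal (real (Suc n) * mu) * ennreal (vwt \<gamma>))"
    by (rule list_integral_cmult[symmetric]) measurable
  also have "\<dots> \<le> list_integral C (Suc n) (\<lambda>\<gamma>. ennreal (vwt \<gamma>) * ennreal (measure C (N \<gamma>) + real (length \<gamma>) * mu) * 1)"
    using mu_pos by (intro list_integral_mono) (auto simp: mult.commute intro!: mult_left_mono ennreal_leI)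
  also have "\<dots> = list_integral C n (\<lambda>\<eta>. ennreal (vwt \<eta>) * (\<integral>\<^sup>+ x. indicator (- N \<eta>) x * 1 \<partial>C))"
    by (rule list_integral_arrivals[symmetric]) simp
  also have "\<dots> \<le> list_integral C n (\<lambda>\<eta>. ennreal (2 * L) * ennreal (vwt \<eta>))"
    unfolding mult_1_right compl_Nbr_integral
    by (intro list_integral_mono) (auto simp: mult.commute intro!: mult_left_mono ennreal_leI)
  also have "\<dots> = ennreal (2 * L) * Z n"
    by (rule list_integral_cmult) measurable
  finally show ?thesis .
qed

lemma Z_0: "Z 0 = 1"
  by (simp add: list_integral_0 vwt_Nil)

text \<open>The bound is the unnormalized Poisson law with parameter \<open>2 * L / mu\<close>,
  which is stationary for arrivals at rate \<open>2 * L\<close> and individual departures at rate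
  \<open>mu\<close> without matching.\<close>

lemma Z_le: "Z n \<le> ennreal ((2 * L / mu) ^ n / fact n)"
proof (induction n)
  case 0
  show ?case by (simp add: Z_0)
next
  case (Suc n)
  let ?c = "real (Suc n) * mu"
  have c: "?c > 0" using mu_pos by simp
  have "Z (Suc n) = ennreal (1 / ?c) * (ennreal ?c * Z (Suc n))"
  proof -
    have "ennreal (1 / ?c) * ennreal ?c = ennreal (1 / ?c * ?c)"
      using c by (intro ennreal_mult[symmetric]) simp_all
    also have "\<dots> = 1" using mu_pos by simp
    finally show ?thesis by (simp only: mult.assoc[symmetric] mult_1_left)
  qed
  also have "\<dots> \<le> ennreal (1 / ?c) * (ennreal (2 * L) * ennreal ((2 * L / mu) ^ n / fact n))"
    by (intro mult_left_mono order_trans[OF Z_Suc_le] Suc.IH) auto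
  also have "\<dots> = ennreal (1 / ?c * (2 * L * ((2 * L / mu) ^ n / fact n)))"
  proof -
    have "0 \<le> 1 / ?c" "0 \<le> 2 * L" "0 \<le> (2 * L / mu) ^ n / fact n" using c mu_pos by simp_all
    then show ?thesis by (simp only: ennreal_mult mult_nonneg_nonneg)
  qed
  also have "1 / ?c * (2 * L * ((2 * L / mu) ^ n / fact n)) = (2 * L / mu) ^ Suc n / fact (Suc n)"
    using mu_pos by (simp add: field_simps)
  finally show ?case .
qed

lemma suminf_Z_finite: "(\<Sum>n. Z n) < \<infinity>"
proof -
  have s: "summable (\<lambda>n. (2 * L / mu) ^ n / fact n)"
    using summable_exp[of "2 * L / mu"] by (simp add: field_simps)
  have "(\<Sum>n. Z n) \<le> (\<Sum>n. ennreal ((2 * L / mu) ^ n / fact n))"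
    by (intro suminf_le Z_le) auto
  also have "\<dots> = ennreal (\<Sum>n. (2 * L / mu) ^ n / fact n)"
    using s mu_pos by (intro suminf_ennreal2) auto
  finally show ?thesis by (simp add: order_le_less_trans)
qed

lemma suminf_Z_ge: "1 \<le> (\<Sum>n. Z n)"
  by (subst suminf_Suc_ennreal) (simp add: Z_0)

text \<open>The part of the exit rate that grows with the length is controlled by
  \<open>Z_Suc_le\<close>: shifted by one, its terms are at most \<open>2 * L\<close> times the
  total weight.\<close>

lemma vwt_exit_rate_finite: "(\<integral>\<^sup>+ \<eta>. ennreal (vwt \<eta>) * ennreal (q \<eta>) \<partial>S) < \<infinity>"
proof -
  have "(\<integral>\<^sup>+ \<eta>. ennreal (vwt \<eta>) * ennreal (q \<eta>) \<partial>S) = (\<Sum>n. list_integral C n (\<lambda>\<eta>. ennreal (vwt \<eta>) * ennreal (q \<eta>)))"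
    by (rule nn_integral_S) measurable
  also have "\<dots> = (\<Sum>n. ennreal (2 * L) * Z n + ennreal (real n * mu) * Z n)"
  proof (intro suminf_cong)
    fix n
    have "list_integral C n (\<lambda>\<eta>. ennreal (vwt \<eta>) * ennreal (q \<eta>)) = list_integral C n (\<lambda>\<eta>. (ennreal (2 * L) + ennreal (real n * mu)) * ennreal (vwt \<eta>))"
    proof (rule list_integral_cong)
      fix \<eta> assume "\<eta> \<in> lists (space C)" "length \<eta> = n"
      then have "q \<eta> = 2 * L + real n * mu" by (simp only: exit_rate_R space_S)
      then show "ennreal (vwt \<eta>) * ennreal (q \<eta>) = (ennreal (2 * L) + ennreal (real n * mu)) * ennreal (vwt \<eta>)"
        using mu_pos by (simp add: mult.commute)
    qed
    also have "\<dots> = (ennreal (2 * L) + ennreal (real n * mu)) * Z n"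
      by (rule list_integral_cmult) measurable
    finally show "list_integral C n (\<lambda>\<eta>. ennreal (vwt \<eta>) * ennreal (q \<eta>)) = ennreal (2 * L) * Z n + ennreal (real n * mu) * Z n"
      by (simp only: distrib_right)
  qed
  also have "\<dots> = (\<Sum>n. ennreal (2 * L) * Z n) + (\<Sum>n. ennreal (real n * mu) * Z n)"
    by (rule suminf_add[symmetric]) auto
  also have "(\<Sum>n. ennreal (real n * mu) * Z n) = (\<Sum>n. ennreal (real (Suc n) * mu) * Z (Suc n))"
    by (subst suminf_Suc_ennreal) simp
  also have "\<dots> \<le> (\<Sum>n. ennreal (2 * L) * Z n)"
    by (intro suminf_le Z_Suc_le) auto
  also have "(\<Sum>n. ennreal (2 * L) * Z n) = ennreal (2 * L) * (\<Sum>n. Z n)"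
    by simp
  finally have "(\<integral>\<^sup>+ \<eta>. ennreal (vwt \<eta>) * ennreal (q \<eta>) \<partial>S) \<le> ennreal (2 * L) * (\<Sum>n. Z n) + ennreal (2 * L) * (\<Sum>n. Z n)"
    by (simp add: add_left_mono)
  also have "\<dots> < \<infinity>" using suminf_Z_finite by (simp add: ennreal_mult_less_top)
  finally show ?thesis .
qed

section \<open>The empty list is reached from every state, and uniqueness follows\<close>

lemma sets_singleton_Nil: "{[]} \<in> sets S"
proof -
  have "{\<eta> \<in> lists (space C). length \<eta> = 0} = {[]}" by auto
  then show ?thesis using sets_list_measure_length[of C 0] by (simp only: fifm_states_def)
qed

text \<open>Removing the first element again and again empties the list in
  \<open>length \<eta>\<close> jumps, and each of these removals has positive rate.\<close>

lemma jump_to_Nil_pos: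
  assumes "0 < t" "\<eta> \<in> space S"
  shows "0 < J (length \<eta>) (indicator {[]}) t \<eta>"
  using assms
proof (induction "length \<eta>" arbitrary: t \<eta>)
  case 0
  then show ?case by simp
next
  case (Suc n)
  let ?I = "indicator {[]} :: _ \<Rightarrow> ennreal"
  have I: "?I \<in> borel_measurable S" using sets_singleton_Nil by simp
  define h where "h s = ennreal (exp (- q \<eta> * s)) * (\<integral>\<^sup>+ y. J n ?I (t - s) y \<partial>R \<eta>) * indicator {0..t} s" for s
  have J: "J (length \<eta>) ?I t \<eta> = (\<integral>\<^sup>+ s. h s \<partial>lborel)"
    by (simp add: Suc(2)[symmetric] h_def)
  have [measurable]: "(\<lambda>s. \<integral>\<^sup>+ y. J n ?I (t - s) y \<partial>R \<eta>) \<in> borel_measurable borel"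
    by (rule measurable_J_Q[OF I _ Suc.prems(2)]) simp
  have h: "h \<in> borel_measurable lborel" unfolding h_def by measurable
  \<comment> \<open>For \<open>s\<close> strictly between 0 and \<open>t\<close> some time remains
    after the first jump, as the induction hypothesis demands. These \<open>s\<close> form a set of
    positive Lebesgue measure.\<close>
  have pos: "h s \<noteq> 0" if s: "s \<in> {0<..<t}" for s
  proof -
    let ?\<eta> = "take 0 \<eta> @ drop (Suc 0) \<eta>"
    have len: "length ?\<eta> = n" using Suc(2) by simp
    have "0 < J n ?I (t - s) ?\<eta>"
      using Suc(1)[of ?\<eta> "t - s"] delete_in_space[OF Suc.prems(2), of 0] s by (simp only: len) simp
    moreover have "J n ?I (t - s) \<in> borel_measurable S"
      using measurable_J[OF I, of "\<lambda>_. t - s" S "\<lambda>x. x"] by simp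
    then have "(\<integral>\<^sup>+ y. J n ?I (t - s) y \<partial>R \<eta>) \<ge>
      (\<Sum>i<length \<eta>. ennreal (removal_rate (\<eta> ! i) (take i \<eta>)) * J n ?I (t - s) (take i \<eta> @ drop (Suc i) \<eta>))"
      by (simp only: nn_integral_R[OF _ Suc.prems(2)]) simp
    moreover have "(\<Sum>i<length \<eta>. ennreal (removal_rate (\<eta> ! i) (take i \<eta>)) * J n ?I (t - s) (take i \<eta> @ drop (Suc i) \<eta>))
        \<ge> ennreal (removal_rate (\<eta> ! 0) (take 0 \<eta>)) * J n ?I (t - s) ?\<eta>"
      using Suc(2) by (intro member_le_sum) auto
    moreover have "0 < ennreal (removal_rate (\<eta> ! 0) (take 0 \<eta>)) * J n ?I (t - s) ?\<eta>"
      using \<open>0 < J n ?I (t - s) ?\<eta>\<close> removal_rate_pos by (simp only: ennreal_zero_less_mult_iff ennreal_less_zero_iff simp_thms)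
    ultimately have "0 < (\<integral>\<^sup>+ y. J n ?I (t - s) y \<partial>R \<eta>)" by order
    then show ?thesis using s by (simp add: h_def less_imp_le)
  qed
  have "(\<integral>\<^sup>+ s. h s \<partial>lborel) \<noteq> 0"
  proof
    assume "(\<integral>\<^sup>+ s. h s \<partial>lborel) = 0"
    then have "emeasure lborel {s \<in> space lborel. h s \<noteq> 0} = 0"
      using nn_integral_0_iff[OF h] by simp
    moreover have "emeasure lborel {0<..<t} \<le> emeasure lborel {s \<in> space lborel. h s \<noteq> 0}"
      using h pos by (intro emeasure_mono) auto
    ultimately show False using Suc.prems(1) by simp
  qed
  then show ?case unfolding J by (simp add: zero_less_iff_neq_zero)
qed

lemma transition_to_Nil_pos:
  assumes "\<eta> \<in> space S"
  shows "0 < transition_prob R 1 \<eta> {[]}"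
proof -
  have "0 < J (length \<eta>) (indicator {[]}) 1 \<eta>" by (rule jump_to_Nil_pos[OF _ assms]) simp
  also have "\<dots> \<le> transition_prob R 1 \<eta> {[]}"
    unfolding transition_prob_eq using sum_le_suminf[of "\<lambda>n. J n (indicator {[]}) 1 \<eta>" "{length \<eta>}"] by simp
  finally show ?thesis .
qed

text \<open>Since \<open>1 / K\<close> is the total weight, integrals against the candidate are
  \<open>K\<close> times weighted integrals over the lists, which reduces the conditions for
  stationarity to the facts on \<open>vwt\<close>. Uniqueness takes the empty list as the state
  \<open>e\<close>.\<close>

theorem stationary_distribution_iff:
  assumes K: "K > 0" "ennreal (1 / K) = (\<Sum>n. Z n)"
  shows "stationary_distribution S R \<nu> \<longleftrightarrow> \<nu> = density S (\<lambda>\<gamma>. ennreal (fifm_density D lam mu K \<gamma>))"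
proof -
  define \<pi> where "\<pi> = density S (\<lambda>\<gamma>. ennreal (fifm_density D lam mu K \<gamma>))"
  have dens: "ennreal (fifm_density D lam mu K \<gamma>) = ennreal K * ennreal (vwt \<gamma>)" for \<gamma>
    using K(1) by (simp add: fifm_density_eq ennreal_mult)
  have int: "(\<integral>\<^sup>+ \<gamma>. f \<gamma> \<partial>\<pi>) = ennreal K * (\<integral>\<^sup>+ \<gamma>. ennreal (vwt \<gamma>) * f \<gamma> \<partial>S)" if [measurable]: "f \<in> borel_measurable S" for f
    unfolding \<pi>_def dens by (subst nn_integral_density) (auto simp: mult.assoc nn_integral_cmult)
  have "prob_space \<pi>"
  proof (rule prob_spaceI)
    have "emeasure \<pi> (space \<pi>) = (\<integral>\<^sup>+ \<gamma>. 1 \<partial>\<pi>)" by simp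
    also have "\<dots> = ennreal K * (\<integral>\<^sup>+ \<gamma>. ennreal (vwt \<gamma>) * 1 \<partial>S)" by (rule int) simp
    also have "(\<integral>\<^sup>+ \<gamma>. ennreal (vwt \<gamma>) * 1 \<partial>S) = ennreal (1 / K)"
      unfolding K(2) mult_1_right by (rule nn_integral_S) measurable
    also have "ennreal K * ennreal (1 / K) = 1" using K(1) by (simp add: ennreal_mult[symmetric])
    finally show "emeasure \<pi> (space \<pi>) = 1" .
  qed
  then interpret pi: prob_space \<pi> .
  interpret balanced_jump_kernel S R \<pi>
  proof unfold_locales
    show "sets \<pi> = sets S" by (simp add: \<pi>_def)
    show "(\<integral>\<^sup>+ x. \<integral>\<^sup>+ y. f y \<partial>R x \<partial>\<pi>) = (\<integral>\<^sup>+ x. ennreal (q x) * f x \<partial>\<pi>)" if f [measurable]: "f \<in> borel_measurable S" for f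
      by (simp add: int measurable_Q_integral vwt_balance)
    show "(\<integral>\<^sup>+ x. ennreal (q x) \<partial>\<pi>) < \<infinity>"
      using vwt_exit_rate_finite by (simp add: int ennreal_mult_less_top)
  qed
  show ?thesis
    unfolding \<pi>_def[symmetric]
    using stationary stationary_unique[OF _ stationary sets_singleton_Nil transition_to_Nil_pos] by blast
qed

end

section \<open>The normalizing constant\<close>

lemma suminf_shift_ennreal:
  fixes a :: "nat \<Rightarrow> ennreal"
  shows "(\<Sum>n. if j < n then a (n - 1 - j) else 0) = (\<Sum>m. a m)"
proof (induction j)
  case 0
  show ?case by (subst suminf_Suc_ennreal) simp
next
  case (Suc j)
  have "(\<Sum>n. if Suc j < n then a (n - 1 - Suc j) else 0) = (\<Sum>n. if Suc j < Suc n then a (Suc n - 1 - Suc j) else 0)"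
    by (subst suminf_Suc_ennreal) simp
  also have "\<dots> = (\<Sum>n. if j < n then a (n - 1 - j) else 0)" by (intro suminf_cong) simp
  finally show ?case using Suc by simp
qed

text \<open>The reindexing \<open>n = j + 1 + m\<close> counts \<open>j\<close> elements before the
  last unmatched one, that element itself, and \<open>m\<close> matched elements behind it.\<close>

lemma suminf_convolution_ennreal:
  fixes a :: "nat \<Rightarrow> nat \<Rightarrow> ennreal"
  shows "(\<Sum>n. \<Sum>j<n. a j (n - 1 - j)) = (\<Sum>j. \<Sum>m. a j m)"
proof -
  have "(\<Sum>j<n. a j (n - 1 - j)) = (\<Sum>j. if j < n then a j (n - 1 - j) else 0)" for n
    by (subst suminf_finite[of "{..<n}"]) auto
  then show ?thesis
    by (simp only: suminf_swap_ennreal[of "\<lambda>n j. if j < n then a j (n - 1 - j) else 0"] suminf_shift_ennreal)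
qed

lemma UNIV_mark: "(UNIV :: mark set) = {Unmatched, Matched}"
  using mark.exhaust by auto

lemma finite_UNIV_mark: "finite (UNIV :: mark set)"
  by (simp add: UNIV_mark)

definition unmatched :: "'a marked list \<Rightarrow> ('a \<times> color) list" where
  "unmatched \<gamma> = map (\<lambda>x. (pos x, col x)) (filter (\<lambda>x. mrk x = Unmatched) \<gamma>)"

lemma unmatched_Nil [simp]: "unmatched [] = []"
  by (simp add: unmatched_def)

lemma unmatched_snoc: "unmatched (\<gamma> @ [x]) = (if mrk x = Unmatched then unmatched \<gamma> @ [(pos x, col x)] else unmatched \<gamma>)"
  by (simp add: unmatched_def)

lemma num_unmatched_eq: "num_unmatched i \<gamma> = length (unmatched (take i \<gamma>))"
  by (simp add: num_unmatched_def unmatched_def)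

lemma unmatched_nonempty: "detailed_valid \<gamma> \<Longrightarrow> \<gamma> \<noteq> [] \<Longrightarrow> unmatched \<gamma> \<noteq> []"
  by (cases \<gamma>) (auto simp: detailed_valid_def unmatched_def)

text \<open>Conditions (2) and (3) put the same demand on a new last element, whichever mark it
  carries: no earlier unmatched element of the other color may be close to it. A matched element
  never restricts a later one, so only \<open>unmatched \<gamma>\<close> enters.\<close>

lemma detailed_valid_snoc:
  assumes "pos x \<in> D"
  shows "detailed_valid (\<gamma> @ [x]) \<longleftrightarrow>
    detailed_valid \<gamma> \<and> (\<gamma> = [] \<longrightarrow> mrk x = Unmatched) \<and> (pos x, col x) \<notin> Nbr D (set (unmatched \<gamma>))"
proof -
  let ?n = "length \<gamma>"
  have nth: "(\<gamma> @ [x]) ! i = \<gamma> ! i" if "i < ?n" for i using that by (simp add: nth_append)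
  have neq: "c = opposite c' \<longleftrightarrow> c' \<noteq> c" for c c' by (cases c; cases c') auto
  have "(pos x, col x) \<notin> Nbr D (set (unmatched \<gamma>)) \<longleftrightarrow>
      (\<forall>y\<in>set \<gamma>. mrk y = Unmatched \<and> dist (pos y) (pos x) < 1 \<longrightarrow> col y = col x)"
    using assms by (auto simp: Nbr_def nbr_def unmatched_def neq)
  also have "\<dots> \<longleftrightarrow> (\<forall>i<?n. mrk (\<gamma> ! i) = Unmatched \<and> dist (pos (\<gamma> ! i)) (pos x) < 1 \<longrightarrow> col (\<gamma> ! i) = col x)"
    by (simp only: all_set_conv_all_nth)
  finally have N: "(pos x, col x) \<notin> Nbr D (set (unmatched \<gamma>)) \<longleftrightarrow> \<dots>" .
  have 1: "(length (\<gamma> @ [x]) \<ge> 1 \<longrightarrow> mrk ((\<gamma> @ [x]) ! 0) = Unmatched) \<longleftrightarrow>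
      (?n \<ge> 1 \<longrightarrow> mrk (\<gamma> ! 0) = Unmatched) \<and> (\<gamma> = [] \<longrightarrow> mrk x = Unmatched)"
    by (cases \<gamma>) auto
  have all_Suc: "(\<forall>i<Suc n. P i) \<longleftrightarrow> (\<forall>i<n. P i) \<and> P n" for P and n :: nat
    using less_Suc_eq by auto
  have len: "length (\<gamma> @ [x]) = Suc ?n" by simp
  have last: "(\<gamma> @ [x]) ! ?n = x" by simp
  have 2: "(\<forall>i<Suc ?n. \<forall>j<Suc ?n. P ((\<gamma> @ [x]) ! i) ((\<gamma> @ [x]) ! j)) \<longleftrightarrow>
      (\<forall>i<?n. \<forall>j<?n. P (\<gamma> ! i) (\<gamma> ! j)) \<and> (\<forall>i<?n. P (\<gamma> ! i) x) \<and> (\<forall>i<?n. P x (\<gamma> ! i)) \<and> P x x" for P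
    unfolding all_Suc last using nth by auto
  have 3: "(\<forall>j<Suc ?n. \<forall>i<j. P ((\<gamma> @ [x]) ! i) ((\<gamma> @ [x]) ! j)) \<longleftrightarrow>
      (\<forall>j<?n. \<forall>i<j. P (\<gamma> ! i) (\<gamma> ! j)) \<and> (\<forall>i<?n. P (\<gamma> ! i) x)" for P
  proof -
    have "(\<forall>i<j. P ((\<gamma> @ [x]) ! i) ((\<gamma> @ [x]) ! j)) \<longleftrightarrow> (\<forall>i<j. P (\<gamma> ! i) (\<gamma> ! j))" if "j < ?n" for j
      using that nth by auto
    then show ?thesis unfolding all_Suc last using nth by auto
  qed
  have m: "mrk x = Unmatched \<or> mrk x = Matched" by (cases "mrk x") auto
  let ?P2 = "\<lambda>y z. mrk y = Unmatched \<and> mrk z = Unmatched \<and> dist (pos y) (pos z) < 1 \<longrightarrow> col y = col z"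
  let ?P3 = "\<lambda>y z. mrk y = Unmatched \<and> mrk z = Matched \<and> dist (pos y) (pos z) < 1 \<longrightarrow> col y = col z"
  have comb: "(\<forall>i<?n. ?P2 (\<gamma> ! i) x) \<and> (\<forall>i<?n. ?P2 x (\<gamma> ! i)) \<and> ?P2 x x \<and> (\<forall>i<?n. ?P3 (\<gamma> ! i) x) \<longleftrightarrow>
      (\<forall>i<?n. mrk (\<gamma> ! i) = Unmatched \<and> dist (pos (\<gamma> ! i)) (pos x) < 1 \<longrightarrow> col (\<gamma> ! i) = col x)"
    by (cases "mrk x") (auto simp: dist_commute)
  show ?thesis
    unfolding N detailed_valid_def 1 unfolding len 2[of ?P2] 3[of ?P3] comb[symmetric] by (simp only: conj_ac)
qed

section \<open>The weight of detailed lists: recursion at the last element and measurability\<close>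

context fifm
begin

abbreviation "M \<equiv> marked_measure lam"
abbreviation "dw \<equiv> detailed_weight D lam mu"

lemma pos_in_D: "x \<in> space M \<Longrightarrow> pos x \<in> D"
  by (auto simp: marked_measure_def space_pair_measure space_lam pos_def)

lemma dw_Nil: "dw [] = 1"
  by (simp add: detailed_weight_def detailed_valid_def)

lemma dw_nonneg [simp]: "0 \<le> dw \<gamma>"
  unfolding detailed_weight_def using mu_pos by (intro mult_nonneg_nonneg prod_nonneg) auto

lemma dw_snoc:
  assumes "x \<in> space M"
  shows "dw (\<gamma> @ [x]) = dw \<gamma> * of_bool ((\<gamma> = [] \<longrightarrow> mrk x = Unmatched) \<and> (pos x, col x) \<notin> N (unmatched \<gamma>)) *
    (1 / (2 * L + real (length (unmatched (\<gamma> @ [x]))) * mu))"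
proof -
  have "(\<Prod>i=1..length (\<gamma> @ [x]). 1 / (2 * L + real (num_unmatched i (\<gamma> @ [x])) * mu)) =
    (\<Prod>i=1..length \<gamma>. 1 / (2 * L + real (num_unmatched i (\<gamma> @ [x])) * mu)) * (1 / (2 * L + real (length (unmatched (\<gamma> @ [x]))) * mu))"
    by (simp add: num_unmatched_eq)
  also have "(\<Prod>i=1..length \<gamma>. 1 / (2 * L + real (num_unmatched i (\<gamma> @ [x])) * mu)) =
      (\<Prod>i=1..length \<gamma>. 1 / (2 * L + real (num_unmatched i \<gamma>) * mu))"
    by (intro prod.cong) (simp_all add: num_unmatched_eq)
  finally show ?thesis
    unfolding detailed_weight_def detailed_valid_snoc[OF pos_in_D[OF assms]] by simp
qed

lemma measurable_mrk [measurable]: "mrk \<in> measurable M (count_space UNIV)"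
  unfolding marked_measure_def mrk_def[abs_def] by measurable

lemma measurable_pos_col [measurable]: "(\<lambda>x. (pos x, col x)) \<in> measurable M C"
  unfolding marked_measure_def colored_def pos_def col_def by measurable

lemma sigma_finite_color: "sigma_finite_measure (count_space (UNIV :: color set))"
  by (rule sigma_finite_measure_count_space_finite[OF finite_UNIV_color])

lemma nn_integral_marked:
  assumes F: "F \<in> borel_measurable M"
  shows "(\<integral>\<^sup>+ x. F x \<partial>M) = (\<integral>\<^sup>+ z. F (fst z, snd z, Unmatched) \<partial>C) + (\<integral>\<^sup>+ z. F (fst z, snd z, Matched) \<partial>C)"
proof -
  have cm: "(count_space UNIV :: color measure) \<Otimes>\<^sub>M (count_space UNIV :: mark measure) = count_space UNIV"
    using pair_measure_countable[OF countable_finite countable_finite, OF finite_UNIV_color finite_UNIV_mark]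
    by (simp only: UNIV_Times_UNIV)
  have U: "(UNIV :: (color \<times> mark) set) = {(Red, Unmatched), (Red, Matched), (Blue, Unmatched), (Blue, Matched)}"
    unfolding UNIV_Times_UNIV[symmetric] UNIV_color UNIV_mark by auto
  interpret cm: sigma_finite_measure "count_space (UNIV :: (color \<times> mark) set)"
    by (rule sigma_finite_measure_count_space_finite) (simp add: U)
  interpret c: sigma_finite_measure "count_space (UNIV :: color set)" by (rule sigma_finite_color)
  have F' [measurable]: "F \<in> borel_measurable (lam \<Otimes>\<^sub>M count_space UNIV)"
    using F by (simp add: marked_measure_def cm)
  have Fm [measurable]: "(\<lambda>p. F (p, c, m)) \<in> borel_measurable lam" for c m by measurable
  have [measurable]: "(\<lambda>z. (snd z, m)) \<in> measurable (lam \<Otimes>\<^sub>M count_space (UNIV :: color set)) (count_space UNIV)" for m :: mark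
    by (rule measurable_compose[OF measurable_snd]) simp
  have Fc: "(\<lambda>z. F (fst z, snd z, m)) \<in> borel_measurable (lam \<Otimes>\<^sub>M count_space UNIV)" for m by measurable
  have "(\<integral>\<^sup>+ x. F x \<partial>M) = (\<integral>\<^sup>+ p. (\<integral>\<^sup>+ y. F (p, y) \<partial>count_space UNIV) \<partial>lam)"
    unfolding marked_measure_def cm by (rule cm.nn_integral_fst[symmetric]) (rule F')
  also have "\<dots> = (\<integral>\<^sup>+ p. F (p, Red, Unmatched) + F (p, Red, Matched) + F (p, Blue, Unmatched) + F (p, Blue, Matched) \<partial>lam)"
    by (subst nn_integral_count_space_finite) (simp_all add: U add_ac)
  finally have 1: "(\<integral>\<^sup>+ x. F x \<partial>M) = \<dots>" .
  have 2: "(\<integral>\<^sup>+ z. F (fst z, snd z, m) \<partial>C) = (\<integral>\<^sup>+ p. F (p, Red, m) + F (p, Blue, m) \<partial>lam)" for m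
  proof -
    have "(\<integral>\<^sup>+ z. F (fst z, snd z, m) \<partial>C) = (\<integral>\<^sup>+ p. (\<integral>\<^sup>+ c. F (fst (p, c), snd (p, c), m) \<partial>count_space UNIV) \<partial>lam)"
      unfolding colored_def by (rule c.nn_integral_fst[symmetric]) (rule Fc)
    also have "\<dots> = (\<integral>\<^sup>+ p. F (p, Red, m) + F (p, Blue, m) \<partial>lam)"
      by (subst nn_integral_count_space_finite) (simp_all add: UNIV_color)
    finally show ?thesis .
  qed
  show ?thesis
    unfolding 1 2 by (subst nn_integral_add[symmetric]) (auto simp: add_ac intro!: nn_integral_cong)
qed

lemma sigma_finite_M: "sigma_finite_measure M"
proof -
  interpret cm: sigma_finite_measure "count_space (UNIV :: color set) \<Otimes>\<^sub>M count_space (UNIV :: mark set)"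
  proof -
    have "(count_space UNIV :: color measure) \<Otimes>\<^sub>M (count_space UNIV :: mark measure) = count_space (UNIV \<times> UNIV)"
      by (rule pair_measure_countable) (simp_all add: UNIV_color UNIV_mark countable_finite)
    moreover have "finite (UNIV \<times> UNIV :: (color \<times> mark) set)" by (simp add: UNIV_color UNIV_mark del: UNIV_Times_UNIV)
    ultimately show "sigma_finite_measure (count_space (UNIV :: color set) \<Otimes>\<^sub>M count_space (UNIV :: mark set))"
      using sigma_finite_measure_count_space_finite by metis
  qed
  interpret pair_sigma_finite lam "count_space (UNIV :: color set) \<Otimes>\<^sub>M count_space (UNIV :: mark set)" ..
  show ?thesis unfolding marked_measure_def ..
qed

lemma measurable_unmatched_aux:
  "n \<le> m \<Longrightarrow> (\<lambda>f. unmatched (map f [0..<n])) \<in> measurable (\<Pi>\<^sub>M i\<in>{..<m}. M) (list_measure C)"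
proof (induction n)
  case 0
  have "[] \<in> space (list_measure C)" by (simp add: space_list_measure)
  then show ?case by simp
next
  case (Suc n)
  have [measurable]: "(\<lambda>f. unmatched (map f [0..<n])) \<in> measurable (\<Pi>\<^sub>M i\<in>{..<m}. M) (list_measure C)"
    using Suc by simp
  have fn [measurable]: "(\<lambda>f. f n) \<in> measurable (\<Pi>\<^sub>M i\<in>{..<m}. M) M"
    using Suc.prems by (intro measurable_component_singleton) simp
  note [measurable] = measurable_compose[OF fn measurable_pos_col] measurable_compose[OF fn measurable_mrk]
  have "(\<lambda>f. if mrk (f n) = Unmatched then unmatched (map f [0..<n]) @ [(pos (f n), col (f n))] else unmatched (map f [0..<n]))
    \<in> measurable (\<Pi>\<^sub>M i\<in>{..<m}. M) (list_measure C)"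
    by measurable
  then show ?case by (simp add: unmatched_snoc)
qed

lemma measurable_unmatched [measurable]: "unmatched \<in> measurable (list_measure M) (list_measure C)"
  by (rule measurable_list_measureI) (rule measurable_unmatched_aux, simp)

lemma measurable_weight_factor:
  assumes [measurable]: "A \<in> borel_measurable X" "Measurable.pred X P" "Measurable.pred X P'"
    "l \<in> measurable X (count_space (UNIV :: nat set))"
  shows "(\<lambda>f. A f * (if (b \<longrightarrow> P f) \<and> \<not> P' f then 1 else 0) * (1 / (2 * L + real (l f) * mu))) \<in> borel_measurable X"
  by measurable

lemma measurable_dw_aux:
  "n \<le> m \<Longrightarrow> (\<lambda>f. dw (map f [0..<n])) \<in> borel_measurable (\<Pi>\<^sub>M i\<in>{..<m}. M)"
proof (induction n)
  case 0
  show ?case by simp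
next
  case (Suc n)
  have nm: "n \<le> m" "n < m" using Suc.prems by auto
  have u: "(\<lambda>f. unmatched (map f [0..<n])) \<in> measurable (\<Pi>\<^sub>M i\<in>{..<m}. M) S"
    unfolding fifm_states_def by (rule measurable_unmatched_aux[OF nm(1)])
  have fn: "(\<lambda>f. f n) \<in> measurable (\<Pi>\<^sub>M i\<in>{..<m}. M) M"
    using nm(2) by (intro measurable_component_singleton) simp
  have "(\<lambda>f. dw (map f [0..<n]) *
      (if (n = 0 \<longrightarrow> mrk (f n) = Unmatched) \<and> \<not> (pos (f n), col (f n)) \<in> N (unmatched (map f [0..<n])) then 1 else 0) *
      (1 / (2 * L + real (length (unmatched (map f [0..<Suc n]))) * mu))) \<in> borel_measurable (\<Pi>\<^sub>M i\<in>{..<m}. M)"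
  proof (rule measurable_weight_factor)
    show "(\<lambda>f. dw (map f [0..<n])) \<in> borel_measurable (\<Pi>\<^sub>M i\<in>{..<m}. M)"
      by (rule Suc.IH[OF nm(1)])
    show "Measurable.pred (\<Pi>\<^sub>M i\<in>{..<m}. M) (\<lambda>f. mrk (f n) = Unmatched)"
      by (rule measurable_compose[OF measurable_compose[OF fn measurable_mrk]]) simp
    show "Measurable.pred (\<Pi>\<^sub>M i\<in>{..<m}. M) (\<lambda>f. (pos (f n), col (f n)) \<in> N (unmatched (map f [0..<n])))"
      using measurable_compose[OF measurable_Pair[OF u measurable_compose[OF fn measurable_pos_col]] measurable_Nbr]
      by (simp only: fst_conv snd_conv)
    show "(\<lambda>f. length (unmatched (map f [0..<Suc n]))) \<in> measurable (\<Pi>\<^sub>M i\<in>{..<m}. M) (count_space UNIV)"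
      by (rule measurable_compose[OF measurable_unmatched_aux[OF Suc.prems] measurable_length])
  qed
  then show ?case
  proof (rule measurable_cong[THEN iffD1, rotated])
    fix f assume "f \<in> space (\<Pi>\<^sub>M i\<in>{..<m}. M)"
    then have fn: "f n \<in> space M" using nm(2) by (rule space_PiM_lessThan_mem)
    have eq: "map f [0..<Suc n] = map f [0..<n] @ [f n]" "map f [0..<n] = [] \<longleftrightarrow> n = 0" by simp_all
    show "dw (map f [0..<n]) *
      (if (n = 0 \<longrightarrow> mrk (f n) = Unmatched) \<and> \<not> (pos (f n), col (f n)) \<in> N (unmatched (map f [0..<n])) then 1 else 0) *
      (1 / (2 * L + real (length (unmatched (map f [0..<Suc n]))) * mu)) = dw (map f [0..<Suc n])"
      unfolding eq(1) dw_snoc[OF fn] eq(2) of_bool_def ..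
  qed
qed

lemma measurable_dw [measurable]: "dw \<in> borel_measurable (list_measure M)"
  by (rule measurable_list_measureI) (rule measurable_dw_aux, simp)

section \<open>Integrating out the matched elements\<close>

definition arrive :: "(('a \<times> color) list \<Rightarrow> ennreal) \<Rightarrow> ('a \<times> color) list \<Rightarrow> ennreal" where
  "arrive h \<eta> = (\<integral>\<^sup>+ x. indicator (- N \<eta>) x * h (\<eta> @ [x]) \<partial>C)"

text \<open>The reciprocal of the exit rate at \<eta>, which is the factor that the detailed weight
  gains at each element.\<close>

definition scale :: "('a \<times> color) list \<Rightarrow> real" where
  "scale \<eta> = 1 / (2 * L + real (length \<eta>) * mu)"

text \<open>The total weight gained by appending one matched element when the unmatched ones form
  \<eta>; it is the ratio of the geometric series.\<close>

definition stay :: "('a \<times> color) list \<Rightarrow> real" where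
  "stay \<eta> = (2 * L - measure C (N \<eta>)) * scale \<eta>"

abbreviation "detailed n h \<equiv> list_integral M n (\<lambda>\<gamma>. ennreal (dw \<gamma>) * h (unmatched \<gamma>))"

lemma measurable_length_S [measurable]: "length \<in> measurable S (count_space UNIV)"
  unfolding fifm_states_def by (rule measurable_length)

lemma measurable_scale [measurable]: "scale \<in> borel_measurable S"
  unfolding scale_def by measurable

lemma measurable_stay [measurable]: "stay \<in> borel_measurable S"
  unfolding stay_def by measurable

lemma measurable_arrive [measurable]: "h \<in> borel_measurable S \<Longrightarrow> arrive h \<in> borel_measurable S"
  using measurable_arrivals[of h] by (simp add: arrive_def[abs_def] fifm_states_def)

lemma measurable_unmatched_S: "unmatched \<in> measurable (list_measure M) S"
  unfolding fifm_states_def by (rule measurable_unmatched)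

lemma measurable_detailed_integrand:
  assumes "h \<in> borel_measurable S"
  shows "(\<lambda>\<gamma>. ennreal (dw \<gamma>) * h (unmatched \<gamma>)) \<in> borel_measurable (list_measure M)"
proof -
  note [measurable] = measurable_compose[OF measurable_unmatched_S assms]
  show ?thesis by measurable
qed

lemma scale_nonneg [simp]: "0 \<le> scale \<eta>"
  using mu_pos by (simp add: scale_def)

lemma stay_nonneg [simp]: "0 \<le> stay \<eta>"
  using measure_Nbr_le[of \<eta>] by (simp add: stay_def)

lemma unmatched_in_space: "\<gamma> \<in> lists (space M) \<Longrightarrow> unmatched \<gamma> \<in> space S"
  using measurable_space[OF measurable_unmatched_S] by (simp only: space_list_measure)

lemma detailed_add:
  assumes "h \<in> borel_measurable S" "h' \<in> borel_measurable S"
  shows "detailed n (\<lambda>\<eta>. h \<eta> + h' \<eta>) = detailed n h + detailed n h'"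
  unfolding distrib_left by (intro list_integral_add measurable_detailed_integrand assms)

lemma detailed_suminf:
  assumes "\<And>i. h i \<in> borel_measurable S"
  shows "detailed n (\<lambda>\<eta>. \<Sum>i. h i \<eta>) = (\<Sum>i. detailed n (h i))"
proof -
  have "detailed n (\<lambda>\<eta>. \<Sum>i. h i \<eta>) = list_integral M n (\<lambda>\<gamma>. \<Sum>i. ennreal (dw \<gamma>) * h i (unmatched \<gamma>))"
    by (simp add: ennreal_suminf_cmult)
  also have "\<dots> = (\<Sum>i. detailed n (h i))"
    by (intro list_integral_suminf measurable_detailed_integrand assms)
  finally show ?thesis .
qed

lemma detailed_cong:
  "(\<And>\<eta>. \<eta> \<in> space S \<Longrightarrow> h \<eta> = h' \<eta>) \<Longrightarrow> detailed n h = detailed n h'"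
  by (intro list_integral_cong arg_cong2[where f = "(*)"] refl) (simp only: unmatched_in_space)

text \<open>The last element is integrated out according to its mark. An unmatched one extends the
  list of unmatched elements; a matched one leaves that list unchanged, so its position integrates
  to the factor \<open>stay\<close>.\<close>

lemma detailed_Suc:
  assumes h: "h \<in> borel_measurable S"
  shows "detailed (Suc n) h = detailed n (arrive (\<lambda>\<eta>. ennreal (scale \<eta>) * h \<eta>)) +
    detailed n (\<lambda>\<eta>. (if \<eta> = [] then 0 else ennreal (stay \<eta>)) * h \<eta>)"
proof -
  note [measurable] = h
  let ?U = "arrive (\<lambda>\<eta>. ennreal (scale \<eta>) * h \<eta>)" and ?M = "\<lambda>\<eta>. (if \<eta> = [] then 0 else ennreal (stay \<eta>)) * h \<eta>"
  have U: "?U \<in> borel_measurable S" by measurable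
  have "Measurable.pred S (\<lambda>\<eta>. length \<eta> = 0)" by measurable
  then have [measurable]: "Measurable.pred S (\<lambda>\<eta>. \<eta> = [])" by simp
  have Mm: "?M \<in> borel_measurable S" by measurable
  have "detailed (Suc n) h = list_integral M n (\<lambda>\<gamma>. \<integral>\<^sup>+ x. ennreal (dw (\<gamma> @ [x])) * h (unmatched (\<gamma> @ [x])) \<partial>M)"
    by (rule list_integral_Suc[OF sigma_finite_M measurable_detailed_integrand[OF h]])
  also have "\<dots> = list_integral M n (\<lambda>\<gamma>. ennreal (dw \<gamma>) * (?U (unmatched \<gamma>) + ?M (unmatched \<gamma>)))"
  proof (rule list_integral_cong)
    fix \<gamma> assume \<gamma>: "\<gamma> \<in> lists (space M)"
    let ?u = "unmatched \<gamma>"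
    have u: "?u \<in> space S" by (rule unmatched_in_space[OF \<gamma>])
    have [measurable]: "(\<lambda>x. indicator (- N ?u) x :: ennreal) \<in> borel_measurable C"
      unfolding indicator_compl by measurable
    note [measurable] = measurable_snoc_fixed[OF u h] measurable_snoc_fixed[OF u, of "\<lambda>\<eta>. ennreal (scale \<eta>) * h \<eta>"]
    have inM: "(fst z, snd z, m) \<in> space M" if "z \<in> space C" for z m
      using that by (simp add: marked_measure_def space_pair_measure space_C space_lam mem_Times_iff)
    have F: "(\<lambda>x. ennreal (dw (\<gamma> @ [x])) * h (unmatched (\<gamma> @ [x]))) \<in> borel_measurable M"
    proof (rule measurable_compose[OF _ measurable_detailed_integrand[OF h]])
      show "(\<lambda>x. \<gamma> @ [x]) \<in> measurable M (list_measure M)"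
        using \<gamma> by (intro measurable_append_single measurable_ident_sets measurable_const refl) (simp only: space_list_measure)
    qed
    have "(\<integral>\<^sup>+ x. ennreal (dw (\<gamma> @ [x])) * h (unmatched (\<gamma> @ [x])) \<partial>M) =
        (\<integral>\<^sup>+ z. ennreal (dw (\<gamma> @ [(fst z, snd z, Unmatched)])) * h (unmatched (\<gamma> @ [(fst z, snd z, Unmatched)])) \<partial>C) +
        (\<integral>\<^sup>+ z. ennreal (dw (\<gamma> @ [(fst z, snd z, Matched)])) * h (unmatched (\<gamma> @ [(fst z, snd z, Matched)])) \<partial>C)"
      by (rule nn_integral_marked[OF F])
    also have "(\<integral>\<^sup>+ z. ennreal (dw (\<gamma> @ [(fst z, snd z, Unmatched)])) * h (unmatched (\<gamma> @ [(fst z, snd z, Unmatched)])) \<partial>C) =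
        (\<integral>\<^sup>+ z. ennreal (dw \<gamma>) * (indicator (- N ?u) z * (ennreal (scale (?u @ [z])) * h (?u @ [z]))) \<partial>C)"
    proof (rule nn_integral_cong)
      fix z assume z: "z \<in> space C"
      have "dw (\<gamma> @ [(fst z, snd z, Unmatched)]) = dw \<gamma> * of_bool (z \<notin> N ?u) * scale (?u @ [z])"
        using dw_snoc[OF inM[OF z, of Unmatched], of \<gamma>] by (simp add: unmatched_snoc pos_def col_def mrk_def scale_def)
      then show "ennreal (dw (\<gamma> @ [(fst z, snd z, Unmatched)])) * h (unmatched (\<gamma> @ [(fst z, snd z, Unmatched)])) =
          ennreal (dw \<gamma>) * (indicator (- N ?u) z * (ennreal (scale (?u @ [z])) * h (?u @ [z])))"
        by (simp add: unmatched_snoc pos_def col_def mrk_def indicator_def ennreal_mult mult.assoc)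
    qed
    also have "\<dots> = ennreal (dw \<gamma>) * ?U ?u"
      unfolding arrive_def by (rule nn_integral_cmult) measurable
    also have "(\<integral>\<^sup>+ z. ennreal (dw (\<gamma> @ [(fst z, snd z, Matched)])) * h (unmatched (\<gamma> @ [(fst z, snd z, Matched)])) \<partial>C) =
        (\<integral>\<^sup>+ z. ennreal (dw \<gamma> * of_bool (\<gamma> \<noteq> []) * scale ?u) * h ?u * indicator (- N ?u) z \<partial>C)"
    proof (rule nn_integral_cong)
      fix z assume z: "z \<in> space C"
      have "dw (\<gamma> @ [(fst z, snd z, Matched)]) = dw \<gamma> * of_bool (\<gamma> \<noteq> []) * scale ?u * of_bool (z \<notin> N ?u)"
        using dw_snoc[OF inM[OF z, of Matched], of \<gamma>] by (simp add: unmatched_snoc pos_def col_def mrk_def scale_def)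
      then show "ennreal (dw (\<gamma> @ [(fst z, snd z, Matched)])) * h (unmatched (\<gamma> @ [(fst z, snd z, Matched)])) =
          ennreal (dw \<gamma> * of_bool (\<gamma> \<noteq> []) * scale ?u) * h ?u * indicator (- N ?u) z"
        by (simp add: unmatched_snoc mrk_def indicator_def)
    qed
    also have "\<dots> = ennreal (dw \<gamma> * of_bool (\<gamma> \<noteq> []) * scale ?u) * h ?u * ennreal (2 * L - measure C (N ?u))"
      unfolding compl_Nbr_integral[symmetric] by (rule nn_integral_cmult) measurable
    also have "\<dots> = ennreal (dw \<gamma> * of_bool (\<gamma> \<noteq> []) * scale ?u * (2 * L - measure C (N ?u))) * h ?u"
      using measure_Nbr_le[of ?u] by (simp add: ennreal_mult mult_ac)
    \<comment> \<open>The requirement that the first element be unmatched turns into a condition on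
      \<open>unmatched \<gamma>\<close> alone: a nonempty detailed-valid list has an unmatched
      element, and other lists carry weight 0.\<close>
    also have "dw \<gamma> * of_bool (\<gamma> \<noteq> []) * scale ?u * (2 * L - measure C (N ?u)) = dw \<gamma> * (if ?u = [] then 0 else stay ?u)"
    proof (cases "detailed_valid \<gamma>")
      case True
      then have "\<gamma> \<noteq> [] \<longleftrightarrow> ?u \<noteq> []" using unmatched_nonempty by auto
      then show ?thesis by (simp add: stay_def)
    qed (simp add: detailed_weight_def)
    also have "ennreal (dw \<gamma> * (if ?u = [] then 0 else stay ?u)) * h ?u = ennreal (dw \<gamma>) * ?M ?u"
      by (simp add: ennreal_mult mult.assoc)
    finally show "(\<integral>\<^sup>+ x. ennreal (dw (\<gamma> @ [x])) * h (unmatched (\<gamma> @ [x])) \<partial>M) =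
        ennreal (dw \<gamma>) * (?U ?u + ?M ?u)"
      by (simp only: distrib_left)
  qed
  also have "\<dots> = detailed n ?U + detailed n ?M"
    by (rule detailed_add[OF U Mm])
  finally show ?thesis .
qed

text \<open>The summand \<open>j\<close> is the contribution of the lists whose last unmatched element is preceded
  by \<open>j\<close> elements and followed by \<open>n - 1 - j\<close> matched ones.\<close>

lemma detailed_expand:
  assumes "h \<in> borel_measurable S" "h [] = 0"
  shows "detailed n h = (\<Sum>j<n. detailed j (arrive (\<lambda>\<eta>. ennreal (scale \<eta>) * (ennreal (stay \<eta>) ^ (n - 1 - j) * h \<eta>))))"
  using assms
proof (induction n arbitrary: h)
  case 0
  then show ?case by (simp add: list_integral_0)
next
  case (Suc n)
  note [measurable] = Suc.prems(1)
  have "detailed (Suc n) h = detailed n (arrive (\<lambda>\<eta>. ennreal (scale \<eta>) * h \<eta>)) +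
    detailed n (\<lambda>\<eta>. (if \<eta> = [] then 0 else ennreal (stay \<eta>)) * h \<eta>)"
    by (rule detailed_Suc[OF Suc.prems(1)])
  also have "detailed n (\<lambda>\<eta>. (if \<eta> = [] then 0 else ennreal (stay \<eta>)) * h \<eta>) = detailed n (\<lambda>\<eta>. ennreal (stay \<eta>) * h \<eta>)"
    by (rule detailed_cong) (use Suc.prems(2) in auto)
  also have "\<dots> = (\<Sum>j<n. detailed j (arrive (\<lambda>\<eta>. ennreal (scale \<eta>) * (ennreal (stay \<eta>) ^ (n - 1 - j) * (ennreal (stay \<eta>) * h \<eta>)))))"
    by (rule Suc.IH) (use Suc.prems(2) in simp_all)
  also have "\<dots> = (\<Sum>j<n. detailed j (arrive (\<lambda>\<eta>. ennreal (scale \<eta>) * (ennreal (stay \<eta>) ^ (n - j) * h \<eta>))))"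
  proof (rule sum.cong)
    fix j assume "j \<in> {..<n}"
    then have "n - j = Suc (n - 1 - j)" by auto
    then have "ennreal (stay \<eta>) ^ (n - 1 - j) * (ennreal (stay \<eta>) * h \<eta>) = ennreal (stay \<eta>) ^ (n - j) * h \<eta>" for \<eta>
      by (simp only: power_Suc2 mult.assoc)
    then show "detailed j (arrive (\<lambda>\<eta>. ennreal (scale \<eta>) * (ennreal (stay \<eta>) ^ (n - 1 - j) * (ennreal (stay \<eta>) * h \<eta>)))) =
        detailed j (arrive (\<lambda>\<eta>. ennreal (scale \<eta>) * (ennreal (stay \<eta>) ^ (n - j) * h \<eta>)))"
      by (simp only:)
  qed simp
  finally show ?case by (simp add: add.commute)
qed

lemma arrive_suminf:
  assumes "\<And>i. h i \<in> borel_measurable S" "\<eta> \<in> space S"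
  shows "arrive (\<lambda>\<eta>. \<Sum>i. h i \<eta>) \<eta> = (\<Sum>i. arrive (h i) \<eta>)"
proof -
  have [measurable]: "(\<lambda>x. indicator (- N \<eta>) x :: ennreal) \<in> borel_measurable C"
    unfolding indicator_compl by measurable
  note [measurable] = measurable_snoc_fixed[OF assms(2) assms(1)]
  have "arrive (\<lambda>\<eta>. \<Sum>i. h i \<eta>) \<eta> = (\<integral>\<^sup>+ x. (\<Sum>i. indicator (- N \<eta>) x * h i (\<eta> @ [x])) \<partial>C)"
    by (simp add: arrive_def ennreal_suminf_cmult)
  also have "\<dots> = (\<Sum>i. arrive (h i) \<eta>)"
    unfolding arrive_def by (rule nn_integral_suminf) measurable
  finally show ?thesis .
qed

text \<open>The gap \<open>1 - stay \<eta>\<close> is \<open>scale \<eta>\<close> times the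
  denominator on the right, so the factors \<open>scale \<eta>\<close> cancel. For the empty list
  the ratio is 1 as soon as \<open>L > 0\<close>, and the series diverges.\<close>

lemma scale_geometric:
  assumes "\<eta> \<noteq> []"
  shows "ennreal (scale \<eta>) * (\<Sum>m. ennreal (stay \<eta>) ^ m) = ennreal (1 / (measure C (N \<eta>) + real (length \<eta>) * mu))"
proof -
  let ?H = "2 * L + real (length \<eta>) * mu" and ?G = "measure C (N \<eta>) + real (length \<eta>) * mu"
  have len: "real (length \<eta>) * mu > 0" using assms mu_pos by simp
  then have G: "?G > 0" and H: "?H > 0" by (simp_all add: add_nonneg_pos)
  have 1: "1 - stay \<eta> = ?G * scale \<eta>" using H by (simp add: stay_def scale_def field_simps)
  have sc: "scale \<eta> > 0" using H by (simp add: scale_def)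
  have st: "stay \<eta> < 1" using 1 G sc by (metis diff_gt_0_iff_gt mult_pos_pos)
  have "(\<Sum>m. ennreal (stay \<eta>) ^ m) = (\<Sum>m. ennreal (stay \<eta> ^ m))" by (simp add: ennreal_power)
  also have "\<dots> = ennreal (\<Sum>m. stay \<eta> ^ m)"
    by (rule suminf_ennreal2) (use st in \<open>simp_all add: summable_geometric\<close>)
  also have "(\<Sum>m. stay \<eta> ^ m) = 1 / (?G * scale \<eta>)"
    using st by (simp add: suminf_geometric 1)
  finally have "ennreal (scale \<eta>) * (\<Sum>m. ennreal (stay \<eta>) ^ m) = ennreal (scale \<eta> * (1 / (?G * scale \<eta>)))"
    using G sc by (subst ennreal_mult) auto
  also have "scale \<eta> * (1 / (?G * scale \<eta>)) = 1 / ?G" using sc by simp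
  finally show ?thesis .
qed

text \<open>With \<open>h [] = 0\<close> every contributing list has a last unmatched element. The
  matched elements behind it are summed out at once, by exchanging nonnegative sums, while
  everything before it stays a detailed list.\<close>

lemma suminf_detailed_step:
  assumes h: "h \<in> borel_measurable S" and "h [] = 0"
  shows "(\<Sum>n. detailed n h) =
    (\<Sum>n. detailed n (arrive (\<lambda>\<eta>. ennreal (1 / (measure C (N \<eta>) + real (length \<eta>) * mu)) * h \<eta>)))"
proof -
  note [measurable] = h
  define H where "H m \<eta> = ennreal (scale \<eta>) * (ennreal (stay \<eta>) ^ m * h \<eta>)" for m \<eta>
  have H: "H m \<in> borel_measurable S" for m unfolding H_def by measurable
  have "(\<Sum>n. detailed n h) = (\<Sum>n. \<Sum>j<n. detailed j (arrive (H (n - 1 - j))))"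
    unfolding H_def by (intro suminf_cong detailed_expand assms)
  also have "\<dots> = (\<Sum>j. \<Sum>m. detailed j (arrive (H m)))"
    by (rule suminf_convolution_ennreal)
  also have "\<dots> = (\<Sum>j. detailed j (\<lambda>\<eta>. \<Sum>m. arrive (H m) \<eta>))"
    by (intro suminf_cong detailed_suminf[symmetric] measurable_arrive H)
  also have "\<dots> = (\<Sum>j. detailed j (arrive (\<lambda>\<eta>. \<Sum>m. H m \<eta>)))"
    by (intro suminf_cong detailed_cong) (simp only: arrive_suminf[OF H])
  also have "arrive (\<lambda>\<eta>. \<Sum>m. H m \<eta>) = arrive (\<lambda>\<eta>. ennreal (1 / (measure C (N \<eta>) + real (length \<eta>) * mu)) * h \<eta>)"
  proof -
    \<comment> \<open>\<open>arrive\<close> evaluates its argument only at lists of the form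
      \<open>\<eta> @ [x]\<close>, so the empty list, where the series may diverge, never
      enters.\<close>
    have "(\<Sum>m. H m \<eta>) = ennreal (1 / (measure C (N \<eta>) + real (length \<eta>) * mu)) * h \<eta>" if "\<eta> \<noteq> []" for \<eta>
      unfolding scale_geometric[OF that, symmetric] H_def
      by (simp add: ennreal_suminf_cmult ennreal_suminf_multc mult.assoc)
    then show ?thesis unfolding arrive_def by simp
  qed
  finally show ?thesis .
qed

text \<open>This is the arrival relation with the last denominator moved into the test function, so
  that weighted integrals over valid lists obey the same recursion as the sums over detailed
  lists.\<close>

lemma list_integral_vwt_Suc:
  assumes h: "h \<in> borel_measurable S"
  shows "list_integral C (Suc k) (\<lambda>\<gamma>. ennreal (vwt \<gamma>) * h \<gamma>) =
    list_integral C k (\<lambda>\<gamma>. ennreal (vwt \<gamma>) * arrive (\<lambda>\<eta>. ennreal (1 / (measure C (N \<eta>) + real (length \<eta>) * mu)) * h \<eta>) \<gamma>)"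
proof -
  note [measurable] = h
  let ?h = "\<lambda>\<eta>. ennreal (1 / (measure C (N \<eta>) + real (length \<eta>) * mu)) * h \<eta>"
  have "list_integral C k (\<lambda>\<gamma>. ennreal (vwt \<gamma>) * arrive ?h \<gamma>) =
    list_integral C (Suc k) (\<lambda>\<gamma>. ennreal (vwt \<gamma>) * ennreal (measure C (N \<gamma>) + real (length \<gamma>) * mu) * ?h \<gamma>)"
    unfolding arrive_def by (rule list_integral_arrivals) measurable
  also have "\<dots> = list_integral C (Suc k) (\<lambda>\<gamma>. ennreal (vwt \<gamma>) * h \<gamma>)"
  proof (rule list_integral_cong)
    fix \<gamma> :: "('a \<times> color) list" assume "length \<gamma> = Suc k"
    then have pos: "measure C (N \<gamma>) + real (length \<gamma>) * mu > 0" using mu_pos by (simp add: add_nonneg_pos)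
    then have "ennreal (measure C (N \<gamma>) + real (length \<gamma>) * mu) * ennreal (1 / (measure C (N \<gamma>) + real (length \<gamma>) * mu)) = 1"
      by (subst ennreal_mult[symmetric]) auto
    then show "ennreal (vwt \<gamma>) * ennreal (measure C (N \<gamma>) + real (length \<gamma>) * mu) * ?h \<gamma> = ennreal (vwt \<gamma>) * h \<gamma>"
      by (metis mult.assoc mult_1_left)
  qed
  finally show ?thesis by (rule sym)
qed

text \<open>Both sides transform alike when \<open>h\<close> is replaced by the function under
  \<open>arrive\<close>, and this replacement lowers the length on which \<open>h\<close> lives from
  \<open>Suc k\<close> to \<open>k\<close>.\<close>

lemma suminf_detailed:
  assumes "h \<in> borel_measurable S" "\<And>\<eta>. length \<eta> \<noteq> k \<Longrightarrow> h \<eta> = 0"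
  shows "(\<Sum>n. detailed n h) = list_integral C k (\<lambda>\<gamma>. ennreal (vwt \<gamma>) * h \<gamma>)"
  using assms
proof (induction k arbitrary: h)
  case 0
  \<comment> \<open>Here \<open>h\<close> lives on the empty list only, and a nonempty
    detailed-valid list always has an unmatched element; just the empty detailed list
    contributes.\<close>
  have "detailed (Suc n) h = list_integral M (Suc n) (\<lambda>\<gamma>. 0)" for n
  proof (rule list_integral_cong)
    fix \<gamma> :: "'a marked list" assume "length \<gamma> = Suc n"
    then have "detailed_valid \<gamma> \<Longrightarrow> unmatched \<gamma> \<noteq> []" using unmatched_nonempty by fastforce
    then show "ennreal (dw \<gamma>) * h (unmatched \<gamma>) = 0"
      using 0(2) by (cases "detailed_valid \<gamma>") (simp_all add: detailed_weight_def)
  qed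
  then have "detailed (Suc n) h = 0" for n by (simp add: list_integral_def)
  then show ?case
    by (subst suminf_Suc_ennreal) (simp add: list_integral_0 dw_Nil vwt_Nil)
next
  case (Suc k)
  note [measurable] = Suc.prems(1)
  have "(\<Sum>n. detailed n h) = (\<Sum>n. detailed n (arrive (\<lambda>\<eta>. ennreal (1 / (measure C (N \<eta>) + real (length \<eta>) * mu)) * h \<eta>)))"
    by (rule suminf_detailed_step) (use Suc.prems in simp_all)
  also have "\<dots> = list_integral C k (\<lambda>\<gamma>. ennreal (vwt \<gamma>) * arrive (\<lambda>\<eta>. ennreal (1 / (measure C (N \<eta>) + real (length \<eta>) * mu)) * h \<eta>) \<gamma>)"
  proof (rule Suc.IH)
    show "arrive (\<lambda>\<eta>. ennreal (1 / (measure C (N \<eta>) + real (length \<eta>) * mu)) * h \<eta>) \<in> borel_measurable S"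
      by measurable
    show "arrive (\<lambda>\<eta>. ennreal (1 / (measure C (N \<eta>) + real (length \<eta>) * mu)) * h \<eta>) \<eta> = 0" if "length \<eta> \<noteq> k" for \<eta>
      using that Suc.prems(2) by (simp add: arrive_def)
  qed
  also have "\<dots> = list_integral C (Suc k) (\<lambda>\<gamma>. ennreal (vwt \<gamma>) * h \<gamma>)"
    by (rule list_integral_vwt_Suc[symmetric]) fact
  finally show ?case .
qed

text \<open>Detailed lists are sorted by their number \<open>k\<close> of unmatched elements, which
  become a valid list of length \<open>k\<close> once the matched ones are integrated out.\<close>

theorem suminf_detailed_weight: "(\<Sum>n. list_integral M n (\<lambda>\<gamma>. ennreal (dw \<gamma>))) = (\<Sum>k. Z k)"
proof -
  define e where "e k \<eta> = (if length \<eta> = k then 1 else 0 :: ennreal)" for k and \<eta> :: "('a \<times> color) list"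
  have e: "e k \<in> borel_measurable S" for k unfolding e_def by measurable
  have "(\<Sum>k. e k \<eta>) = 1" for \<eta>
    unfolding e_def by (subst suminf_finite[of "{length \<eta>}"]) auto
  then have "(\<Sum>n. list_integral M n (\<lambda>\<gamma>. ennreal (dw \<gamma>))) = (\<Sum>n. detailed n (\<lambda>\<eta>. \<Sum>k. e k \<eta>))"
    by simp
  also have "\<dots> = (\<Sum>n. \<Sum>k. detailed n (e k))"
    by (simp only: detailed_suminf[OF e])
  also have "\<dots> = (\<Sum>k. \<Sum>n. detailed n (e k))"
    by (rule suminf_swap_ennreal)
  also have "\<dots> = (\<Sum>k. list_integral C k (\<lambda>\<gamma>. ennreal (vwt \<gamma>) * e k \<gamma>))"
    by (intro suminf_cong suminf_detailed e) (simp add: e_def)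
  also have "\<dots> = (\<Sum>k. Z k)"
    by (intro suminf_cong list_integral_cong) (simp add: e_def)
  finally show ?thesis .
qed

end

theorem corollary2p4:
  fixes D :: "'a::metric_space set" and lam :: "'a measure" and mu :: real
  assumes "compact D" and "radon_measure_on D lam" and "mu > 0"
  shows "\<exists>K::real. K > 0 \<and>
    ennreal (1 / K) =
      (\<Sum>n. \<integral>\<^sup>+ f. ennreal (detailed_weight D lam mu (map f [0..<n]))
              \<partial>(\<Pi>\<^sub>M i\<in>{..<n}. marked_measure lam)) \<and>
    (\<forall>\<nu>. stationary_distribution (fifm_states lam) (fifm_rates D lam mu) \<nu> \<longleftrightarrow>
          \<nu> = density (fifm_states lam) (\<lambda>\<gamma>. ennreal (fifm_density D lam mu K \<gamma>)))"
proof -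
  interpret fifm D lam mu by unfold_locales (rule assms)+
  \<comment> \<open>The empty list alone has weight 1, which bounds the total weight
    \<open>r\<close> away from 0; so \<open>1 / r\<close> is a legitimate choice for
    \<open>K\<close>.\<close>
  obtain r where r: "(\<Sum>n. Z n) = ennreal r" "1 \<le> r"
    using suminf_Z_ge suminf_Z_finite by (cases "\<Sum>n. Z n") (auto simp: ennreal_le_iff2)
  show ?thesis
  proof (intro exI[of _ "1 / r"] conjI allI)
    show "1 / r > 0" using r(2) by simp
    show "ennreal (1 / (1 / r)) = (\<Sum>n. \<integral>\<^sup>+ f. ennreal (detailed_weight D lam mu (map f [0..<n])) \<partial>(\<Pi>\<^sub>M i\<in>{..<n}. marked_measure lam))"
      using suminf_detailed_weight r(1) by (simp add: list_integral_def)
    show "stationary_distribution (fifm_states lam) (fifm_rates D lam mu) \<nu> \<longleftrightarrow>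
        \<nu> = density (fifm_states lam) (\<lambda>\<gamma>. ennreal (fifm_density D lam mu (1 / r) \<gamma>))" for \<nu>
      using r by (intro stationary_distribution_iff) simp_all
  qed
qed

end
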